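(* Let $k$ be a field containing all roots of unity. For $q\in k$ let $\Lambda_q=k\langle x,y\rangle/(x^2,\,xy+qyx,\,y^2)$. Then the gap of zero Hochschild cohomology groups of $\Lambda_q$ from degree $3$ to the first non-zero group thereafter can be made arbitrarily large by choosing $q$ to be a primitive $r$-th root of unity for large $r$. That is: for every integer $N\ge 3$ there is an integer $R$ such that for every $r\ge R$ and every primitive $r$-th root of unity $q\in k$ one has $\mathrm{HH}^n(\Lambda_q)=0$ for all $3\le n\le N$, while $\mathrm{HH}^n(\Lambda_q)\neq 0$ for some $n>N$.
   Context: $k\langle x,y\rangle$ is the free associative (non-commutative) $k$-algebra on $x,y$, and $(\dots)$ denotes the two-sided ideal generated by the listed elements. The enveloping algebra of a $k$-algebra $\Lambda$ is $\Lambda^e=\Lambda^{\mathrm{op}}\otimes_k\Lambda$, and $\mathrm{HH}^n(\Lambda)=\mathrm{Ext}^n_{\Lambda^e}(\Lambda,\Lambda)$. "Contains all roots of unity" means that $k$ contains all roots of unity of its algebraic closure; a primitive $r$-th root of unity is an element of multiplicative order exactly $r$. *)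

theory Defs
  imports "HOL-Algebra.Algebra" "HOL-Algebra.Algebraic_Closure_Type"
begin

section \<open>Algebras over a field\<close>

text \<open>
  The ground field \<open>k\<close> is a type of class \<^class>\<open>field\<close>. An associative, not necessarily
  commutative, \<open>k\<close>-algebra is given by the record \<^typ>\<open>('k, 'a) module\<close>, whose fields are
  exactly the ring operations and the scalar multiplication. (The locale \<open>algebra\<close> of
  HOL-Algebra is not applicable, since it demands a commutative ring.)
\<close>

definition monoid_alg :: "('m, 'z) monoid_scheme \<Rightarrow> ('k::field, 'm \<Rightarrow> 'k) module"
  where "monoid_alg G =
    \<lparr>carrier = {f. finite {a. f a \<noteq> 0} \<and> {a. f a \<noteq> 0} \<subseteq> carrier G},
     monoid.mult = (\<lambda>f g c. \<Sum>(a, b) \<in> {(a, b). f a \<noteq> 0 \<and> g b \<noteq> 0 \<and> a \<otimes>\<^bsub>G\<^esub> b = c}. f a * g b),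
     monoid.one = (\<lambda>c. if c = \<one>\<^bsub>G\<^esub> then 1 else 0),
     ring.zero = (\<lambda>c. 0),
     ring.add = (\<lambda>f g c. f c + g c),
     module.smult = (\<lambda>t f c. t * f c)\<rparr>"

definition basis_elem :: "'m \<Rightarrow> 'm \<Rightarrow> 'k::field"
  where "basis_elem a = (\<lambda>c. if c = a then 1 else 0)"

definition quot_alg :: "('k, 'a) module \<Rightarrow> 'a set \<Rightarrow> ('k, 'a set) module"
  where "quot_alg A I =
    \<lparr>carrier = carrier (A Quot I),
     monoid.mult = monoid.mult (A Quot I),
     monoid.one = monoid.one (A Quot I),
     ring.zero = ring.zero (A Quot I),
     ring.add = ring.add (A Quot I),
     module.smult = (\<lambda>t U. \<Union>x\<in>U. I +>\<^bsub>A\<^esub> (t \<odot>\<^bsub>A\<^esub> x))\<rparr>"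

definition opposite_alg :: "('k, 'a) module \<Rightarrow> ('k, 'a) module"
  where "opposite_alg A = A\<lparr>monoid.mult := (\<lambda>a b. b \<otimes>\<^bsub>A\<^esub> a)\<rparr>"

text \<open>
  The tensor product \<open>A \<otimes>\<^sub>k B\<close>: the vector space with basis \<open>A \<times> B\<close>, modulo the bilinearity
  relations. Since the multiplication \<open>(a \<otimes> b)(a' \<otimes> b') = aa' \<otimes> bb'\<close> is that of the algebra of
  the multiplicative monoid \<open>A \<times> B\<close>, and the linear span of the relations is a two-sided ideal
  of it, one can divide by the ideal that they generate.
\<close>

definition bilinearity_relations ::
    "('k::field, 'a) module \<Rightarrow> ('k, 'b) module \<Rightarrow> ('a \<times> 'b \<Rightarrow> 'k) set"
  where "bilinearity_relations A B =
    (let F = monoid_alg (A \<times>\<times> B); t = (\<lambda>a b. basis_elem (a, b)) in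
       {t (a \<oplus>\<^bsub>A\<^esub> a') b \<ominus>\<^bsub>F\<^esub> (t a b \<oplus>\<^bsub>F\<^esub> t a' b) | a a' b.
          a \<in> carrier A \<and> a' \<in> carrier A \<and> b \<in> carrier B} \<union>
       {t a (b \<oplus>\<^bsub>B\<^esub> b') \<ominus>\<^bsub>F\<^esub> (t a b \<oplus>\<^bsub>F\<^esub> t a b') | a b b'.
          a \<in> carrier A \<and> b \<in> carrier B \<and> b' \<in> carrier B} \<union>
       {t (c \<odot>\<^bsub>A\<^esub> a) b \<ominus>\<^bsub>F\<^esub> c \<odot>\<^bsub>F\<^esub> t a b | c a b. a \<in> carrier A \<and> b \<in> carrier B} \<union>
       {t a (c \<odot>\<^bsub>B\<^esub> b) \<ominus>\<^bsub>F\<^esub> c \<odot>\<^bsub>F\<^esub> t a b | c a b. a \<in> carrier A \<and> b \<in> carrier B})"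

definition tensor_alg ::
    "('k::field, 'a) module \<Rightarrow> ('k, 'b) module \<Rightarrow> ('k, ('a \<times> 'b \<Rightarrow> 'k) set) module"
  where "tensor_alg A B =
    (let F = monoid_alg (A \<times>\<times> B) in quot_alg F (Idl\<^bsub>F\<^esub> (bilinearity_relations A B)))"

definition enveloping_alg ::
    "('k::field, 'a) module \<Rightarrow> ('k, ('a \<times> 'a \<Rightarrow> 'k) set) module"
  where "enveloping_alg A = tensor_alg (opposite_alg A) A"

text \<open>
  \<open>A\<close> as a left module over its enveloping algebra: \<open>(a \<otimes> b) \<cdot> m = b m a\<close>. An element of the
  enveloping algebra is a coset; on it the linear extension of this formula is constant.
\<close>

definition bimodule_of_alg ::
    "('k::field, 'a) module \<Rightarrow> (('a \<times> 'a \<Rightarrow> 'k) set, 'a) module"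
  where "bimodule_of_alg A =
    \<lparr>carrier = carrier A,
     monoid.mult = monoid.mult A,
     monoid.one = monoid.one A,
     ring.zero = ring.zero A,
     ring.add = ring.add A,
     module.smult = (\<lambda>\<xi> m. the_elem
       ((\<lambda>f. \<Oplus>\<^bsub>A\<^esub>p \<in> {p. f p \<noteq> 0}. f p \<odot>\<^bsub>A\<^esub> (snd p \<otimes>\<^bsub>A\<^esub> m \<otimes>\<^bsub>A\<^esub> fst p)) ` \<xi>))\<rparr>"


section \<open>Ext over a not necessarily commutative ring\<close>

locale left_module = R?: ring R + M?: abelian_group M
  for R :: "('r, 'z) ring_scheme" (structure) and M :: "('r, 'm) module" (structure) +
  assumes smult_closed [simp, intro]:
      "\<lbrakk>a \<in> carrier R; x \<in> carrier M\<rbrakk> \<Longrightarrow> a \<odot>\<^bsub>M\<^esub> x \<in> carrier M"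
    and smult_l_distr:
      "\<lbrakk>a \<in> carrier R; b \<in> carrier R; x \<in> carrier M\<rbrakk> \<Longrightarrow>
       (a \<oplus> b) \<odot>\<^bsub>M\<^esub> x = a \<odot>\<^bsub>M\<^esub> x \<oplus>\<^bsub>M\<^esub> b \<odot>\<^bsub>M\<^esub> x"
    and smult_r_distr:
      "\<lbrakk>a \<in> carrier R; x \<in> carrier M; y \<in> carrier M\<rbrakk> \<Longrightarrow>
       a \<odot>\<^bsub>M\<^esub> (x \<oplus>\<^bsub>M\<^esub> y) = a \<odot>\<^bsub>M\<^esub> x \<oplus>\<^bsub>M\<^esub> a \<odot>\<^bsub>M\<^esub> y"
    and smult_assoc1:
      "\<lbrakk>a \<in> carrier R; b \<in> carrier R; x \<in> carrier M\<rbrakk> \<Longrightarrow>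
       (a \<otimes> b) \<odot>\<^bsub>M\<^esub> x = a \<odot>\<^bsub>M\<^esub> (b \<odot>\<^bsub>M\<^esub> x)"
    and smult_one [simp]:
      "x \<in> carrier M \<Longrightarrow> \<one> \<odot>\<^bsub>M\<^esub> x = x"

definition free_left_module :: "('r, 'z) ring_scheme \<Rightarrow> ('r, 'p) module \<Rightarrow> bool"
  where "free_left_module R P \<longleftrightarrow> left_module R P \<and>
    (\<exists>B \<subseteq> carrier P. \<forall>x \<in> carrier P. \<exists>!c. c \<in> B \<rightarrow>\<^sub>E carrier R \<and>
       finite {b \<in> B. c b \<noteq> \<zero>\<^bsub>R\<^esub>} \<and> x = (\<Oplus>\<^bsub>P\<^esub>b \<in> {b \<in> B. c b \<noteq> \<zero>\<^bsub>R\<^esub>}. c b \<odot>\<^bsub>P\<^esub> b))"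

definition left_module_hom ::
    "('r, 'z) ring_scheme \<Rightarrow> ('r, 'p) module \<Rightarrow> ('r, 'm) module \<Rightarrow> ('p \<Rightarrow> 'm) set"
  where "left_module_hom R P M =
    {f \<in> carrier P \<rightarrow>\<^sub>E carrier M.
      (\<forall>x \<in> carrier P. \<forall>y \<in> carrier P. f (x \<oplus>\<^bsub>P\<^esub> y) = f x \<oplus>\<^bsub>M\<^esub> f y) \<and>
      (\<forall>a \<in> carrier R. \<forall>x \<in> carrier P. f (a \<odot>\<^bsub>P\<^esub> x) = a \<odot>\<^bsub>M\<^esub> f x)}"

text \<open>
  An exact sequence \<open>\<dots> \<rightarrow> P 2 \<rightarrow> P 1 \<rightarrow> P 0 \<rightarrow> M \<rightarrow> 0\<close> of left modules with all \<open>P n\<close> free;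
  \<open>d n\<close> is the differential from \<open>P (n + 1)\<close> to \<open>P n\<close>.
\<close>

definition free_resolution ::
    "('r, 'z) ring_scheme \<Rightarrow> ('r, 'm) module \<Rightarrow>
     (nat \<Rightarrow> ('r, 'p) module) \<Rightarrow> (nat \<Rightarrow> 'p \<Rightarrow> 'p) \<Rightarrow> ('p \<Rightarrow> 'm) \<Rightarrow> bool"
  where "free_resolution R M P d e \<longleftrightarrow>
    (\<forall>n. free_left_module R (P n)) \<and>
    e \<in> left_module_hom R (P 0) M \<and>
    (\<forall>n. d n \<in> left_module_hom R (P (Suc n)) (P n)) \<and>
    e ` carrier (P 0) = carrier M \<and>
    d 0 ` carrier (P 1) = {x \<in> carrier (P 0). e x = \<zero>\<^bsub>M\<^esub>} \<and>
    (\<forall>n. d (Suc n) ` carrier (P (Suc (Suc n))) =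
           {x \<in> carrier (P (Suc n)). d n x = \<zero>\<^bsub>P n\<^esub>})"

definition cochain_group ::
    "('r, 'z) ring_scheme \<Rightarrow> ('r, 'p) module \<Rightarrow> ('r, 'n) module \<Rightarrow> ('p \<Rightarrow> 'n) monoid"
  where "cochain_group R P N =
    \<lparr>carrier = left_module_hom R P N,
     monoid.mult = (\<lambda>f g. \<lambda>x\<in>carrier P. f x \<oplus>\<^bsub>N\<^esub> g x),
     monoid.one = (\<lambda>x\<in>carrier P. \<zero>\<^bsub>N\<^esub>)\<rparr>"

definition cocycles ::
    "('r, 'z) ring_scheme \<Rightarrow> (nat \<Rightarrow> ('r, 'p) module) \<Rightarrow> (nat \<Rightarrow> 'p \<Rightarrow> 'p) \<Rightarrow>
     ('r, 'n) module \<Rightarrow> nat \<Rightarrow> ('p \<Rightarrow> 'n) set"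
  where "cocycles R P d N n =
    {f \<in> left_module_hom R (P n) N.
       compose (carrier (P (Suc n))) f (d n) = \<one>\<^bsub>cochain_group R (P (Suc n)) N\<^esub>}"

fun coboundaries ::
    "('r, 'z) ring_scheme \<Rightarrow> (nat \<Rightarrow> ('r, 'p) module) \<Rightarrow> (nat \<Rightarrow> 'p \<Rightarrow> 'p) \<Rightarrow>
     ('r, 'n) module \<Rightarrow> nat \<Rightarrow> ('p \<Rightarrow> 'n) set"
  where
    "coboundaries R P d N 0 = {\<one>\<^bsub>cochain_group R (P 0) N\<^esub>}"
  | "coboundaries R P d N (Suc n) =
       (\<lambda>g. compose (carrier (P (Suc n))) g (d n)) ` left_module_hom R (P n) N"

text \<open>The cohomology group in degree \<open>n\<close> of the complex \<open>Hom\<^sub>R(P, N)\<close>.\<close>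

definition Hom_cohomology ::
    "('r, 'z) ring_scheme \<Rightarrow> (nat \<Rightarrow> ('r, 'p) module) \<Rightarrow> (nat \<Rightarrow> 'p \<Rightarrow> 'p) \<Rightarrow>
     ('r, 'n) module \<Rightarrow> nat \<Rightarrow> ('p \<Rightarrow> 'n) set monoid"
  where "Hom_cohomology R P d N n =
    cochain_group R (P n) N\<lparr>carrier := cocycles R P d N n\<rparr> Mod coboundaries R P d N n"

text \<open>
  \<open>Ext\<^sup>n\<^sub>R(M, N)\<close> is computed from a chosen free resolution of \<open>M\<close>; up to isomorphism it does not
  depend on the choice. The modules of the resolution have to live in one fixed type. The type
  of functions from \<open>X = ('r + 'm) list\<close> to \<open>'r\<close> is large enough for every \<open>R\<close> and \<open>M\<close>: the
  finitely supported functions \<open>X \<rightarrow> R\<close> are in bijection with a subset of the infinite type \<open>X\<close>,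
  so that, step by step, every syzygy of \<open>M\<close> is generated by a family indexed by a subset of \<open>X\<close>.
\<close>

type_synonym ('r, 'm) resolution_carrier = "('r + 'm) list \<Rightarrow> 'r"

definition Ext ::
    "('r, 'z) ring_scheme \<Rightarrow> ('r, 'm) module \<Rightarrow> ('r, 'n) module \<Rightarrow> nat \<Rightarrow>
     (('r, 'm) resolution_carrier \<Rightarrow> 'n) set monoid"
  where "Ext R M N n =
    (let (P, d, e) = (SOME (P, d, e). free_resolution R M P d e)
     in Hom_cohomology R P d N n)"

definition HH ::
    "('k::field, 'a) module \<Rightarrow> nat \<Rightarrow>
     ((('a \<times> 'a \<Rightarrow> 'k) set, 'a) resolution_carrier \<Rightarrow> 'a) set monoid"
  where "HH A n = Ext (enveloping_alg A) (bimodule_of_alg A) (bimodule_of_alg A) n"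


section \<open>The algebras \<open>k\<langle>x,y\<rangle>/(x\<^sup>2, xy + qyx, y\<^sup>2)\<close>\<close>

datatype letter = Letter_x | Letter_y

definition word_monoid :: "letter list monoid"
  where "word_monoid = \<lparr>carrier = UNIV, monoid.mult = (@), monoid.one = []\<rparr>"

definition free_alg_xy :: "('k::field, letter list \<Rightarrow> 'k) module"
  where "free_alg_xy = monoid_alg word_monoid"

definition \<Lambda> :: "'k::field \<Rightarrow> ('k, (letter list \<Rightarrow> 'k) set) module"
  where "\<Lambda> q =
    (let F = free_alg_xy; x = basis_elem [Letter_x]; y = basis_elem [Letter_y] in
       quot_alg F (Idl\<^bsub>F\<^esub> {x \<otimes>\<^bsub>F\<^esub> x, x \<otimes>\<^bsub>F\<^esub> y \<oplus>\<^bsub>F\<^esub> q \<odot>\<^bsub>F\<^esub> (y \<otimes>\<^bsub>F\<^esub> x), y \<otimes>\<^bsub>F\<^esub> y}))"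

definition primitive_root_of_unity :: "nat \<Rightarrow> 'k::field \<Rightarrow> bool"
  where "primitive_root_of_unity r q \<longleftrightarrow>
    0 < r \<and> q ^ r = 1 \<and> (\<forall>m. 0 < m \<and> m < r \<longrightarrow> q ^ m \<noteq> 1)"


section \<open>The notions above are well defined\<close>

text \<open>
  \<open>\<Lambda> q\<close> and the enveloping algebra of a \<open>k\<close>-algebra are \<open>k\<close>-algebras, every \<open>k\<close>-algebra is a left
  module over its enveloping algebra, and every left module has a free resolution of the type
  used for \<^const>\<open>Ext\<close>.
\<close>

abbreviation (input) supp :: "('m \<Rightarrow> 'k::field) \<Rightarrow> 'm set"
  where "supp f \<equiv> {a. f a \<noteq> 0}"

lemma monoid_alg_mult_eq:
  assumes "finite A" "finite B" "supp f \<subseteq> A" "supp g \<subseteq> B"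
  shows "(f \<otimes>\<^bsub>monoid_alg G\<^esub> g) c = (\<Sum>a\<in>A. \<Sum>b\<in>B. if a \<otimes>\<^bsub>G\<^esub> b = c then f a * g b else 0)"
proof -
  have "(f \<otimes>\<^bsub>monoid_alg G\<^esub> g) c =
     (\<Sum>(a, b) \<in> {(a, b). f a \<noteq> 0 \<and> g b \<noteq> 0 \<and> a \<otimes>\<^bsub>G\<^esub> b = c}. f a * g b)"
    by (simp add: monoid_alg_def)
  also have "\<dots> = (\<Sum>(a, b) \<in> A \<times> B. if a \<otimes>\<^bsub>G\<^esub> b = c then f a * g b else 0)"
    by (rule sum.mono_neutral_cong_left) (use assms in \<open>auto split: if_splits\<close>)
  also have "\<dots> = (\<Sum>a\<in>A. \<Sum>b\<in>B. if a \<otimes>\<^bsub>G\<^esub> b = c then f a * g b else 0)"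
    by (simp add: sum.cartesian_product)
  finally show ?thesis .
qed

lemma monoid_alg_carrier: "f \<in> carrier (monoid_alg G) \<longleftrightarrow> finite (supp f) \<and> supp f \<subseteq> carrier G"
  by (simp add: monoid_alg_def)

lemma monoid_alg_mult_supp:
  "supp (f \<otimes>\<^bsub>monoid_alg G\<^esub> g) \<subseteq> (\<lambda>(a,b). a \<otimes>\<^bsub>G\<^esub> b) ` (supp f \<times> supp g)"
proof
  fix c assume "c \<in> supp (f \<otimes>\<^bsub>monoid_alg G\<^esub> g)"
  hence "(\<Sum>(a, b) \<in> {(a, b). f a \<noteq> 0 \<and> g b \<noteq> 0 \<and> a \<otimes>\<^bsub>G\<^esub> b = c}. f a * g b) \<noteq> 0"
    by (simp add: monoid_alg_def)
  hence "{(a, b). f a \<noteq> 0 \<and> g b \<noteq> 0 \<and> a \<otimes>\<^bsub>G\<^esub> b = c} \<noteq> {}"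
    using sum.empty by metis
  thus "c \<in> (\<lambda>(a,b). a \<otimes>\<^bsub>G\<^esub> b) ` (supp f \<times> supp g)" by auto
qed

lemma monoid_alg_ring:
  assumes "Group.monoid G"
  shows "ring (monoid_alg G :: ('k::field, 'm \<Rightarrow> 'k) module)"
proof -
  interpret G: Group.monoid G by fact
  let ?F = "monoid_alg G :: ('k, 'm \<Rightarrow> 'k) module"
  have add: "f \<oplus>\<^bsub>?F\<^esub> g = (\<lambda>c. f c + g c)" for f g by (simp add: monoid_alg_def)
  have zero: "\<zero>\<^bsub>?F\<^esub> = (\<lambda>c. 0)" by (simp add: monoid_alg_def)
  have one: "\<one>\<^bsub>?F\<^esub> = (\<lambda>c. if c = \<one>\<^bsub>G\<^esub> then 1 else 0)" by (simp add: monoid_alg_def)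
  have addc: "f \<oplus>\<^bsub>?F\<^esub> g \<in> carrier ?F" if "f \<in> carrier ?F" "g \<in> carrier ?F" for f g
  proof -
    have "supp (\<lambda>c. f c + g c) \<subseteq> supp f \<union> supp g" by auto
    thus ?thesis using that finite_subset[of "supp (\<lambda>c. f c + g c)" "supp f \<union> supp g"]
      unfolding monoid_alg_carrier add by blast
  qed
  have multc: "f \<otimes>\<^bsub>?F\<^esub> g \<in> carrier ?F" if "f \<in> carrier ?F" "g \<in> carrier ?F" for f g
  proof -
    have "finite (supp (f \<otimes>\<^bsub>?F\<^esub> g))"
      by (rule finite_subset[OF monoid_alg_mult_supp]) (use that in \<open>auto simp: monoid_alg_carrier\<close>)
    moreover have "supp (f \<otimes>\<^bsub>?F\<^esub> g) \<subseteq> carrier G"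
    proof -
      have "(\<lambda>(a,b). a \<otimes>\<^bsub>G\<^esub> b) ` (supp f \<times> supp g) \<subseteq> carrier G"
        using that unfolding monoid_alg_carrier by (auto intro!: G.m_closed)
      thus ?thesis by (rule subset_trans[OF monoid_alg_mult_supp])
    qed
    ultimately show ?thesis unfolding monoid_alg_carrier by (rule conjI)
  qed
  have assoc: "(f \<otimes>\<^bsub>?F\<^esub> g) \<otimes>\<^bsub>?F\<^esub> h = f \<otimes>\<^bsub>?F\<^esub> (g \<otimes>\<^bsub>?F\<^esub> h)"
    if "f \<in> carrier ?F" "g \<in> carrier ?F" "h \<in> carrier ?F" for f g h
  proof
    fix x
    let ?A = "supp f" let ?B = "supp g" let ?C = "supp h"
    have fin: "finite ?A" "finite ?B" "finite ?C" and sub: "?A \<subseteq> carrier G" "?B \<subseteq> carrier G" "?C \<subseteq> carrier G"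
      using that by (auto simp: monoid_alg_carrier)
    let ?D = "(\<lambda>(a,b). a \<otimes>\<^bsub>G\<^esub> b) ` (?A \<times> ?B)" let ?E = "(\<lambda>(a,b). a \<otimes>\<^bsub>G\<^esub> b) ` (?B \<times> ?C)"
    have "((f \<otimes>\<^bsub>?F\<^esub> g) \<otimes>\<^bsub>?F\<^esub> h) x =
      (\<Sum>d\<in>?D. \<Sum>c\<in>?C. if d \<otimes>\<^bsub>G\<^esub> c = x then (f \<otimes>\<^bsub>?F\<^esub> g) d * h c else 0)"
      by (rule monoid_alg_mult_eq[OF _ fin(3) monoid_alg_mult_supp subset_refl]) (use fin in blast)
    also have "\<dots> = (\<Sum>d\<in>?D. \<Sum>c\<in>?C. \<Sum>a\<in>?A. \<Sum>b\<in>?B. if d = a \<otimes>\<^bsub>G\<^esub> b then (if d \<otimes>\<^bsub>G\<^esub> c = x then f a * g b * h c else 0) else 0)"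
    proof (intro sum.cong refl)
      fix d c
      show "(if d \<otimes>\<^bsub>G\<^esub> c = x then (f \<otimes>\<^bsub>?F\<^esub> g) d * h c else 0) = (\<Sum>a\<in>?A. \<Sum>b\<in>?B. if d = a \<otimes>\<^bsub>G\<^esub> b then (if d \<otimes>\<^bsub>G\<^esub> c = x then f a * g b * h c else 0) else 0)"
      proof (cases "d \<otimes>\<^bsub>G\<^esub> c = x")
        case True
        thus ?thesis
          by (simp only: monoid_alg_mult_eq[OF fin(1,2) subset_refl subset_refl] sum_distrib_right if_True simp_thms)
             (intro sum.cong refl, auto)
      qed (auto intro!: sum.neutral)
    qed
    also have "\<dots> = (\<Sum>c\<in>?C. \<Sum>a\<in>?A. \<Sum>b\<in>?B. \<Sum>d\<in>?D. if d = a \<otimes>\<^bsub>G\<^esub> b then (if d \<otimes>\<^bsub>G\<^esub> c = x then f a * g b * h c else 0) else 0)"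
      by (rule trans[OF sum.swap sum.cong[OF refl trans[OF sum.swap sum.cong[OF refl sum.swap]]]])
    also have "\<dots> = (\<Sum>c\<in>?C. \<Sum>a\<in>?A. \<Sum>b\<in>?B. if a \<otimes>\<^bsub>G\<^esub> b \<otimes>\<^bsub>G\<^esub> c = x then f a * g b * h c else 0)"
    proof (intro sum.cong refl)
      fix c a b assume h: "c \<in> ?C" "a \<in> ?A" "b \<in> ?B"
      have "finite ?D" using fin by blast
      moreover have "a \<otimes>\<^bsub>G\<^esub> b \<in> ?D" using h by force
      ultimately show "(\<Sum>d\<in>?D. if d = a \<otimes>\<^bsub>G\<^esub> b then (if d \<otimes>\<^bsub>G\<^esub> c = x then f a * g b * h c else 0) else 0)
        = (if a \<otimes>\<^bsub>G\<^esub> b \<otimes>\<^bsub>G\<^esub> c = x then f a * g b * h c else 0)"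
        by (simp add: sum.delta)
    qed
    also have "\<dots> = (\<Sum>c\<in>?C. \<Sum>a\<in>?A. \<Sum>b\<in>?B. if a \<otimes>\<^bsub>G\<^esub> (b \<otimes>\<^bsub>G\<^esub> c) = x then f a * g b * h c else 0)"
    proof (intro sum.cong refl)
      fix c a b assume h: "c \<in> ?C" "a \<in> ?A" "b \<in> ?B"
      hence "a \<otimes>\<^bsub>G\<^esub> b \<otimes>\<^bsub>G\<^esub> c = a \<otimes>\<^bsub>G\<^esub> (b \<otimes>\<^bsub>G\<^esub> c)" using sub by (intro G.m_assoc) blast+
      thus "(if a \<otimes>\<^bsub>G\<^esub> b \<otimes>\<^bsub>G\<^esub> c = x then f a * g b * h c else 0) = (if a \<otimes>\<^bsub>G\<^esub> (b \<otimes>\<^bsub>G\<^esub> c) = x then f a * g b * h c else 0)"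
        by simp
    qed
    also have "\<dots> = (\<Sum>a\<in>?A. \<Sum>b\<in>?B. \<Sum>c\<in>?C. if a \<otimes>\<^bsub>G\<^esub> (b \<otimes>\<^bsub>G\<^esub> c) = x then f a * g b * h c else 0)"
      by (rule trans[OF sum.swap sum.cong[OF refl sum.swap]])
    also have "\<dots> = (\<Sum>a\<in>?A. \<Sum>b\<in>?B. \<Sum>c\<in>?C. \<Sum>e\<in>?E. if e = b \<otimes>\<^bsub>G\<^esub> c then (if a \<otimes>\<^bsub>G\<^esub> e = x then f a * g b * h c else 0) else 0)"
    proof (intro sum.cong refl)
      fix c a b assume h: "c \<in> ?C" "a \<in> ?A" "b \<in> ?B"
      have "finite ?E" using fin by blast
      moreover have "b \<otimes>\<^bsub>G\<^esub> c \<in> ?E" using h by force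
      ultimately show "(if a \<otimes>\<^bsub>G\<^esub> (b \<otimes>\<^bsub>G\<^esub> c) = x then f a * g b * h c else 0) = (\<Sum>e\<in>?E. if e = b \<otimes>\<^bsub>G\<^esub> c then (if a \<otimes>\<^bsub>G\<^esub> e = x then f a * g b * h c else 0) else 0)"
        by (simp add: sum.delta)
    qed
    also have "\<dots> = (\<Sum>a\<in>?A. \<Sum>e\<in>?E. \<Sum>b\<in>?B. \<Sum>c\<in>?C. if e = b \<otimes>\<^bsub>G\<^esub> c then (if a \<otimes>\<^bsub>G\<^esub> e = x then f a * g b * h c else 0) else 0)"
      by (rule sum.cong[OF refl trans[OF sum.cong[OF refl sum.swap] sum.swap]])
    also have "\<dots> = (\<Sum>a\<in>?A. \<Sum>e\<in>?E. if a \<otimes>\<^bsub>G\<^esub> e = x then f a * (g \<otimes>\<^bsub>?F\<^esub> h) e else 0)"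
    proof (intro sum.cong refl)
      fix a e
      show "(\<Sum>b\<in>?B. \<Sum>c\<in>?C. if e = b \<otimes>\<^bsub>G\<^esub> c then (if a \<otimes>\<^bsub>G\<^esub> e = x then f a * g b * h c else 0) else 0) = (if a \<otimes>\<^bsub>G\<^esub> e = x then f a * (g \<otimes>\<^bsub>?F\<^esub> h) e else 0)"
      proof (cases "a \<otimes>\<^bsub>G\<^esub> e = x")
        case True
        thus ?thesis
          by (simp only: monoid_alg_mult_eq[OF fin(2,3) subset_refl subset_refl] sum_distrib_left if_True simp_thms)
             (intro sum.cong refl, auto simp: mult.assoc)
      qed (auto intro!: sum.neutral)
    qed
    also have "\<dots> = (f \<otimes>\<^bsub>?F\<^esub> (g \<otimes>\<^bsub>?F\<^esub> h)) x"
      by (rule monoid_alg_mult_eq[OF fin(1) _ subset_refl monoid_alg_mult_supp, symmetric]) (use fin in blast)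
    finally show "((f \<otimes>\<^bsub>?F\<^esub> g) \<otimes>\<^bsub>?F\<^esub> h) x = (f \<otimes>\<^bsub>?F\<^esub> (g \<otimes>\<^bsub>?F\<^esub> h)) x" .
  qed
  have distr1: "(f \<oplus>\<^bsub>?F\<^esub> g) \<otimes>\<^bsub>?F\<^esub> h = f \<otimes>\<^bsub>?F\<^esub> h \<oplus>\<^bsub>?F\<^esub> g \<otimes>\<^bsub>?F\<^esub> h"
   and distr2: "h \<otimes>\<^bsub>?F\<^esub> (f \<oplus>\<^bsub>?F\<^esub> g) = h \<otimes>\<^bsub>?F\<^esub> f \<oplus>\<^bsub>?F\<^esub> h \<otimes>\<^bsub>?F\<^esub> g"
    if "f \<in> carrier ?F" "g \<in> carrier ?F" "h \<in> carrier ?F" for f g h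
  proof -
    let ?A = "supp f \<union> supp g" let ?C = "supp h"
    have fin: "finite ?A" "finite ?C"
      using that by (auto simp: monoid_alg_carrier)
    have s: "supp f \<subseteq> ?A" "supp g \<subseteq> ?A" "supp (f \<oplus>\<^bsub>?F\<^esub> g) \<subseteq> ?A" by (auto simp: add)
    show "(f \<oplus>\<^bsub>?F\<^esub> g) \<otimes>\<^bsub>?F\<^esub> h = f \<otimes>\<^bsub>?F\<^esub> h \<oplus>\<^bsub>?F\<^esub> g \<otimes>\<^bsub>?F\<^esub> h"
      by (rule ext, subst (2) add)
         (simp only: monoid_alg_mult_eq[OF fin s(1) subset_refl] monoid_alg_mult_eq[OF fin s(2) subset_refl]
             monoid_alg_mult_eq[OF fin s(3) subset_refl] sum.distrib[symmetric], 
          auto simp: add distrib_right intro!: sum.cong)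
    show "h \<otimes>\<^bsub>?F\<^esub> (f \<oplus>\<^bsub>?F\<^esub> g) = h \<otimes>\<^bsub>?F\<^esub> f \<oplus>\<^bsub>?F\<^esub> h \<otimes>\<^bsub>?F\<^esub> g"
      by (rule ext, subst (2) add)
         (simp only: monoid_alg_mult_eq[OF fin(2,1) subset_refl s(1)] monoid_alg_mult_eq[OF fin(2,1) subset_refl s(2)]
             monoid_alg_mult_eq[OF fin(2,1) subset_refl s(3)] sum.distrib[symmetric], 
          auto simp: add distrib_left intro!: sum.cong)
  qed
  have onec: "\<one>\<^bsub>?F\<^esub> \<in> carrier ?F" by (auto simp: monoid_alg_carrier one)
  have suppone: "supp (\<one>\<^bsub>?F\<^esub>) \<subseteq> {\<one>\<^bsub>G\<^esub>}" by (auto simp: one)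
  have l_one: "\<one>\<^bsub>?F\<^esub> \<otimes>\<^bsub>?F\<^esub> f = f" and r_one: "f \<otimes>\<^bsub>?F\<^esub> \<one>\<^bsub>?F\<^esub> = f"
    if f: "f \<in> carrier ?F" for f
  proof -
    have fin: "finite (supp f)" "supp f \<subseteq> carrier G" using f by (auto simp: monoid_alg_carrier)
    show "\<one>\<^bsub>?F\<^esub> \<otimes>\<^bsub>?F\<^esub> f = f"
    proof
      fix c
      have "(\<one>\<^bsub>?F\<^esub> \<otimes>\<^bsub>?F\<^esub> f) c = (\<Sum>b\<in>supp f. if \<one>\<^bsub>G\<^esub> \<otimes>\<^bsub>G\<^esub> b = c then f b else 0)"
        by (subst monoid_alg_mult_eq[OF _ fin(1) suppone subset_refl]) (auto simp: one intro!: sum.cong)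
      also have "\<dots> = (\<Sum>b\<in>supp f. if b = c then f b else 0)"
        by (intro sum.cong refl) (use fin in \<open>auto\<close>)
      finally show "(\<one>\<^bsub>?F\<^esub> \<otimes>\<^bsub>?F\<^esub> f) c = f c" using fin by (simp add: sum.delta)
    qed
    show "f \<otimes>\<^bsub>?F\<^esub> \<one>\<^bsub>?F\<^esub> = f"
    proof
      fix c
      have "(f \<otimes>\<^bsub>?F\<^esub> \<one>\<^bsub>?F\<^esub>) c = (\<Sum>b\<in>supp f. if b \<otimes>\<^bsub>G\<^esub> \<one>\<^bsub>G\<^esub> = c then f b else 0)"
        by (subst monoid_alg_mult_eq[OF fin(1) _ subset_refl suppone]) (auto simp: one intro!: sum.cong)
      also have "\<dots> = (\<Sum>b\<in>supp f. if b = c then f b else 0)"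
        by (intro sum.cong refl) (use fin in \<open>auto\<close>)
      finally show "(f \<otimes>\<^bsub>?F\<^esub> \<one>\<^bsub>?F\<^esub>) c = f c" using fin by (simp add: sum.delta)
    qed
  qed
  show ?thesis
  proof (rule ringI)
    show "abelian_group ?F"
    proof (rule abelian_groupI)
      fix f assume f: "f \<in> carrier ?F"
      show "\<exists>g\<in>carrier ?F. g \<oplus>\<^bsub>?F\<^esub> f = \<zero>\<^bsub>?F\<^esub>"
        by (rule bexI[of _ "\<lambda>c. - f c"]) (use f in \<open>auto simp: monoid_alg_carrier add zero\<close>)
    next
      show "\<And>f g. f \<in> carrier ?F \<Longrightarrow> g \<in> carrier ?F \<Longrightarrow> f \<oplus>\<^bsub>?F\<^esub> g \<in> carrier ?F" by (rule addc)
    qed (auto simp: add zero monoid_alg_carrier ac_simps)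
    show "Group.monoid ?F"
      by (rule monoidI) (auto intro: multc assoc onec l_one r_one)
  qed (auto intro: distr1 distr2)
qed

locale k_algebra = ring A for A :: "('k::field, 'a) module" (structure) +
  assumes smult_closed: "x \<in> carrier A \<Longrightarrow> c \<odot> x \<in> carrier A"
    and smult_l_distr: "x \<in> carrier A \<Longrightarrow> (c + d) \<odot> x = c \<odot> x \<oplus> d \<odot> x"
    and smult_r_distr: "x \<in> carrier A \<Longrightarrow> y \<in> carrier A \<Longrightarrow> c \<odot> (x \<oplus> y) = c \<odot> x \<oplus> c \<odot> y"
    and smult_assoc: "x \<in> carrier A \<Longrightarrow> (c * d) \<odot> x = c \<odot> (d \<odot> x)"
    and smult_one: "x \<in> carrier A \<Longrightarrow> 1 \<odot> x = x"
    and smult_mult_left: "x \<in> carrier A \<Longrightarrow> y \<in> carrier A \<Longrightarrow> (c \<odot> x) \<otimes> y = c \<odot> (x \<otimes> y)"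
    and smult_mult_right: "x \<in> carrier A \<Longrightarrow> y \<in> carrier A \<Longrightarrow> x \<otimes> (c \<odot> y) = c \<odot> (x \<otimes> y)"
begin

lemma smult_zero [simp]: "c \<odot> \<zero> = \<zero>"
proof -
  have "c \<odot> \<zero> \<oplus> c \<odot> \<zero> = c \<odot> \<zero>" using smult_r_distr[of \<zero> \<zero> c] by simp
  thus ?thesis using smult_closed[of \<zero> c] by (metis local.add.l_cancel_one zero_closed)
qed

lemma zero_smult [simp]: "x \<in> carrier A \<Longrightarrow> 0 \<odot> x = \<zero>"
  using smult_l_distr[of x 0 0] smult_closed[of x 0] by (metis add_0 local.add.l_cancel_one)

lemma smult_eq_mult: "x \<in> carrier A \<Longrightarrow> c \<odot> x = (c \<odot> \<one>) \<otimes> x"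
  by (simp add: smult_mult_left)

end

lemma k_algebra_monoid_alg:
  assumes "Group.monoid G"
  shows "k_algebra (monoid_alg G :: ('k::field, 'm \<Rightarrow> 'k) module)"
proof -
  let ?F = "monoid_alg G :: ('k, 'm \<Rightarrow> 'k) module"
  have sm: "c \<odot>\<^bsub>?F\<^esub> f = (\<lambda>x. c * f x)" and add: "f \<oplus>\<^bsub>?F\<^esub> g = (\<lambda>c. f c + g c)" for c f g
    by (simp_all add: monoid_alg_def)
  have supp: "supp (c \<odot>\<^bsub>?F\<^esub> f) \<subseteq> supp f" for c f by (auto simp: sm)
  interpret F: ring ?F by (rule monoid_alg_ring) fact
  show ?thesis
  proof unfold_locales
    fix f c assume "f \<in> carrier ?F"
    thus "c \<odot>\<^bsub>?F\<^esub> f \<in> carrier ?F" using supp[of c f] finite_subset[OF supp[of c f]]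
      unfolding monoid_alg_carrier by blast
  next
    fix f g c assume fg: "f \<in> carrier ?F" "g \<in> carrier ?F"
    hence fin: "finite (supp f)" "finite (supp g)" by (auto simp: monoid_alg_carrier)
    show "c \<odot>\<^bsub>?F\<^esub> f \<otimes>\<^bsub>?F\<^esub> g = c \<odot>\<^bsub>?F\<^esub> (f \<otimes>\<^bsub>?F\<^esub> g)"
      by (rule ext, subst (2) sm)
         (simp only: monoid_alg_mult_eq[OF fin subset_refl subset_refl] monoid_alg_mult_eq[OF fin supp subset_refl] sum_distrib_left,
           auto simp: sm mult.assoc intro!: sum.cong)
    show "f \<otimes>\<^bsub>?F\<^esub> (c \<odot>\<^bsub>?F\<^esub> g) = c \<odot>\<^bsub>?F\<^esub> (f \<otimes>\<^bsub>?F\<^esub> g)"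
      by (rule ext, subst (2) sm)
         (simp only: monoid_alg_mult_eq[OF fin subset_refl subset_refl] monoid_alg_mult_eq[OF fin subset_refl supp] sum_distrib_left,
           auto simp: sm mult.left_commute intro!: sum.cong)
  qed (auto simp: sm add algebra_simps)
qed

lemma k_algebra_quot_alg:
  assumes "k_algebra A" "ideal I A"
  shows "k_algebra (quot_alg A I)"
proof -
  interpret A: k_algebra A by fact
  interpret I: ideal I A by fact
  have sm: "c \<odot>\<^bsub>quot_alg A I\<^esub> (I +>\<^bsub>A\<^esub> x) = I +>\<^bsub>A\<^esub> (c \<odot>\<^bsub>A\<^esub> x)" if x: "x \<in> carrier A" for c x
  proof -
    have "I +>\<^bsub>A\<^esub> (c \<odot>\<^bsub>A\<^esub> y) = I +>\<^bsub>A\<^esub> (c \<odot>\<^bsub>A\<^esub> x)" if y: "y \<in> I +>\<^bsub>A\<^esub> x" for y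
    proof -
      obtain i where i: "i \<in> I" "y = i \<oplus>\<^bsub>A\<^esub> x" using y by (auto simp: a_r_coset_def')
      have ic: "i \<in> carrier A" using i by auto
      have "c \<odot>\<^bsub>A\<^esub> i \<in> I"
        by (subst A.smult_eq_mult[OF ic]) (intro I.I_l_closed i A.smult_closed A.one_closed)
      hence "c \<odot>\<^bsub>A\<^esub> y \<in> I +>\<^bsub>A\<^esub> (c \<odot>\<^bsub>A\<^esub> x)"
        using i ic x by (auto simp: a_r_coset_def' A.smult_r_distr)
      thus ?thesis using x by (intro I.a_repr_independence'[symmetric]) (auto intro: A.smult_closed)
    qed
    hence "(\<Union>y\<in>I +>\<^bsub>A\<^esub> x. I +>\<^bsub>A\<^esub> (c \<odot>\<^bsub>A\<^esub> y)) = (\<Union>y\<in>I +>\<^bsub>A\<^esub> x. I +>\<^bsub>A\<^esub> (c \<odot>\<^bsub>A\<^esub> x))"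
      by (intro SUP_cong refl)
    also have "\<dots> = I +>\<^bsub>A\<^esub> (c \<odot>\<^bsub>A\<^esub> x)" using I.a_rcos_self[OF x] by (subst UN_constant) auto
    finally show ?thesis by (simp add: quot_alg_def)
  qed
  have car: "carrier (quot_alg A I) = carrier (A Quot I)" and
    mult: "monoid.mult (quot_alg A I) = monoid.mult (A Quot I)" and
    add: "ring.add (quot_alg A I) = ring.add (A Quot I)" and
    one: "monoid.one (quot_alg A I) = monoid.one (A Quot I)" and
    zero: "ring.zero (quot_alg A I) = ring.zero (A Quot I)"
    by (simp_all add: quot_alg_def)
  have carE: "\<exists>x \<in> carrier A. U = I +>\<^bsub>A\<^esub> x" if "U \<in> carrier (quot_alg A I)" for U
    using that by (auto simp: car FactRing_def A_RCOSETS_def')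
  have carI: "x \<in> carrier A \<Longrightarrow> I +>\<^bsub>A\<^esub> x \<in> carrier (quot_alg A I)" for x
    by (auto simp: car FactRing_def A_RCOSETS_def')
  have addeq: "(I +>\<^bsub>A\<^esub> x) \<oplus>\<^bsub>quot_alg A I\<^esub> (I +>\<^bsub>A\<^esub> y) = I +>\<^bsub>A\<^esub> (x \<oplus>\<^bsub>A\<^esub> y)" if "x \<in> carrier A" "y \<in> carrier A" for x y
    using that by (simp add: add FactRing_def I.a_rcos_sum)
  have multeq: "(I +>\<^bsub>A\<^esub> x) \<otimes>\<^bsub>quot_alg A I\<^esub> (I +>\<^bsub>A\<^esub> y) = I +>\<^bsub>A\<^esub> (x \<otimes>\<^bsub>A\<^esub> y)" if "x \<in> carrier A" "y \<in> carrier A" for x y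
    using that by (simp add: mult FactRing_def I.rcoset_mult_add)
  interpret Q: ring "A Quot I" by (rule I.quotient_is_ring)
  have r: "ring (quot_alg A I)"
  proof (rule ringI)
    show "abelian_group (quot_alg A I)"
      by (rule abelian_groupI) (auto simp: car add zero Q.a_ac Q.add.l_inv_ex)
    show "Group.monoid (quot_alg A I)"
      by (rule Group.monoidI) (auto simp: car mult one Q.m_assoc)
  qed (auto simp: car mult add Q.l_distr Q.r_distr)
  interpret Q': ring "quot_alg A I" by (rule r)
  show ?thesis
    by unfold_locales
      (auto dest!: carE simp: sm addeq multeq A.smult_closed A.smult_l_distr A.smult_r_distr A.smult_assoc
        A.smult_one A.smult_mult_left A.smult_mult_right intro!: carI)
qed

lemma k_algebra_opposite:
  assumes "k_algebra A" shows "k_algebra (opposite_alg A)"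
proof -
  interpret A: k_algebra A by fact
  have r: "ring (opposite_alg A)"
  proof (rule ringI)
    show "abelian_group (opposite_alg A)"
      by (rule abelian_groupI) (auto simp: opposite_alg_def A.a_ac A.add.l_inv_ex)
    show "Group.monoid (opposite_alg A)"
      by (rule Group.monoidI) (auto simp: opposite_alg_def A.m_assoc)
  qed (auto simp: opposite_alg_def A.l_distr A.r_distr)
  interpret O: ring "opposite_alg A" by (rule r)
  show ?thesis
    by unfold_locales (auto simp: opposite_alg_def A.smult_closed A.smult_l_distr A.smult_r_distr A.smult_assoc
        A.smult_one A.smult_mult_left A.smult_mult_right)
qed

lemma basis_elem_carrier: "a \<in> carrier G \<Longrightarrow> basis_elem a \<in> carrier (monoid_alg G)"
  by (auto simp: monoid_alg_carrier basis_elem_def)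

lemma basis_elem_mult:
  assumes "a \<in> carrier G" "b \<in> carrier G"
  shows "basis_elem a \<otimes>\<^bsub>monoid_alg G\<^esub> basis_elem b = (basis_elem (a \<otimes>\<^bsub>G\<^esub> b) :: _ \<Rightarrow> 'k::field)"
proof
  fix c
  have "(basis_elem a \<otimes>\<^bsub>monoid_alg G\<^esub> basis_elem b) c = (\<Sum>x\<in>{a}. \<Sum>y\<in>{b}. if x \<otimes>\<^bsub>G\<^esub> y = c then basis_elem a x * basis_elem b y else (0::'k))"
    by (rule monoid_alg_mult_eq) (auto simp: basis_elem_def)
  thus "(basis_elem a \<otimes>\<^bsub>monoid_alg G\<^esub> basis_elem b) c = (basis_elem (a \<otimes>\<^bsub>G\<^esub> b) c :: 'k)"
    by (auto simp: basis_elem_def)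
qed

lemma monoid_alg_induct [consumes 1, case_names zero add]:
  assumes "f \<in> carrier (monoid_alg G)"
    and z: "P \<zero>\<^bsub>monoid_alg G\<^esub>"
    and s: "\<And>a c f. a \<in> carrier G \<Longrightarrow> f \<in> carrier (monoid_alg G) \<Longrightarrow> P f \<Longrightarrow>
              P (c \<odot>\<^bsub>monoid_alg G\<^esub> basis_elem a \<oplus>\<^bsub>monoid_alg G\<^esub> f)"
  shows "P (f :: _ \<Rightarrow> 'k::field)"
proof -
  have "P f" if "finite S" "supp f \<subseteq> S" "S \<subseteq> carrier G" for S f
    using that
  proof (induction S arbitrary: f rule: finite_induct)
    case empty
    hence "f = \<zero>\<^bsub>monoid_alg G\<^esub>" by (auto simp: monoid_alg_def)
    thus ?case using z by simp
  next
    case (insert a S)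
    let ?g = "f(a := 0)"
    have g: "supp ?g \<subseteq> S" using insert.prems by auto
    have "P ?g" by (rule insert.IH[OF g]) (use insert in auto)
    moreover have "finite (supp ?g)" by (rule finite_subset[OF g insert.hyps(1)])
    hence "?g \<in> carrier (monoid_alg G)" using g insert.prems by (auto simp: monoid_alg_carrier)
    moreover have "f = f a \<odot>\<^bsub>monoid_alg G\<^esub> basis_elem a \<oplus>\<^bsub>monoid_alg G\<^esub> ?g"
      by (auto simp: monoid_alg_def basis_elem_def)
    moreover have "a \<in> carrier G" using insert.prems by auto
    ultimately show ?case using s[of a ?g "f a"] by simp
  qed
  thus ?thesis using assms(1) by (auto simp: monoid_alg_carrier)
qed

context
  fixes A :: "('k::field, 'a) module" and B :: "('k, 'b) module"
  assumes A: "k_algebra A" and B: "k_algebra B"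
begin

interpretation A: k_algebra A by (rule A)
interpretation B: k_algebra B by (rule B)

lemma k_algebra_tensor_pre: "k_algebra (monoid_alg (A \<times>\<times> B) :: (_, _ \<Rightarrow> 'k) module)"
  by (rule k_algebra_monoid_alg) (intro DirProd_monoid A.monoid_axioms B.monoid_axioms)

lemma bilinearity_relations_carrier:
  "bilinearity_relations A B \<subseteq> carrier (monoid_alg (A \<times>\<times> B) :: (_, _ \<Rightarrow> 'k) module)"
proof -
  interpret F: k_algebra "monoid_alg (A \<times>\<times> B) :: (_, _ \<Rightarrow> 'k) module" by (rule k_algebra_tensor_pre)
  have t: "a \<in> carrier A \<Longrightarrow> b \<in> carrier B \<Longrightarrow> basis_elem (a, b) \<in> carrier (monoid_alg (A \<times>\<times> B) :: (_, _ \<Rightarrow> 'k) module)" for a b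
    by (rule basis_elem_carrier) (auto simp: DirProd_def)
  show ?thesis
    unfolding bilinearity_relations_def Let_def
    by (auto intro!: F.minus_closed F.a_closed t F.smult_closed A.a_closed B.a_closed A.smult_closed B.smult_closed)
qed

lemma ideal_tensor: "ideal (Idl\<^bsub>monoid_alg (A \<times>\<times> B)\<^esub> (bilinearity_relations A B)) (monoid_alg (A \<times>\<times> B) :: (_, _ \<Rightarrow> 'k) module)"
proof -
  interpret F: k_algebra "monoid_alg (A \<times>\<times> B) :: (_, _ \<Rightarrow> 'k) module" by (rule k_algebra_tensor_pre)
  show ?thesis by (rule F.genideal_ideal[OF bilinearity_relations_carrier])
qed

lemma k_algebra_tensor: "k_algebra (tensor_alg A B)"
  unfolding tensor_alg_def Let_def by (rule k_algebra_quot_alg[OF k_algebra_tensor_pre ideal_tensor])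

end

lemma k_algebra_enveloping: "k_algebra A \<Longrightarrow> k_algebra (enveloping_alg A)"
  unfolding enveloping_alg_def by (intro k_algebra_tensor k_algebra_opposite)

lemma k_algebra_\<Lambda>: "k_algebra (\<Lambda> q)"
proof -
  have "Group.monoid word_monoid" by (rule monoidI) (auto simp: word_monoid_def)
  hence F: "k_algebra (free_alg_xy :: (_, _ \<Rightarrow> 'a) module)" unfolding free_alg_xy_def by (rule k_algebra_monoid_alg)
  interpret F: k_algebra "free_alg_xy :: (_, _ \<Rightarrow> 'a) module" by fact
  have b: "basis_elem w \<in> carrier (free_alg_xy :: (_, _ \<Rightarrow> 'a) module)" for w
    unfolding free_alg_xy_def by (rule basis_elem_carrier) (simp add: word_monoid_def)
  show ?thesis unfolding \<Lambda>_def Let_def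
    by (intro k_algebra_quot_alg F F.genideal_ideal) (auto intro!: F.a_closed F.m_closed F.smult_closed b)
qed

context
  fixes A :: "('k::field, 'a) module"
  assumes A: "k_algebra A"
begin

interpretation A: k_algebra A by (rule A)

abbreviation (input) "env_pre \<equiv> monoid_alg (opposite_alg A \<times>\<times> A) :: (_, _ \<Rightarrow> 'k) module"

interpretation F: k_algebra env_pre by (intro k_algebra_tensor_pre k_algebra_opposite A)

definition "sandwich p m = snd p \<otimes>\<^bsub>A\<^esub> m \<otimes>\<^bsub>A\<^esub> fst p"
definition "env_act f m = (\<Oplus>\<^bsub>A\<^esub>p \<in> {p. f p \<noteq> 0}. f p \<odot>\<^bsub>A\<^esub> sandwich p m)"

lemma carrier_opposite [simp]: "carrier (opposite_alg A) = carrier A" by (simp add: opposite_alg_def)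
lemma carrier_opposite_prod [simp]: "carrier (opposite_alg A \<times>\<times> A) = carrier A \<times> carrier A"
  by (simp add: DirProd_def opposite_alg_def)

lemma sandwich_closed: "p \<in> carrier A \<times> carrier A \<Longrightarrow> m \<in> carrier A \<Longrightarrow> sandwich p m \<in> carrier A"
  by (auto simp: sandwich_def)

lemma sandwich_add: "p \<in> carrier A \<times> carrier A \<Longrightarrow> m \<in> carrier A \<Longrightarrow> m' \<in> carrier A \<Longrightarrow> sandwich p (m \<oplus>\<^bsub>A\<^esub> m') = sandwich p m \<oplus>\<^bsub>A\<^esub> sandwich p m'"
  by (auto simp: sandwich_def A.l_distr A.r_distr)

lemma sandwich_smult: "p \<in> carrier A \<times> carrier A \<Longrightarrow> m \<in> carrier A \<Longrightarrow> sandwich p (c \<odot>\<^bsub>A\<^esub> m) = c \<odot>\<^bsub>A\<^esub> sandwich p m"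
  by (auto simp: sandwich_def A.smult_mult_left A.smult_mult_right)

lemma env_act_eq:
  assumes "finite S" "supp f \<subseteq> S" "S \<subseteq> carrier A \<times> carrier A" "m \<in> carrier A"
  shows "env_act f m = (\<Oplus>\<^bsub>A\<^esub>p \<in> S. f p \<odot>\<^bsub>A\<^esub> sandwich p m)"
  unfolding env_act_def
  by (rule A.add.finprod_mono_neutral_cong_left)
     (use assms in \<open>auto intro!: A.smult_closed sandwich_closed simp: A.zero_smult[OF sandwich_closed]\<close>)

lemma env_act_closed: "f \<in> carrier env_pre \<Longrightarrow> m \<in> carrier A \<Longrightarrow> env_act f m \<in> carrier A"
  unfolding env_act_def by (rule A.finsum_closed) (auto intro!: A.smult_closed sandwich_closed simp: monoid_alg_carrier)

lemma env_pre_add: "(f \<oplus>\<^bsub>env_pre\<^esub> g) = (\<lambda>p. f p + g p)" by (simp add: monoid_alg_def)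

lemma env_act_add:
  assumes "f \<in> carrier env_pre" "g \<in> carrier env_pre" "m \<in> carrier A"
  shows "env_act (f \<oplus>\<^bsub>env_pre\<^esub> g) m = env_act f m \<oplus>\<^bsub>A\<^esub> env_act g m"
proof -
  let ?S = "supp f \<union> supp g"
  have S: "finite ?S" "?S \<subseteq> carrier A \<times> carrier A" using assms by (auto simp: monoid_alg_carrier)
  have sub: "supp (f \<oplus>\<^bsub>env_pre\<^esub> g) \<subseteq> ?S" by (auto simp: env_pre_add)
  have cl: "(\<lambda>p. h p \<odot>\<^bsub>A\<^esub> sandwich p m) \<in> ?S \<rightarrow> carrier A" for h
    using S assms by (auto intro!: A.smult_closed sandwich_closed)
  have "env_act (f \<oplus>\<^bsub>env_pre\<^esub> g) m = (\<Oplus>\<^bsub>A\<^esub>p \<in> ?S. (f \<oplus>\<^bsub>env_pre\<^esub> g) p \<odot>\<^bsub>A\<^esub> sandwich p m)"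
    by (rule env_act_eq[OF S(1) sub S(2) assms(3)])
  also have "\<dots> = (\<Oplus>\<^bsub>A\<^esub>p \<in> ?S. f p \<odot>\<^bsub>A\<^esub> sandwich p m \<oplus>\<^bsub>A\<^esub> g p \<odot>\<^bsub>A\<^esub> sandwich p m)"
  proof (rule A.finsum_cong')
    show "(\<lambda>p. f p \<odot>\<^bsub>A\<^esub> sandwich p m \<oplus>\<^bsub>A\<^esub> g p \<odot>\<^bsub>A\<^esub> sandwich p m) \<in> ?S \<rightarrow> carrier A"
      using cl[of f] cl[of g] by (auto simp: Pi_iff)
    show "(f \<oplus>\<^bsub>env_pre\<^esub> g) p \<odot>\<^bsub>A\<^esub> sandwich p m = f p \<odot>\<^bsub>A\<^esub> sandwich p m \<oplus>\<^bsub>A\<^esub> g p \<odot>\<^bsub>A\<^esub> sandwich p m" if "p \<in> ?S" for p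
      unfolding env_pre_add by (rule A.smult_l_distr[OF sandwich_closed]) (use that S assms in blast)+
  qed simp
  also have "\<dots> = (\<Oplus>\<^bsub>A\<^esub>p \<in> ?S. f p \<odot>\<^bsub>A\<^esub> sandwich p m) \<oplus>\<^bsub>A\<^esub> (\<Oplus>\<^bsub>A\<^esub>p \<in> ?S. g p \<odot>\<^bsub>A\<^esub> sandwich p m)"
    by (rule A.finsum_addf[OF cl cl])
  also have "\<dots> = env_act f m \<oplus>\<^bsub>A\<^esub> env_act g m"
    using env_act_eq[OF S(1) _ S(2) assms(3), of f] env_act_eq[OF S(1) _ S(2) assms(3), of g] by simp
  finally show ?thesis .
qed

lemma env_act_zero: "env_act \<zero>\<^bsub>env_pre\<^esub> m = \<zero>\<^bsub>A\<^esub>"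
  by (simp add: env_act_def monoid_alg_def)

lemma env_act_single:
  assumes "p \<in> carrier A \<times> carrier A" "m \<in> carrier A"
  shows "env_act (c \<odot>\<^bsub>env_pre\<^esub> basis_elem p) m = c \<odot>\<^bsub>A\<^esub> sandwich p m"
proof -
  have "env_act (c \<odot>\<^bsub>env_pre\<^esub> basis_elem p) m = (\<Oplus>\<^bsub>A\<^esub>p' \<in> {p}. (c \<odot>\<^bsub>env_pre\<^esub> basis_elem p) p' \<odot>\<^bsub>A\<^esub> sandwich p' m)"
    by (rule env_act_eq) (use assms in \<open>auto simp: monoid_alg_def basis_elem_def split: if_splits\<close>)
  also have "\<dots> = c \<odot>\<^bsub>A\<^esub> sandwich p m"
    using A.smult_closed[OF sandwich_closed[OF assms], of c]
    by (simp add: monoid_alg_def basis_elem_def)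
  finally show ?thesis .
qed

lemma basis_env_pre: "p \<in> carrier A \<times> carrier A \<Longrightarrow> basis_elem p \<in> carrier env_pre"
  by (rule basis_elem_carrier) simp

lemma env_act_basis:
  assumes "p \<in> carrier A \<times> carrier A" "m \<in> carrier A"
  shows "env_act (basis_elem p :: _ \<Rightarrow> 'k) m = sandwich p m"
  using env_act_single[OF assms, of 1] F.smult_one[OF basis_env_pre[OF assms(1)]] A.smult_one[OF sandwich_closed[OF assms]] by simp

lemma env_act_smult:
  assumes "f \<in> carrier env_pre" "m \<in> carrier A"
  shows "env_act (c \<odot>\<^bsub>env_pre\<^esub> f) m = c \<odot>\<^bsub>A\<^esub> env_act f m"
  using assms(1)
proof (induction rule: monoid_alg_induct)
  case (add a d f)
  have a: "a \<in> carrier A \<times> carrier A" using add by simp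
  have "c \<odot>\<^bsub>env_pre\<^esub> (d \<odot>\<^bsub>env_pre\<^esub> basis_elem a \<oplus>\<^bsub>env_pre\<^esub> f) = (c * d) \<odot>\<^bsub>env_pre\<^esub> basis_elem a \<oplus>\<^bsub>env_pre\<^esub> c \<odot>\<^bsub>env_pre\<^esub> f"
    using add a basis_env_pre[OF a] by (simp add: F.smult_r_distr F.smult_closed F.smult_assoc)
  thus ?case using add a assms(2) basis_env_pre[OF a]
    by (simp add: env_act_add env_act_single F.smult_closed A.smult_r_distr A.smult_closed env_act_closed sandwich_closed A.smult_assoc)
qed (simp add: env_act_zero)

lemma env_act_madd:
  assumes "f \<in> carrier env_pre" "m \<in> carrier A" "m' \<in> carrier A"
  shows "env_act f (m \<oplus>\<^bsub>A\<^esub> m') = env_act f m \<oplus>\<^bsub>A\<^esub> env_act f m'"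
  using assms(1)
proof (induction rule: monoid_alg_induct)
  case (add a d f)
  have a: "a \<in> carrier A \<times> carrier A" using add by simp
  note cl = env_act_closed[OF add(2)] A.smult_closed[OF sandwich_closed[OF a]] A.a_closed
  show ?case using add a assms(2,3) basis_env_pre[OF a] 
    by (simp add: env_act_add env_act_single F.smult_closed sandwich_add A.smult_r_distr A.a_ac cl sandwich_closed)
qed (simp add: env_act_zero)

lemma env_act_msmult:
  assumes "f \<in> carrier env_pre" "m \<in> carrier A"
  shows "env_act f (c \<odot>\<^bsub>A\<^esub> m) = c \<odot>\<^bsub>A\<^esub> env_act f m"
  using assms(1)
proof (induction rule: monoid_alg_induct)
  case (add a d f)
  have a: "a \<in> carrier A \<times> carrier A" using add by simp
  note cl = env_act_closed[OF add(2)] A.smult_closed[OF sandwich_closed[OF a]] A.a_closed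
  have "d \<odot>\<^bsub>A\<^esub> (c \<odot>\<^bsub>A\<^esub> sandwich a m) = c \<odot>\<^bsub>A\<^esub> (d \<odot>\<^bsub>A\<^esub> sandwich a m)"
    using sandwich_closed[OF a assms(2)] by (simp add: A.smult_assoc[symmetric] mult.commute)
  thus ?case using add a assms(2) basis_env_pre[OF a] 
    by (simp add: env_act_add env_act_single F.smult_closed A.smult_closed sandwich_smult A.smult_r_distr cl)
qed (simp add: env_act_zero)

lemma sandwich_mult:
  assumes "p \<in> carrier A \<times> carrier A" "p' \<in> carrier A \<times> carrier A" "m \<in> carrier A"
  shows "sandwich (p \<otimes>\<^bsub>opposite_alg A \<times>\<times> A\<^esub> p') m = sandwich p (sandwich p' m)"
  using assms by (auto simp: sandwich_def DirProd_def opposite_alg_def A.m_assoc)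

lemma env_act_mult:
  assumes "f \<in> carrier env_pre" "g \<in> carrier env_pre" "m \<in> carrier A"
  shows "env_act (f \<otimes>\<^bsub>env_pre\<^esub> g) m = env_act f (env_act g m)"
proof -
  have 1: "env_act (basis_elem p \<otimes>\<^bsub>env_pre\<^esub> g) m = env_act (basis_elem p :: _ \<Rightarrow> 'k) (env_act g m)" if p: "p \<in> carrier A \<times> carrier A" for p
    using assms(2)
  proof (induction rule: monoid_alg_induct)
    case zero
    have "env_act (basis_elem p :: _ \<Rightarrow> 'k) \<zero>\<^bsub>A\<^esub> = \<zero>\<^bsub>A\<^esub>"
      using p by (subst env_act_basis) (auto simp: sandwich_def)
    thus ?case using basis_env_pre[OF p] by (simp add: env_act_zero)
  next
    case (add a d g)
    have a: "a \<in> carrier A \<times> carrier A" using add by simp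
    have pa: "p \<otimes>\<^bsub>opposite_alg A \<times>\<times> A\<^esub> a \<in> carrier A \<times> carrier A" using p a by (auto simp: DirProd_def opposite_alg_def)
    have e: "basis_elem p \<otimes>\<^bsub>env_pre\<^esub> (d \<odot>\<^bsub>env_pre\<^esub> basis_elem a \<oplus>\<^bsub>env_pre\<^esub> g) =
        d \<odot>\<^bsub>env_pre\<^esub> basis_elem (p \<otimes>\<^bsub>opposite_alg A \<times>\<times> A\<^esub> a) \<oplus>\<^bsub>env_pre\<^esub> basis_elem p \<otimes>\<^bsub>env_pre\<^esub> g"
      using add basis_env_pre[OF p] basis_env_pre[OF a] p a
      by (simp add: F.r_distr F.smult_closed F.smult_mult_right basis_elem_mult)
    have "env_act (basis_elem p \<otimes>\<^bsub>env_pre\<^esub> (d \<odot>\<^bsub>env_pre\<^esub> basis_elem a \<oplus>\<^bsub>env_pre\<^esub> g)) m =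
        d \<odot>\<^bsub>A\<^esub> sandwich p (sandwich a m) \<oplus>\<^bsub>A\<^esub> env_act (basis_elem p) (env_act g m)"
      unfolding e using add pa basis_env_pre[OF p] basis_env_pre[OF pa] assms(3) p a
      by (simp add: env_act_add F.smult_closed env_act_single sandwich_mult)
    also have "\<dots> = env_act (basis_elem p) (env_act (d \<odot>\<^bsub>env_pre\<^esub> basis_elem a \<oplus>\<^bsub>env_pre\<^esub> g) m)"
      using add p a basis_env_pre[OF p] basis_env_pre[OF a] assms(3)
      by (simp add: env_act_add F.smult_closed env_act_single env_act_madd env_act_msmult A.smult_closed sandwich_closed env_act_closed env_act_basis)
    finally show ?case .
  qed
  show ?thesis using assms(1)
  proof (induction rule: monoid_alg_induct)
    case zero
    thus ?case using assms by (simp add: env_act_zero)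
  next
    case (add a d f)
    have a: "a \<in> carrier A \<times> carrier A" using add by simp
    have e: "(d \<odot>\<^bsub>env_pre\<^esub> basis_elem a \<oplus>\<^bsub>env_pre\<^esub> f) \<otimes>\<^bsub>env_pre\<^esub> g = d \<odot>\<^bsub>env_pre\<^esub> (basis_elem a \<otimes>\<^bsub>env_pre\<^esub> g) \<oplus>\<^bsub>env_pre\<^esub> f \<otimes>\<^bsub>env_pre\<^esub> g"
      using add basis_env_pre[OF a] assms by (simp add: F.l_distr F.smult_closed F.smult_mult_left)
    show ?case unfolding e using add basis_env_pre[OF a] assms a
      by (simp add: env_act_add env_act_smult F.smult_closed 1 env_act_closed)
  qed
qed

lemma env_act_one: "m \<in> carrier A \<Longrightarrow> env_act \<one>\<^bsub>env_pre\<^esub> m = m"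
proof -
  assume m: "m \<in> carrier A"
  have "\<one>\<^bsub>env_pre\<^esub> = basis_elem (\<one>\<^bsub>A\<^esub>, \<one>\<^bsub>A\<^esub>)" by (auto simp: monoid_alg_def basis_elem_def DirProd_def opposite_alg_def)
  thus ?thesis using m by (simp add: env_act_basis sandwich_def)
qed

lemma env_act_uminus: "f \<in> carrier env_pre \<Longrightarrow> m \<in> carrier A \<Longrightarrow> env_act (\<ominus>\<^bsub>env_pre\<^esub> f) m = \<ominus>\<^bsub>A\<^esub> env_act f m"
  by (metis A.minus_equality F.a_inv_closed F.l_neg env_act_add env_act_closed env_act_zero)

lemma env_act_minus: "f \<in> carrier env_pre \<Longrightarrow> g \<in> carrier env_pre \<Longrightarrow> m \<in> carrier A \<Longrightarrow> env_act (f \<ominus>\<^bsub>env_pre\<^esub> g) m = env_act f m \<ominus>\<^bsub>A\<^esub> env_act g m"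
  by (simp add: a_minus_def env_act_add env_act_uminus)

definition "env_annihilator = {f \<in> carrier env_pre. \<forall>m \<in> carrier A. env_act f m = \<zero>\<^bsub>A\<^esub>}"

lemma env_act_m0: "f \<in> carrier env_pre \<Longrightarrow> env_act f \<zero>\<^bsub>A\<^esub> = \<zero>\<^bsub>A\<^esub>"
  by (metis A.add.l_cancel_one A.l_zero A.zero_closed env_act_closed env_act_madd)

lemma ideal_env_annihilator: "ideal env_annihilator env_pre"
proof (rule idealI)
  show "ring env_pre" by (rule F.ring_axioms)
  show "subgroup env_annihilator (add_monoid env_pre)"
    by (rule F.add.subgroupI) 
      (auto simp: env_annihilator_def env_act_add env_act_uminus[unfolded a_inv_def] env_act_zero a_inv_def[symmetric] env_act_uminus intro!: exI[of _ "\<zero>\<^bsub>env_pre\<^esub>"])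
qed (auto simp: env_annihilator_def env_act_mult env_act_closed env_act_m0)

lemma bilinearity_relations_env_annihilator: "bilinearity_relations (opposite_alg A) A \<subseteq> env_annihilator"
proof -
  have b: "\<And>a b. a \<in> carrier A \<Longrightarrow> b \<in> carrier A \<Longrightarrow> basis_elem (a, b) \<in> carrier env_pre"
    by (rule basis_env_pre) simp
  have op: "carrier (opposite_alg A) = carrier A" "ring.add (opposite_alg A) = ring.add A" "module.smult (opposite_alg A) = module.smult A"
    by (simp_all add: opposite_alg_def)
  note b = b
  have ab: "\<And>a b m. a \<in> carrier A \<Longrightarrow> b \<in> carrier A \<Longrightarrow> m \<in> carrier A \<Longrightarrow> env_act (basis_elem (a, b) :: _ \<Rightarrow> 'k) m = b \<otimes>\<^bsub>A\<^esub> m \<otimes>\<^bsub>A\<^esub> a"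
    by (subst env_act_basis) (auto simp: sandwich_def)
  have sub: "bilinearity_relations (opposite_alg A) A \<subseteq> carrier env_pre"
    by (intro bilinearity_relations_carrier k_algebra_opposite A)
  show ?thesis
    unfolding env_annihilator_def
    using sub unfolding bilinearity_relations_def Let_def op 
    by (auto simp: env_act_minus env_act_add env_act_smult ab b A.smult_closed F.smult_closed A.l_distr A.r_distr
      A.smult_mult_left A.smult_mult_right A.r_neg a_minus_def env_act_uminus)
qed

lemma left_module_bimodule_of_alg: "left_module (enveloping_alg A) (bimodule_of_alg A)"
proof -
  let ?I = "Idl\<^bsub>env_pre\<^esub> (bilinearity_relations (opposite_alg A) A)"
  interpret I: ideal ?I env_pre by (intro ideal_tensor k_algebra_opposite A)
  have sub: "?I \<subseteq> env_annihilator" using ideal_env_annihilator bilinearity_relations_env_annihilator by (auto simp: genideal_def)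
  interpret E: k_algebra "enveloping_alg A" by (rule k_algebra_enveloping[OF A])
  have sm: "(?I +>\<^bsub>env_pre\<^esub> f) \<odot>\<^bsub>bimodule_of_alg A\<^esub> m = env_act f m" if f: "f \<in> carrier env_pre" and m: "m \<in> carrier A" for f m
  proof -
    have "(\<lambda>f. env_act f m) ` (?I +>\<^bsub>env_pre\<^esub> f) = {env_act f m}"
    proof -
      have "env_act g m = env_act f m" if "g \<in> ?I +>\<^bsub>env_pre\<^esub> f" for g
      proof -
        obtain i where i: "i \<in> ?I" "g = i \<oplus>\<^bsub>env_pre\<^esub> f" using \<open>g \<in> ?I +>\<^bsub>env_pre\<^esub> f\<close> by (auto simp: a_r_coset_def')
        hence "i \<in> env_annihilator" using sub by blast
        thus ?thesis using i f m by (simp add: env_annihilator_def env_act_add env_act_closed)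
      qed
      thus ?thesis using I.a_rcos_self[OF f] by blast
    qed
    thus ?thesis unfolding env_act_def sandwich_def by (simp add: bimodule_of_alg_def)
  qed
  have Edef: "enveloping_alg A = quot_alg env_pre ?I" by (simp add: enveloping_alg_def tensor_alg_def Let_def)
  have carE: "\<exists>f\<in>carrier env_pre. \<xi> = ?I +>\<^bsub>env_pre\<^esub> f" if "\<xi> \<in> carrier (enveloping_alg A)" for \<xi>
    using that by (auto simp: Edef quot_alg_def FactRing_def A_RCOSETS_def')
  have addeq: "(?I +>\<^bsub>env_pre\<^esub> x) \<oplus>\<^bsub>enveloping_alg A\<^esub> (?I +>\<^bsub>env_pre\<^esub> y) = ?I +>\<^bsub>env_pre\<^esub> (x \<oplus>\<^bsub>env_pre\<^esub> y)" if "x \<in> carrier env_pre" "y \<in> carrier env_pre" for x y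
    using that by (simp add: Edef quot_alg_def FactRing_def I.a_rcos_sum)
  have multeq: "(?I +>\<^bsub>env_pre\<^esub> x) \<otimes>\<^bsub>enveloping_alg A\<^esub> (?I +>\<^bsub>env_pre\<^esub> y) = ?I +>\<^bsub>env_pre\<^esub> (x \<otimes>\<^bsub>env_pre\<^esub> y)" if "x \<in> carrier env_pre" "y \<in> carrier env_pre" for x y
    using that by (simp add: Edef quot_alg_def FactRing_def I.rcoset_mult_add)
  have oneeq: "\<one>\<^bsub>enveloping_alg A\<^esub> = ?I +>\<^bsub>env_pre\<^esub> \<one>\<^bsub>env_pre\<^esub>" by (simp add: Edef quot_alg_def FactRing_def)
  have M: "carrier (bimodule_of_alg A) = carrier A" "ring.add (bimodule_of_alg A) = ring.add A" "ring.zero (bimodule_of_alg A) = ring.zero A"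
    by (simp_all add: bimodule_of_alg_def)
  interpret M: abelian_group "bimodule_of_alg A"
    by (rule abelian_groupI) (auto simp: M A.a_ac A.add.l_inv_ex)
  show ?thesis
    by unfold_locales (auto dest!: carE simp: M sm addeq multeq oneeq env_act_closed env_act_add env_act_madd env_act_mult env_act_one)
qed

end

definition free_fun_module :: "('r, 'z) ring_scheme \<Rightarrow> 'x set \<Rightarrow> ('r, 'x \<Rightarrow> 'r) module"
  where "free_fun_module R B =
    \<lparr>carrier = {f. finite {b. f b \<noteq> \<zero>\<^bsub>R\<^esub>} \<and> {b. f b \<noteq> \<zero>\<^bsub>R\<^esub>} \<subseteq> B \<and> (\<forall>b. f b \<in> carrier R)},
     monoid.mult = (\<lambda>f g. f), monoid.one = (\<lambda>b. \<zero>\<^bsub>R\<^esub>), ring.zero = (\<lambda>b. \<zero>\<^bsub>R\<^esub>),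
     ring.add = (\<lambda>f g b. f b \<oplus>\<^bsub>R\<^esub> g b), module.smult = (\<lambda>a f b. a \<otimes>\<^bsub>R\<^esub> f b)\<rparr>"

definition unit_vector :: "('r, 'z) ring_scheme \<Rightarrow> 'x \<Rightarrow> 'x \<Rightarrow> 'r"
  where "unit_vector R b = (\<lambda>c. if c = b then \<one>\<^bsub>R\<^esub> else \<zero>\<^bsub>R\<^esub>)"

lemma left_module_free_fun_module:
  assumes "ring R" shows "left_module R (free_fun_module R B)"
proof -
  interpret R: ring R by fact
  let ?P = "free_fun_module R B"
  have fin: "finite {b. f b \<oplus>\<^bsub>R\<^esub> g b \<noteq> \<zero>\<^bsub>R\<^esub>}" "{b. f b \<oplus>\<^bsub>R\<^esub> g b \<noteq> \<zero>\<^bsub>R\<^esub>} \<subseteq> B" if "f \<in> carrier ?P" "g \<in> carrier ?P" for f g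
  proof -
    have s: "{b. f b \<oplus>\<^bsub>R\<^esub> g b \<noteq> \<zero>\<^bsub>R\<^esub>} \<subseteq> {b. f b \<noteq> \<zero>\<^bsub>R\<^esub>} \<union> {b. g b \<noteq> \<zero>\<^bsub>R\<^esub>}" by auto
    show "finite {b. f b \<oplus>\<^bsub>R\<^esub> g b \<noteq> \<zero>\<^bsub>R\<^esub>}"
      by (rule finite_subset[OF s]) (use that in \<open>auto simp: free_fun_module_def\<close>)
    show "{b. f b \<oplus>\<^bsub>R\<^esub> g b \<noteq> \<zero>\<^bsub>R\<^esub>} \<subseteq> B"
      using s that by (auto simp: free_fun_module_def)
  qed
  have neg: "\<exists>g\<in>carrier ?P. g \<oplus>\<^bsub>?P\<^esub> f = \<zero>\<^bsub>?P\<^esub>" if "f \<in> carrier ?P" for f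
  proof (rule bexI[of _ "\<lambda>b. \<ominus>\<^bsub>R\<^esub> f b"])
    have s: "{b. \<ominus>\<^bsub>R\<^esub> f b \<noteq> \<zero>\<^bsub>R\<^esub>} \<subseteq> {b. f b \<noteq> \<zero>\<^bsub>R\<^esub>}" by auto
    show "(\<lambda>b. \<ominus>\<^bsub>R\<^esub> f b) \<in> carrier ?P"
      using that s finite_subset[OF s] by (auto simp: free_fun_module_def)
    show "(\<lambda>b. \<ominus>\<^bsub>R\<^esub> f b) \<oplus>\<^bsub>?P\<^esub> f = \<zero>\<^bsub>?P\<^esub>"
      using that by (auto simp: free_fun_module_def R.l_neg)
  qed
  interpret P: abelian_group ?P
  proof (rule abelian_groupI)
    fix x assume "x \<in> carrier ?P" thus "\<exists>g\<in>carrier ?P. g \<oplus>\<^bsub>?P\<^esub> x = \<zero>\<^bsub>?P\<^esub>" by (rule neg)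
  next
    fix f g assume "f \<in> carrier ?P" "g \<in> carrier ?P" thus "f \<oplus>\<^bsub>?P\<^esub> g \<in> carrier ?P"
      using fin[of f g] by (simp add: free_fun_module_def)
  qed (auto simp: free_fun_module_def R.a_ac)
  show ?thesis
  proof (unfold_locales)
    fix a f assume h: "a \<in> carrier R" "f \<in> carrier ?P"
    have s: "{b. a \<otimes>\<^bsub>R\<^esub> f b \<noteq> \<zero>\<^bsub>R\<^esub>} \<subseteq> {b. f b \<noteq> \<zero>\<^bsub>R\<^esub>}" using h by auto
    show "a \<odot>\<^bsub>?P\<^esub> f \<in> carrier ?P" using h s finite_subset[OF s] by (auto simp: free_fun_module_def)
  qed (auto simp: free_fun_module_def R.l_distr R.r_distr R.m_assoc)
qed

context left_module
begin

lemma smult_null_l: "x \<in> carrier M \<Longrightarrow> \<zero>\<^bsub>R\<^esub> \<odot>\<^bsub>M\<^esub> x = \<zero>\<^bsub>M\<^esub>"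
  using smult_l_distr[of "\<zero>\<^bsub>R\<^esub>" "\<zero>\<^bsub>R\<^esub>" x] smult_closed[of "\<zero>\<^bsub>R\<^esub>" x]
  by (metis M.add.l_cancel_one R.l_zero R.zero_closed)

lemma smult_null_r: "a \<in> carrier R \<Longrightarrow> a \<odot>\<^bsub>M\<^esub> \<zero>\<^bsub>M\<^esub> = \<zero>\<^bsub>M\<^esub>"
  using smult_r_distr[of a "\<zero>\<^bsub>M\<^esub>" "\<zero>\<^bsub>M\<^esub>"] smult_closed[of a "\<zero>\<^bsub>M\<^esub>"]
  by (metis M.add.l_cancel_one M.l_zero M.zero_closed)

lemma smult_finsum:
  assumes "finite S" "h \<in> S \<rightarrow> carrier M" "a \<in> carrier R"
  shows "a \<odot>\<^bsub>M\<^esub> (\<Oplus>\<^bsub>M\<^esub>b\<in>S. h b) = (\<Oplus>\<^bsub>M\<^esub>b\<in>S. a \<odot>\<^bsub>M\<^esub> h b)"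
  using assms
  by (induction S rule: finite_induct) (auto simp: smult_null_r smult_r_distr Pi_iff)

end

context
  fixes R :: "('r, 'z) ring_scheme" and M :: "('r, 'p) module" and B :: "'x set" and g :: "'x \<Rightarrow> 'p"
  assumes M: "left_module R M" and g: "g ` B \<subseteq> carrier M"
begin

interpretation M: left_module R M by (rule M)

definition lin_ext :: "('x \<Rightarrow> 'r) \<Rightarrow> 'p"
  where "lin_ext f = (\<Oplus>\<^bsub>M\<^esub>b\<in>{b. f b \<noteq> \<zero>\<^bsub>R\<^esub>}. f b \<odot>\<^bsub>M\<^esub> g b)"

lemma lin_ext_eq:
  assumes "finite S" "{b. f b \<noteq> \<zero>\<^bsub>R\<^esub>} \<subseteq> S" "S \<subseteq> B" "\<And>b. f b \<in> carrier R"
  shows "lin_ext f = (\<Oplus>\<^bsub>M\<^esub>b\<in>S. f b \<odot>\<^bsub>M\<^esub> g b)"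
  unfolding lin_ext_def
  by (rule M.M.add.finprod_mono_neutral_cong_left)
     (use assms g in \<open>auto intro!: M.smult_null_l M.smult_closed simp: image_subset_iff subset_iff\<close>)

lemma lin_ext_closed: "f \<in> carrier (free_fun_module R B) \<Longrightarrow> lin_ext f \<in> carrier M"
  unfolding lin_ext_def by (rule M.M.finsum_closed) (use g in \<open>auto simp: free_fun_module_def intro!: M.smult_closed\<close>)

lemma lin_ext_add:
  assumes "f \<in> carrier (free_fun_module R B)" "h \<in> carrier (free_fun_module R B)"
  shows "lin_ext (f \<oplus>\<^bsub>free_fun_module R B\<^esub> h) = lin_ext f \<oplus>\<^bsub>M\<^esub> lin_ext h"
proof -
  let ?S = "{b. f b \<noteq> \<zero>\<^bsub>R\<^esub>} \<union> {b. h b \<noteq> \<zero>\<^bsub>R\<^esub>}"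
  have S: "finite ?S" "?S \<subseteq> B" using assms by (auto simp: free_fun_module_def)
  have fh: "\<And>b. f b \<in> carrier R" "\<And>b. h b \<in> carrier R" using assms by (auto simp: free_fun_module_def)
  have gB: "\<And>b. b \<in> ?S \<Longrightarrow> g b \<in> carrier M" using S g by blast
  have "lin_ext (f \<oplus>\<^bsub>free_fun_module R B\<^esub> h) = (\<Oplus>\<^bsub>M\<^esub>b\<in>?S. (f \<oplus>\<^bsub>free_fun_module R B\<^esub> h) b \<odot>\<^bsub>M\<^esub> g b)"
    by (rule lin_ext_eq) (use S fh in \<open>auto simp: free_fun_module_def\<close>)
  also have "\<dots> = (\<Oplus>\<^bsub>M\<^esub>b\<in>?S. f b \<odot>\<^bsub>M\<^esub> g b \<oplus>\<^bsub>M\<^esub> h b \<odot>\<^bsub>M\<^esub> g b)"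
    by (rule M.M.finsum_cong') (use fh gB in \<open>auto simp: free_fun_module_def M.smult_l_distr\<close>)
  also have "\<dots> = (\<Oplus>\<^bsub>M\<^esub>b\<in>?S. f b \<odot>\<^bsub>M\<^esub> g b) \<oplus>\<^bsub>M\<^esub> (\<Oplus>\<^bsub>M\<^esub>b\<in>?S. h b \<odot>\<^bsub>M\<^esub> g b)"
    by (rule M.M.finsum_addf) (use fh gB in auto)
  also have "\<dots> = lin_ext f \<oplus>\<^bsub>M\<^esub> lin_ext h"
    using lin_ext_eq[OF S(1) _ S(2) fh(1)] lin_ext_eq[OF S(1) _ S(2) fh(2)] by auto
  finally show ?thesis .
qed

lemma lin_ext_smult:
  assumes "f \<in> carrier (free_fun_module R B)" "a \<in> carrier R"
  shows "lin_ext (a \<odot>\<^bsub>free_fun_module R B\<^esub> f) = a \<odot>\<^bsub>M\<^esub> lin_ext f"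
proof -
  let ?S = "{b. f b \<noteq> \<zero>\<^bsub>R\<^esub>}"
  have S: "finite ?S" "?S \<subseteq> B" using assms by (auto simp: free_fun_module_def)
  have fh: "\<And>b. f b \<in> carrier R" using assms by (auto simp: free_fun_module_def)
  have gB: "\<And>b. b \<in> ?S \<Longrightarrow> g b \<in> carrier M" using S g by blast
  have "lin_ext (a \<odot>\<^bsub>free_fun_module R B\<^esub> f) = (\<Oplus>\<^bsub>M\<^esub>b\<in>?S. (a \<odot>\<^bsub>free_fun_module R B\<^esub> f) b \<odot>\<^bsub>M\<^esub> g b)"
    by (rule lin_ext_eq) (use S fh assms(2) in \<open>auto simp: free_fun_module_def\<close>)
  also have "\<dots> = (\<Oplus>\<^bsub>M\<^esub>b\<in>?S. a \<odot>\<^bsub>M\<^esub> (f b \<odot>\<^bsub>M\<^esub> g b))"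
    by (rule M.M.finsum_cong') (use fh gB assms(2) in \<open>auto simp: free_fun_module_def M.smult_assoc1\<close>)
  also have "\<dots> = a \<odot>\<^bsub>M\<^esub> lin_ext f"
    unfolding lin_ext_def by (rule M.smult_finsum[symmetric]) (use S fh gB assms(2) in auto)
  finally show ?thesis .
qed

lemma lin_ext_unit_vector: "b \<in> B \<Longrightarrow> lin_ext (unit_vector R b) = g b"
proof -
  assume b: "b \<in> B"
  have "lin_ext (unit_vector R b) = (\<Oplus>\<^bsub>M\<^esub>b'\<in>{b}. unit_vector R b b' \<odot>\<^bsub>M\<^esub> g b')"
    by (rule lin_ext_eq) (use b in \<open>auto simp: unit_vector_def split: if_splits\<close>)
  also have "\<dots> = g b" using b g by (simp add: unit_vector_def image_subset_iff)
  finally show ?thesis .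
qed

lemma lin_ext_hom: "restrict lin_ext (carrier (free_fun_module R B)) \<in> left_module_hom R (free_fun_module R B) M"
proof -
  interpret P: left_module R "free_fun_module R B" by (rule left_module_free_fun_module) (rule M.R.ring_axioms)
  show ?thesis by (auto simp: left_module_hom_def lin_ext_closed lin_ext_add lin_ext_smult)
qed

end

lemma unit_vector_carrier: "ring R \<Longrightarrow> b \<in> B \<Longrightarrow> unit_vector R b \<in> carrier (free_fun_module R B)"
proof -
  assume r: "ring R" and b: "b \<in> B"
  interpret ring R by (rule r)
  have "{c. unit_vector R b c \<noteq> \<zero>\<^bsub>R\<^esub>} \<subseteq> {b}" by (auto simp: unit_vector_def)
  thus ?thesis using b finite_subset[of "{c. unit_vector R b c \<noteq> \<zero>\<^bsub>R\<^esub>}" "{b}"]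
    by (auto simp: free_fun_module_def unit_vector_def)
qed

lemma finsum_free_fun_module_apply:
  assumes R: "ring R" and "finite S" and "h \<in> S \<rightarrow> carrier (free_fun_module R B)"
  shows "(\<Oplus>\<^bsub>free_fun_module R B\<^esub>s\<in>S. h s) b = (\<Oplus>\<^bsub>R\<^esub>s\<in>S. h s b)"
proof -
  interpret R: ring R by (rule R)
  interpret P: left_module R "free_fun_module R B" by (rule left_module_free_fun_module) (rule R)
  have c: "f \<in> carrier (free_fun_module R B) \<Longrightarrow> f b \<in> carrier R" for f by (auto simp: free_fun_module_def)
  show ?thesis using assms(2,3)
  proof (induction S rule: finite_induct)
    case empty show ?case by (simp, simp add: free_fun_module_def)
  next
    case (insert s S)
    have e: "(f \<oplus>\<^bsub>free_fun_module R B\<^esub> f') b = f b \<oplus>\<^bsub>R\<^esub> f' b" for f f' by (simp add: free_fun_module_def)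
    have "h s \<in> carrier (free_fun_module R B)" "h \<in> S \<rightarrow> carrier (free_fun_module R B)" "(\<lambda>s. h s b) \<in> S \<rightarrow> carrier R"
      using insert.prems c by auto
    thus ?case using insert c by (simp add: P.M.finsum_insert R.finsum_insert e)
  qed
qed

lemma free_free_fun_module:
  fixes R :: "('r, 'z) ring_scheme" and B :: "'x set"
  assumes R: "ring R"
  shows "free_left_module R (free_fun_module R B)"
proof (cases "\<one>\<^bsub>R\<^esub> = \<zero>\<^bsub>R\<^esub>")
  case True
  interpret R: ring R by (rule R)
  interpret P: left_module R "free_fun_module R B" by (rule left_module_free_fun_module) (rule R)
  have c0: "carrier R = {\<zero>\<^bsub>R\<^esub>}" using True R.one_zeroD by simp
  have c1: "carrier (free_fun_module R B) = {\<zero>\<^bsub>free_fun_module R B\<^esub>}" using c0 by (auto simp: free_fun_module_def)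
  show ?thesis unfolding free_left_module_def
    by (intro conjI P.left_module_axioms exI[of _ "{}"]) (auto simp: c1)
next
  case nz: False
  interpret R: ring R by (rule R)
  interpret P: left_module R "free_fun_module R B" by (rule left_module_free_fun_module) (rule R)
  let ?P = "free_fun_module R B" and ?E = "unit_vector R ` B"
  have inj: "inj (unit_vector R :: 'x \<Rightarrow> 'x \<Rightarrow> 'r)" using nz by (auto simp: inj_def unit_vector_def fun_eq_iff split: if_splits)
  have u: "\<And>b. b \<in> B \<Longrightarrow> unit_vector R b \<in> carrier ?P" by (rule unit_vector_carrier[OF R])
  have val: "(\<Oplus>\<^bsub>?P\<^esub>e\<in>{e\<in>?E. c e \<noteq> \<zero>\<^bsub>R\<^esub>}. c e \<odot>\<^bsub>?P\<^esub> e) b = (if b \<in> B then c (unit_vector R b) else \<zero>\<^bsub>R\<^esub>)"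
    if c: "c \<in> ?E \<rightarrow>\<^sub>E carrier R" and fin: "finite {e\<in>?E. c e \<noteq> \<zero>\<^bsub>R\<^esub>}" for c b
  proof -
    let ?S = "{e\<in>?E. c e \<noteq> \<zero>\<^bsub>R\<^esub>}"
    have "(\<Oplus>\<^bsub>?P\<^esub>e\<in>?S. c e \<odot>\<^bsub>?P\<^esub> e) b = (\<Oplus>\<^bsub>R\<^esub>e\<in>?S. (c e \<odot>\<^bsub>?P\<^esub> e) b)"
      by (rule finsum_free_fun_module_apply[OF R fin]) (use c u in \<open>auto intro!: P.smult_closed\<close>)
    also have "\<dots> = (\<Oplus>\<^bsub>R\<^esub>e\<in>?S. if unit_vector R b = e then c e else \<zero>\<^bsub>R\<^esub>)"
    proof (rule R.finsum_cong')
      fix e assume e: "e \<in> ?S"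
      then obtain b' where b': "b' \<in> B" "e = unit_vector R b'" by auto
      have "unit_vector R b = e \<longleftrightarrow> b = b'" using inj b' by (auto dest: injD)
      thus "(c e \<odot>\<^bsub>?P\<^esub> e) b = (if unit_vector R b = e then c e else \<zero>\<^bsub>R\<^esub>)"
        using b' PiE_mem[OF c, of e] e by (auto simp: free_fun_module_def unit_vector_def)
    qed (use c in auto)
    also have "\<dots> = (if b \<in> B then c (unit_vector R b) else \<zero>\<^bsub>R\<^esub>)"
    proof (cases "unit_vector R b \<in> ?S")
      case True
      hence "b \<in> B" using inj by (auto dest: injD)
      thus ?thesis using R.finsum_singleton[OF True fin, of c] c by auto
    next
      case False
      hence "(\<Oplus>\<^bsub>R\<^esub>e\<in>?S. if unit_vector R b = e then c e else \<zero>\<^bsub>R\<^esub>) = (\<Oplus>\<^bsub>R\<^esub>e\<in>?S. \<zero>\<^bsub>R\<^esub>)"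
        by (intro R.finsum_cong') auto
      thus ?thesis using False by auto
    qed
    finally show ?thesis .
  qed
  show ?thesis unfolding free_left_module_def
  proof (intro conjI P.left_module_axioms exI[of _ ?E] ballI)
    show "?E \<subseteq> carrier ?P" using u by auto
    fix x assume x: "x \<in> carrier ?P"
    show "\<exists>!c. c \<in> ?E \<rightarrow>\<^sub>E carrier R \<and> finite {b \<in> ?E. c b \<noteq> \<zero>\<^bsub>R\<^esub>} \<and> x = (\<Oplus>\<^bsub>?P\<^esub>b\<in>{b \<in> ?E. c b \<noteq> \<zero>\<^bsub>R\<^esub>}. c b \<odot>\<^bsub>?P\<^esub> b)"
    proof (rule ex1I)
      let ?c = "\<lambda>e\<in>?E. x (inv_into UNIV (unit_vector R) e)"
      have cv: "b \<in> B \<Longrightarrow> ?c (unit_vector R b) = x b" for b using inj by simp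
      have c: "?c \<in> ?E \<rightarrow>\<^sub>E carrier R" using x by (auto simp: free_fun_module_def)
      have "{b \<in> ?E. ?c b \<noteq> \<zero>\<^bsub>R\<^esub>} \<subseteq> unit_vector R ` {b. x b \<noteq> \<zero>\<^bsub>R\<^esub>}" using inj by auto
      moreover have "finite (unit_vector R ` {b. x b \<noteq> \<zero>\<^bsub>R\<^esub>})" using x by (auto simp: free_fun_module_def)
      ultimately have f: "finite {b \<in> ?E. ?c b \<noteq> \<zero>\<^bsub>R\<^esub>}" by (rule finite_subset)
      have "x = (\<Oplus>\<^bsub>?P\<^esub>b\<in>{b \<in> ?E. ?c b \<noteq> \<zero>\<^bsub>R\<^esub>}. ?c b \<odot>\<^bsub>?P\<^esub> b)"
      proof
        fix b
        show "x b = (\<Oplus>\<^bsub>?P\<^esub>b\<in>{b \<in> ?E. ?c b \<noteq> \<zero>\<^bsub>R\<^esub>}. ?c b \<odot>\<^bsub>?P\<^esub> b) b"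
          unfolding val[OF c f] using x cv by (auto simp: free_fun_module_def)
      qed
      thus "?c \<in> ?E \<rightarrow>\<^sub>E carrier R \<and> finite {b \<in> ?E. ?c b \<noteq> \<zero>\<^bsub>R\<^esub>} \<and> x = (\<Oplus>\<^bsub>?P\<^esub>b\<in>{b \<in> ?E. ?c b \<noteq> \<zero>\<^bsub>R\<^esub>}. ?c b \<odot>\<^bsub>?P\<^esub> b)"
        using c f by blast
      fix c' assume h: "c' \<in> ?E \<rightarrow>\<^sub>E carrier R \<and> finite {b \<in> ?E. c' b \<noteq> \<zero>\<^bsub>R\<^esub>} \<and> x = (\<Oplus>\<^bsub>?P\<^esub>b\<in>{b \<in> ?E. c' b \<noteq> \<zero>\<^bsub>R\<^esub>}. c' b \<odot>\<^bsub>?P\<^esub> b)"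
      show "c' = ?c"
      proof (rule PiE_ext[OF conjunct1[OF h] c])
        fix e assume "e \<in> ?E"
        then obtain b where b: "b \<in> B" "e = unit_vector R b" by auto
        have "x b = c' e" using val[of c' b] h b by auto
        thus "c' e = ?c e" using cv[OF b(1)] b(2) by simp
      qed
    qed
  qed
qed

lemma free_cover_exists:
  fixes M :: "('r, 'p) module"
  assumes M: "left_module R M" and le: "carrier M \<lesssim> (UNIV :: 'x set)"
    and inf: "infinite (UNIV :: 'x set)" and rle: "(UNIV :: 'r set) \<lesssim> (UNIV :: 'x set)"
  shows "\<exists>(P :: ('r, 'x \<Rightarrow> 'r) module) e. free_left_module R P \<and> carrier P \<lesssim> (UNIV :: 'x set) \<and>
     e \<in> left_module_hom R P M \<and> e ` carrier P = carrier M"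
proof -
  interpret M: left_module R M by (rule M)
  obtain i :: "'p \<Rightarrow> 'x" where i: "inj_on i (carrier M)" using le by (auto simp: lepoll_def)
  let ?B = "i ` carrier M" and ?g = "inv_into (carrier M) i"
  have g: "?g ` ?B = carrier M" using i by (simp add: inv_into_image_cancel)
  let ?P = "free_fun_module R ?B" let ?e = "restrict (lin_ext R M ?g) (carrier ?P)"
  have "carrier ?P \<lesssim> (UNIV :: 'x set)"
  proof -
    obtain r :: "'r \<Rightarrow> 'x" where r: "inj r" using rle by (auto simp: lepoll_def)
    have "carrier ?P \<lesssim> Fpow (UNIV :: ('x \<times> 'x) set)"
    proof -
      define enc where "enc f = (\<lambda>b. (b, r (f b))) ` {b. f b \<noteq> \<zero>\<^bsub>R\<^esub>}" for f :: "'x \<Rightarrow> 'r"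
      have "inj_on enc (carrier ?P)"
      proof (rule inj_onI, rule ext)
        fix f f' b assume h: "f \<in> carrier ?P" "f' \<in> carrier ?P" "enc f = enc f'"
        hence e: "(\<lambda>b. (b, r (f b))) ` {b. f b \<noteq> \<zero>\<^bsub>R\<^esub>} = (\<lambda>b. (b, r (f' b))) ` {b. f' b \<noteq> \<zero>\<^bsub>R\<^esub>}"
          by (simp add: enc_def)
        show "f b = f' b"
        proof (cases "f b = \<zero>\<^bsub>R\<^esub>")
          case True
          have "f' b = \<zero>\<^bsub>R\<^esub>"
          proof (rule ccontr)
            assume "f' b \<noteq> \<zero>\<^bsub>R\<^esub>"
            hence "(b, r (f' b)) \<in> (\<lambda>b. (b, r (f b))) ` {b. f b \<noteq> \<zero>\<^bsub>R\<^esub>}" unfolding e by auto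
            thus False using True by auto
          qed
          thus ?thesis using True by simp
        next
          case False
          hence "(b, r (f b)) \<in> (\<lambda>b. (b, r (f' b))) ` {b. f' b \<noteq> \<zero>\<^bsub>R\<^esub>}" unfolding e[symmetric] by auto
          hence "r (f b) = r (f' b)" by auto
          thus ?thesis using r by (auto dest: injD)
        qed
      qed
      moreover have "enc ` carrier ?P \<subseteq> Fpow UNIV" by (auto simp: enc_def free_fun_module_def Fpow_def)
      ultimately show ?thesis by (auto simp: lepoll_def)
    qed
    also have "Fpow (UNIV :: ('x \<times> 'x) set) \<lesssim> (UNIV :: ('x \<times> 'x) set)"
      by (rule eqpoll_imp_lepoll, rule eqpoll_Fpow) (simp add: inf finite_prod)
    also have "(UNIV :: ('x \<times> 'x) set) \<lesssim> (UNIV :: 'x set)"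
      by (rule eqpoll_imp_lepoll) (use card_of_Times_same_infinite[OF inf] in \<open>simp add: eqpoll_iff_card_of_ordIso\<close>)
    finally show ?thesis .
  qed
  moreover have hom: "?e \<in> left_module_hom R ?P M" by (rule lin_ext_hom[OF M]) (simp add: g)
  moreover have "?e ` carrier ?P = carrier M"
  proof
    show "?e ` carrier ?P \<subseteq> carrier M" using hom by (auto simp: left_module_hom_def)
    show "carrier M \<subseteq> ?e ` carrier ?P"
    proof
      fix m assume m: "m \<in> carrier M"
      have "?e (unit_vector R (i m)) = m"
        using m i unit_vector_carrier[OF M.R.ring_axioms, of "i m" ?B] lin_ext_unit_vector[OF M, of ?g ?B "i m"] g by simp
      thus "m \<in> ?e ` carrier ?P" using m unit_vector_carrier[OF M.R.ring_axioms, of "i m" ?B] by (metis image_eqI)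
    qed
  qed
  moreover have "free_left_module R ?P" by (rule free_free_fun_module[OF M.R.ring_axioms])
  ultimately show ?thesis by blast
qed

lemma left_module_kernel:
  assumes P: "left_module R P" and M: "left_module R M" and e: "e \<in> left_module_hom R P M"
  shows "left_module R (P\<lparr>carrier := {x \<in> carrier P. e x = \<zero>\<^bsub>M\<^esub>}\<rparr>)" (is "left_module R ?K")
proof -
  interpret P: left_module R P by (rule P)
  interpret M: left_module R M by (rule M)
  have add: "\<And>x y. x \<in> carrier P \<Longrightarrow> y \<in> carrier P \<Longrightarrow> e (x \<oplus>\<^bsub>P\<^esub> y) = e x \<oplus>\<^bsub>M\<^esub> e y"
    and sm: "\<And>a x. a \<in> carrier R \<Longrightarrow> x \<in> carrier P \<Longrightarrow> e (a \<odot>\<^bsub>P\<^esub> x) = a \<odot>\<^bsub>M\<^esub> e x"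
    and cl: "\<And>x. x \<in> carrier P \<Longrightarrow> e x \<in> carrier M"
    using e by (auto simp: left_module_hom_def)
  have e0: "e \<zero>\<^bsub>P\<^esub> = \<zero>\<^bsub>M\<^esub>"
    using add[of "\<zero>\<^bsub>P\<^esub>" "\<zero>\<^bsub>P\<^esub>"] cl[of "\<zero>\<^bsub>P\<^esub>"] by (metis M.M.add.l_cancel_one P.M.l_zero P.M.zero_closed)
  have en: "x \<in> carrier P \<Longrightarrow> e x = \<zero>\<^bsub>M\<^esub> \<Longrightarrow> e (\<ominus>\<^bsub>P\<^esub> x) = \<zero>\<^bsub>M\<^esub>" for x
    using add[of x "\<ominus>\<^bsub>P\<^esub> x"] cl[of "\<ominus>\<^bsub>P\<^esub> x"] by (simp add: P.M.r_neg e0)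
  interpret K: abelian_group ?K
  proof (rule abelian_groupI)
    fix x assume "x \<in> carrier ?K"
    thus "\<exists>y\<in>carrier ?K. y \<oplus>\<^bsub>?K\<^esub> x = \<zero>\<^bsub>?K\<^esub>"
      by (intro bexI[of _ "\<ominus>\<^bsub>P\<^esub> x"]) (auto simp: en P.M.l_neg)
  qed (auto simp: add e0 P.M.a_ac)
  show ?thesis
    by unfold_locales (auto simp: sm M.smult_null_r P.smult_l_distr P.smult_r_distr P.smult_assoc1)
qed

theorem free_resolution_exists:
  fixes R :: "('r, 'z) ring_scheme" and M :: "('r, 'm) module"
  assumes M: "left_module R M"
  shows "\<exists>(P :: nat \<Rightarrow> ('r, ('r, 'm) resolution_carrier) module) d e. free_resolution R M P d e"
proof -
  let ?X = "UNIV :: ('r + 'm) list set"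
  have inf: "infinite ?X" by (rule infinite_UNIV_listI)
  have rle: "(UNIV :: 'r set) \<lesssim> ?X" unfolding lepoll_def
    by (intro exI[of _ "\<lambda>r. [Inl r]"]) (auto simp: inj_on_def)
  have "carrier M \<lesssim> ?X" unfolding lepoll_def
    by (intro exI[of _ "\<lambda>r. [Inr r]"]) (auto simp: inj_on_def)
  from free_cover_exists[OF M this inf rle] obtain P0 :: "('r, ('r, 'm) resolution_carrier) module" and e
    where P0: "free_left_module R P0" "carrier P0 \<lesssim> ?X" "e \<in> left_module_hom R P0 M" "e ` carrier P0 = carrier M"
    by blast
  define good where "good s \<longleftrightarrow> (case s of (P, K) \<Rightarrow> free_left_module R P \<and> carrier P \<lesssim> ?X \<and> K \<subseteq> carrier P \<and> left_module R (P\<lparr>carrier := K\<rparr>))"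
    for s :: "('r, ('r, 'm) resolution_carrier) module \<times> ('r, 'm) resolution_carrier set"
  define stp where "stp s s' \<longleftrightarrow> (case (s, s') of ((P, K), (P', K')) \<Rightarrow>
      \<exists>d \<in> left_module_hom R P' P. d ` carrier P' = K \<and> K' = {x \<in> carrier P'. d x = \<zero>\<^bsub>P\<^esub>})"
    for s s' :: "('r, ('r, 'm) resolution_carrier) module \<times> ('r, 'm) resolution_carrier set"
  let ?K0 = "{x \<in> carrier P0. e x = \<zero>\<^bsub>M\<^esub>}"
  have "\<exists>f. \<forall>n. (good (f n) \<and> (n = 0 \<longrightarrow> f n = (P0, ?K0))) \<and> stp (f n) (f (Suc n))"
  proof (rule dependent_nat_choice)
    show "\<exists>x. good x \<and> ((0::nat) = 0 \<longrightarrow> x = (P0, ?K0))"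
      using P0 left_module_kernel[OF _ M P0(3)] by (auto simp: good_def free_left_module_def)
  next
    fix s and n :: nat assume "good s \<and> (n = 0 \<longrightarrow> s = (P0, ?K0))"
    then obtain P K where s: "s = (P, K)" and g: "free_left_module R P" "carrier P \<lesssim> ?X" "K \<subseteq> carrier P" "left_module R (P\<lparr>carrier := K\<rparr>)"
      by (cases s) (auto simp: good_def)
    have Kle: "carrier (P\<lparr>carrier := K\<rparr>) \<lesssim> ?X"
      using lepoll_trans[OF subset_imp_lepoll[OF g(3)] g(2)] by simp
    from free_cover_exists[OF g(4) Kle inf rle] obtain P' :: "('r, ('r, 'm) resolution_carrier) module" and d
      where P': "free_left_module R P'" "carrier P' \<lesssim> ?X" "d \<in> left_module_hom R P' (P\<lparr>carrier := K\<rparr>)" "d ` carrier P' = K"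
      by auto
    have d: "d \<in> left_module_hom R P' P" using P'(3) g(3) by (auto simp: left_module_hom_def PiE_iff)
    have "good (P', {x \<in> carrier P'. d x = \<zero>\<^bsub>P\<^esub>})"
      using P' left_module_kernel[OF _ _ d] g by (auto simp: good_def free_left_module_def)
    moreover have "stp s (P', {x \<in> carrier P'. d x = \<zero>\<^bsub>P\<^esub>})" using s d P' by (auto simp: stp_def)
    ultimately show "\<exists>y. (good y \<and> (Suc n = 0 \<longrightarrow> y = (P0, ?K0))) \<and> stp s y" by blast
  qed
  then obtain f where f: "\<And>n. good (f n)" "f 0 = (P0, ?K0)" "\<And>n. stp (f n) (f (Suc n))" by blast
  define P where "P n = fst (f n)" for n
  define K where "K n = snd (f n)" for n
  have "\<forall>n. \<exists>d. d \<in> left_module_hom R (P (Suc n)) (P n) \<and> d ` carrier (P (Suc n)) = K n \<and> K (Suc n) = {x \<in> carrier (P (Suc n)). d x = \<zero>\<^bsub>P n\<^esub>}"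
    using f(3) by (simp add: stp_def P_def K_def split_beta Bex_def)
  from choice[OF this] obtain d where
    "\<forall>n. d n \<in> left_module_hom R (P (Suc n)) (P n) \<and> d n ` carrier (P (Suc n)) = K n \<and> K (Suc n) = {x \<in> carrier (P (Suc n)). d n x = \<zero>\<^bsub>P n\<^esub>}"
    by (rule exE)
  hence d: "d n \<in> left_module_hom R (P (Suc n)) (P n)" "d n ` carrier (P (Suc n)) = K n"
     "K (Suc n) = {x \<in> carrier (P (Suc n)). d n x = \<zero>\<^bsub>P n\<^esub>}" for n by simp_all
  have fr: "free_left_module R (P n)" for n using f(1)[of n] by (simp add: good_def P_def split_beta)
  have PK0: "P 0 = P0" "K 0 = ?K0" using f(2) by (simp_all add: P_def K_def)
  have "free_resolution R M P d e" unfolding free_resolution_def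
  proof (intro conjI allI)
    show "d 0 ` carrier (P 1) = {x \<in> carrier (P 0). e x = \<zero>\<^bsub>M\<^esub>}"
      using d(2)[of 0] by (simp add: PK0)
    show "d (Suc n) ` carrier (P (Suc (Suc n))) = {x \<in> carrier (P (Suc n)). d n x = \<zero>\<^bsub>P n\<^esub>}" for n
      unfolding d(2) d(3) by (rule refl)
  qed (use fr d(1) P0 in \<open>simp_all add: PK0\<close>)
  thus ?thesis by blast
qed

end

theory Submission
  imports Defs
begin

text \<open>
  The algebra \<open>\<Lambda> q\<close> is the twisted tensor product of \<open>k[x]/(x\<^sup>2)\<close> and \<open>k[y]/(y\<^sup>2)\<close>, and the tensor
  product of the two periodic bimodule resolutions, with a twisted bimodule structure, is a free
  bimodule resolution of it, with one generator in each bidegree \<open>(i, j)\<close>. The complex of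
  homomorphisms to \<open>\<Lambda> q\<close> then splits into squares
  \<open>1 @ (i, j) \<rightarrow> x @ (i + 1, j), y @ (i, j + 1) \<rightarrow> xy @ (i + 1, j + 1)\<close> with the coefficients
  \<open>A = 1 - (-1)\<^sup>i\<^sup>+\<^sup>j q\<^sup>j\<close> and \<open>C = q\<^sup>i - (-1)\<^sup>i\<^sup>+\<^sup>j\<close>, apart from some two-term complexes with non-zero
  differential. Such a square is exact unless \<open>A = C = 0\<close>. If \<open>q\<close> has large order \<open>r\<close>, this happens for
  small \<open>i + j\<close> only at \<open>(0, 0)\<close>, which contributes in degrees at most 2, whereas it does happen at
  \<open>(2r, 0)\<close>.
\<close>

section \<open>Independence of the resolution\<close>

text \<open>\<open>Ext\<close> is computed from a resolution picked by \<open>SOME\<close>, so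
  nothing can be read off it directly. The theorem only asks whether groups are trivial, hence no
  isomorphism of cohomology groups is built: it suffices to transfer the inclusion of cocycles in
  coboundaries from one free resolution to another, in positive degrees. The second obstacle is that
  \<open>\<Lambda> q\<close> and its enveloping algebra are quotients by generated ideals, where
  equalities are easy to prove but inequalities are not. Both are therefore made to act on explicit
  coordinate functions; applying an element to 1, or to a generator of the resolution, recovers its
  coefficients. This gives the dimensions 4 and 16 and, with them, freeness. As for the constants, A
  = 0 forces q^j = 1 or -1 and C = 0 forces q^i = 1 or -1. Excluding q^(2k) = 1 for 0 < k <= N rules
  out both signs at once, in every characteristic; hence the bound 2N + 1 for r. At (2r, 0) the even
  exponent makes the sign trivial whatever the parity of r.\<close>

lemma left_module_homD:
  assumes "f \<in> left_module_hom R P M"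
  shows "x \<in> carrier P \<Longrightarrow> f x \<in> carrier M"
    and "x \<in> carrier P \<Longrightarrow> y \<in> carrier P \<Longrightarrow> f (x \<oplus>\<^bsub>P\<^esub> y) = f x \<oplus>\<^bsub>M\<^esub> f y"
    and "a \<in> carrier R \<Longrightarrow> x \<in> carrier P \<Longrightarrow> f (a \<odot>\<^bsub>P\<^esub> x) = a \<odot>\<^bsub>M\<^esub> f x"
    and "x \<notin> carrier P \<Longrightarrow> f x = undefined"
  using assms by (auto simp: left_module_hom_def PiE_iff extensional_def)

lemma left_module_homI:
  assumes "\<And>x. x \<in> carrier P \<Longrightarrow> f x \<in> carrier M"
    and "\<And>x y. x \<in> carrier P \<Longrightarrow> y \<in> carrier P \<Longrightarrow> f (x \<oplus>\<^bsub>P\<^esub> y) = f x \<oplus>\<^bsub>M\<^esub> f y"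
    and "\<And>a x. a \<in> carrier R \<Longrightarrow> x \<in> carrier P \<Longrightarrow> f (a \<odot>\<^bsub>P\<^esub> x) = a \<odot>\<^bsub>M\<^esub> f x"
    and "left_module R P"
  shows "restrict f (carrier P) \<in> left_module_hom R P M"
proof -
  interpret P: left_module R P by (rule assms(4))
  show ?thesis using assms(1-3) by (auto simp: left_module_hom_def)
qed

lemma left_module_hom_zero:
  assumes "left_module R P" "left_module R M" "f \<in> left_module_hom R P M"
  shows "f \<zero>\<^bsub>P\<^esub> = \<zero>\<^bsub>M\<^esub>"
proof -
  interpret P: left_module R P by fact
  interpret M: left_module R M by fact
  show ?thesis
    using left_module_homD(1,2)[OF assms(3), of "\<zero>\<^bsub>P\<^esub>"] 
    by (metis M.M.add.l_cancel_one P.M.l_zero P.M.zero_closed)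
qed

lemma left_module_hom_minus:
  assumes "left_module R P" "left_module R M" "f \<in> left_module_hom R P M"
    and "x \<in> carrier P" "y \<in> carrier P"
  shows "f (x \<ominus>\<^bsub>P\<^esub> y) = f x \<ominus>\<^bsub>M\<^esub> f y"
proof -
  interpret P: left_module R P by fact
  interpret M: left_module R M by fact
  note f = left_module_homD[OF assms(3)]
  have "f (\<ominus>\<^bsub>P\<^esub> y) \<oplus>\<^bsub>M\<^esub> f y = \<zero>\<^bsub>M\<^esub>"
    using assms f(2)[of "\<ominus>\<^bsub>P\<^esub> y" y] by (simp add: P.M.l_neg left_module_hom_zero)
  hence "f (\<ominus>\<^bsub>P\<^esub> y) = \<ominus>\<^bsub>M\<^esub> f y"
    using assms f(1) M.M.minus_equality by (metis P.M.a_inv_closed)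
  thus ?thesis using assms f by (simp add: a_minus_def)
qed

lemma left_module_hom_compose:
  assumes "left_module R P" "f \<in> left_module_hom R P M" "g \<in> left_module_hom R M N"
  shows "compose (carrier P) g f \<in> left_module_hom R P N"
  unfolding compose_def
  by (rule left_module_homI[OF _ _ _ assms(1)])
     (simp_all add: left_module_homD[OF assms(2)] left_module_homD[OF assms(3)])

lemma left_module_hom_finsum:
  assumes "left_module R P" "left_module R M" "f \<in> left_module_hom R P M"
    and "finite S" "h \<in> S \<rightarrow> carrier P"
  shows "f (\<Oplus>\<^bsub>P\<^esub>s\<in>S. h s) = (\<Oplus>\<^bsub>M\<^esub>s\<in>S. f (h s))"
proof -
  interpret P: left_module R P by fact
  interpret M: left_module R M by fact
  note f = left_module_homD[OF assms(3)]
  show ?thesis using assms(4,5)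
  proof (induction S rule: finite_induct)
    case empty thus ?case using assms by (simp add: left_module_hom_zero)
  next
    case (insert s S)
    hence "h s \<in> carrier P" "h \<in> S \<rightarrow> carrier P" by auto
    moreover hence "(\<lambda>s. f (h s)) \<in> S \<rightarrow> carrier M" using f by auto
    ultimately show ?case using insert f
      by (simp add: P.M.finsum_insert M.M.finsum_insert P.M.finsum_closed)
  qed
qed

lemma left_module_hom_eqI:
  assumes "f \<in> left_module_hom R P M" "g \<in> left_module_hom R P M"
    and "\<And>x. x \<in> carrier P \<Longrightarrow> f x = g x"
  shows "f = g"
  using assms left_module_homD(4)[OF assms(1)] left_module_homD(4)[OF assms(2)] by (metis ext)

section \<open>Free modules: maps prescribed on a basis, and lifting\<close>

definition free_on :: "('r, 'z) ring_scheme \<Rightarrow> ('r, 'p) module \<Rightarrow> 'p set \<Rightarrow> bool"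
  where "free_on R P B \<longleftrightarrow> B \<subseteq> carrier P \<and>
    (\<forall>x \<in> carrier P. \<exists>!c. c \<in> B \<rightarrow>\<^sub>E carrier R \<and>
       finite {b \<in> B. c b \<noteq> \<zero>\<^bsub>R\<^esub>} \<and> x = (\<Oplus>\<^bsub>P\<^esub>b \<in> {b \<in> B. c b \<noteq> \<zero>\<^bsub>R\<^esub>}. c b \<odot>\<^bsub>P\<^esub> b))"

lemma free_left_module_iff: "free_left_module R P \<longleftrightarrow> left_module R P \<and> (\<exists>B. free_on R P B)"
  by (auto simp: free_left_module_def free_on_def)

lemma free_on_hom_unique:
  assumes "left_module R P" "left_module R M" "free_on R P B"
    and f: "f \<in> left_module_hom R P M" and g: "g \<in> left_module_hom R P M"
    and eq: "\<And>b. b \<in> B \<Longrightarrow> f b = g b"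
  shows "f = g"
proof (rule left_module_hom_eqI[OF f g])
  interpret P: left_module R P by fact
  interpret M: left_module R M by fact
  have BP: "B \<subseteq> carrier P" using assms(3) by (simp add: free_on_def)
  fix x assume "x \<in> carrier P"
  then obtain c where c: "c \<in> B \<rightarrow>\<^sub>E carrier R" "finite {b \<in> B. c b \<noteq> \<zero>\<^bsub>R\<^esub>}"
    "x = (\<Oplus>\<^bsub>P\<^esub>b \<in> {b \<in> B. c b \<noteq> \<zero>\<^bsub>R\<^esub>}. c b \<odot>\<^bsub>P\<^esub> b)"
    using assms(3) unfolding free_on_def by blast
  let ?S = "{b \<in> B. c b \<noteq> \<zero>\<^bsub>R\<^esub>}"
  have cl: "(\<lambda>b. c b \<odot>\<^bsub>P\<^esub> b) \<in> ?S \<rightarrow> carrier P" using c BP by (auto intro!: P.smult_closed)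
  have "f x = (\<Oplus>\<^bsub>M\<^esub>b\<in>?S. f (c b \<odot>\<^bsub>P\<^esub> b))"
    unfolding c(3) by (rule left_module_hom_finsum[OF assms(1,2) f c(2) cl])
  also have "\<dots> = (\<Oplus>\<^bsub>M\<^esub>b\<in>?S. g (c b \<odot>\<^bsub>P\<^esub> b))"
  proof (rule M.M.finsum_cong')
    show "(\<lambda>b. g (c b \<odot>\<^bsub>P\<^esub> b)) \<in> ?S \<rightarrow> carrier M" using cl left_module_homD(1)[OF g] by auto
    fix b assume "b \<in> ?S"
    thus "f (c b \<odot>\<^bsub>P\<^esub> b) = g (c b \<odot>\<^bsub>P\<^esub> b)"
      using PiE_mem[OF c(1), of b] subsetD[OF BP, of b] eq[of b]
      by (simp add: left_module_homD(3)[OF f] left_module_homD(3)[OF g])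
  qed simp
  also have "\<dots> = g x"
    unfolding c(3) by (rule left_module_hom_finsum[OF assms(1,2) g c(2) cl, symmetric])
  finally show "f x = g x" .
qed

text \<open>By the basis property, \<open>lin_ext\<close> along the inclusion of B is a bijective
  homomorphism \<Phi> from \<open>free_fun_module R B\<close> to P. Its inverse \<Psi> reads off the
  coefficients, and the linear extension of g after \<Psi> is the required map.\<close>

lemma free_on_hom_exists:
  assumes P: "left_module R P" and M: "left_module R M" and B: "free_on R P B"
    and g: "\<And>b. b \<in> B \<Longrightarrow> g b \<in> carrier M"
  shows "\<exists>h\<in>left_module_hom R P M. \<forall>b\<in>B. h b = g b"
proof -
  interpret P: left_module R P by fact
  interpret M: left_module R M by fact
  let ?F = "free_fun_module R B"
  interpret F: left_module R ?F by (rule left_module_free_fun_module) (rule P.R.ring_axioms)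
  have BP: "B \<subseteq> carrier P" using B by (simp add: free_on_def)
  define \<Phi> where "\<Phi> = restrict (lin_ext R P (\<lambda>b. b)) (carrier ?F)"
  have idB: "(\<lambda>b. b) ` B \<subseteq> carrier P" using BP by auto
  have gB: "g ` B \<subseteq> carrier M" using g by auto
  have \<Phi>: "\<Phi> \<in> left_module_hom R ?F P"
    unfolding \<Phi>_def by (rule lin_ext_hom[OF P idB])
  \<comment> \<open>Coefficient families in \<open>free_on\<close> are undefined off B, those in
    \<open>free_fun_module\<close> are zero off B; \<open>restrict\<close> translates between the
    two.\<close>
  have \<Phi>c: "\<Phi> f = (\<Oplus>\<^bsub>P\<^esub>b \<in> {b \<in> B. restrict f B b \<noteq> \<zero>\<^bsub>R\<^esub>}. restrict f B b \<odot>\<^bsub>P\<^esub> b)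
      \<and> restrict f B \<in> B \<rightarrow>\<^sub>E carrier R \<and> finite {b \<in> B. restrict f B b \<noteq> \<zero>\<^bsub>R\<^esub>}" if f: "f \<in> carrier ?F" for f
  proof -
    have s: "{b \<in> B. restrict f B b \<noteq> \<zero>\<^bsub>R\<^esub>} = {b. f b \<noteq> \<zero>\<^bsub>R\<^esub>}" using f by (auto simp: free_fun_module_def)
    have "\<Phi> f = (\<Oplus>\<^bsub>P\<^esub>b \<in> {b. f b \<noteq> \<zero>\<^bsub>R\<^esub>}. f b \<odot>\<^bsub>P\<^esub> b)"
      using f by (simp add: \<Phi>_def lin_ext_def[OF P idB])
    also have "\<dots> = (\<Oplus>\<^bsub>P\<^esub>b \<in> {b. f b \<noteq> \<zero>\<^bsub>R\<^esub>}. restrict f B b \<odot>\<^bsub>P\<^esub> b)"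
    proof (rule P.M.finsum_cong')
      fix b assume "b \<in> {b. f b \<noteq> \<zero>\<^bsub>R\<^esub>}"
      hence "b \<in> B" using f by (auto simp: free_fun_module_def)
      thus "f b \<odot>\<^bsub>P\<^esub> b = restrict f B b \<odot>\<^bsub>P\<^esub> b" by simp
    qed (use f BP in \<open>auto simp: free_fun_module_def intro!: P.smult_closed\<close>)
    finally show ?thesis using f unfolding s by (auto simp: free_fun_module_def)
  qed
  have inj: "inj_on \<Phi> (carrier ?F)"
  proof (rule inj_onI)
    fix f f' assume h: "f \<in> carrier ?F" "f' \<in> carrier ?F" "\<Phi> f = \<Phi> f'"
    have "\<Phi> f \<in> carrier P" using left_module_homD(1)[OF \<Phi> h(1)] .
    hence ex1: "\<exists>!c. c \<in> B \<rightarrow>\<^sub>E carrier R \<and> finite {b \<in> B. c b \<noteq> \<zero>\<^bsub>R\<^esub>} \<and>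
        \<Phi> f = (\<Oplus>\<^bsub>P\<^esub>b \<in> {b \<in> B. c b \<noteq> \<zero>\<^bsub>R\<^esub>}. c b \<odot>\<^bsub>P\<^esub> b)" (is "\<exists>!c. ?Q c")
      using B unfolding free_on_def by (elim conjE) (erule bspec)
    have "?Q (restrict f B)" using \<Phi>c[OF h(1)] by (elim conjE, intro conjI)
    moreover have "?Q (restrict f' B)" unfolding h(3) using \<Phi>c[OF h(2)] by (elim conjE, intro conjI)
    ultimately have "restrict f B = restrict f' B"
      by (rule trans[OF the1_equality[OF ex1, symmetric] the1_equality[OF ex1]])
    hence eq: "f b = f' b" if "b \<in> B" for b using that by (metis restrict_apply')
    have "b \<notin> B \<Longrightarrow> f b = \<zero>\<^bsub>R\<^esub>" "b \<notin> B \<Longrightarrow> f' b = \<zero>\<^bsub>R\<^esub>" for b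
      using h(1,2) unfolding free_fun_module_def by (simp, blast)+
    with eq show "f = f'" by (intro ext) metis
  qed
  have surj: "\<exists>f\<in>carrier ?F. \<Phi> f = x" if x: "x \<in> carrier P" for x
  proof -
    obtain c where c: "c \<in> B \<rightarrow>\<^sub>E carrier R" "finite {b \<in> B. c b \<noteq> \<zero>\<^bsub>R\<^esub>}"
      "x = (\<Oplus>\<^bsub>P\<^esub>b \<in> {b \<in> B. c b \<noteq> \<zero>\<^bsub>R\<^esub>}. c b \<odot>\<^bsub>P\<^esub> b)"
      using B x unfolding free_on_def by blast
    let ?f = "\<lambda>b. if b \<in> B then c b else \<zero>\<^bsub>R\<^esub>"
    have s: "{b. ?f b \<noteq> \<zero>\<^bsub>R\<^esub>} = {b \<in> B. c b \<noteq> \<zero>\<^bsub>R\<^esub>}" by auto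
    have f: "?f \<in> carrier ?F" using c s by (auto simp: free_fun_module_def)
    moreover have "restrict ?f B = c" using c(1) by (auto simp: fun_eq_iff PiE_iff extensional_def)
    ultimately show ?thesis using \<Phi>c[OF f] c(3) by (intro bexI[of _ ?f]) auto
  qed
  define \<Psi> where "\<Psi> = inv_into (carrier ?F) \<Phi>"
  have \<Psi>1: "\<Psi> x \<in> carrier ?F" "\<Phi> (\<Psi> x) = x" if "x \<in> carrier P" for x
    using surj[OF that] unfolding \<Psi>_def by (metis image_eqI inv_into_into, metis f_inv_into_f image_eqI)
  have \<Psi>2: "\<Psi> (\<Phi> f) = f" if "f \<in> carrier ?F" for f
    using inj that unfolding \<Psi>_def by simp
  have \<Psi>add: "\<Psi> (x \<oplus>\<^bsub>P\<^esub> y) = \<Psi> x \<oplus>\<^bsub>?F\<^esub> \<Psi> y" if "x \<in> carrier P" "y \<in> carrier P" for x y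
    using \<Psi>2[of "\<Psi> x \<oplus>\<^bsub>?F\<^esub> \<Psi> y"] \<Psi>1[OF that(1)] \<Psi>1[OF that(2)] left_module_homD(2)[OF \<Phi>] by simp
  have \<Psi>smult: "\<Psi> (a \<odot>\<^bsub>P\<^esub> x) = a \<odot>\<^bsub>?F\<^esub> \<Psi> x" if "x \<in> carrier P" "a \<in> carrier R" for a x
    using \<Psi>2[of "a \<odot>\<^bsub>?F\<^esub> \<Psi> x"] \<Psi>1[OF that(1)] that left_module_homD(3)[OF \<Phi>] by simp
  define h where "h = restrict (\<lambda>x. lin_ext R M g (\<Psi> x)) (carrier P)"
  have "h \<in> left_module_hom R P M"
    unfolding h_def
    by (rule left_module_homI[OF _ _ _ P])
       (simp_all add: \<Psi>1 \<Psi>add \<Psi>smult lin_ext_closed[OF M gB] lin_ext_add[OF M gB] lin_ext_smult[OF M gB])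
  moreover have "h b = g b" if b: "b \<in> B" for b
  proof -
    have u: "unit_vector R b \<in> carrier ?F" by (rule unit_vector_carrier[OF P.R.ring_axioms b])
    hence "\<Phi> (unit_vector R b) = b" using lin_ext_unit_vector[OF P idB b] by (simp add: \<Phi>_def)
    hence "\<Psi> b = unit_vector R b" using \<Psi>2[OF u] by simp
    thus ?thesis using b BP lin_ext_unit_vector[OF M gB b] by (auto simp: h_def)
  qed
  ultimately show ?thesis by blast
qed

text \<open>Projectivity in the form suited to resolutions: p only has to reach the values of f.
  Preimages are chosen on a basis, and p after h equals f because both agree there.\<close>

lemma free_lift:
  assumes P: "free_left_module R P" and A: "left_module R A" and C: "left_module R C"
    and f: "f \<in> left_module_hom R P C" and p: "p \<in> left_module_hom R A C"
    and sub: "\<And>x. x \<in> carrier P \<Longrightarrow> f x \<in> p ` carrier A"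
  shows "\<exists>h\<in>left_module_hom R P A. \<forall>x\<in>carrier P. p (h x) = f x"
proof -
  from P obtain B where P': "left_module R P" and B: "free_on R P B" by (auto simp: free_left_module_iff)
  have BP: "B \<subseteq> carrier P" using B by (simp add: free_on_def)
  have "\<forall>b\<in>B. \<exists>a. a \<in> carrier A \<and> p a = f b" using sub BP by force
  then obtain g where g: "\<And>b. b \<in> B \<Longrightarrow> g b \<in> carrier A" "\<And>b. b \<in> B \<Longrightarrow> p (g b) = f b"
    by metis
  obtain h where h: "h \<in> left_module_hom R P A" "\<And>b. b \<in> B \<Longrightarrow> h b = g b"
    using free_on_hom_exists[OF P' A B, of g] g(1) by blast
  have "compose (carrier P) p h = f"
    by (rule free_on_hom_unique[OF P' C B left_module_hom_compose[OF P' h(1) p] f])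
       (use g h BP in \<open>auto simp: compose_def\<close>)
  hence "\<forall>x\<in>carrier P. p (h x) = f x" by (auto simp: compose_def)
  thus ?thesis using h by blast
qed

section \<open>Comparison of two free resolutions\<close>

context
  fixes R :: "('r, 'z) ring_scheme" and M :: "('r, 'm) module"
    and P :: "nat \<Rightarrow> ('r, 'p) module" and d e
  assumes M: "left_module R M" and res: "free_resolution R M P d e"
begin

lemma resolution_module: "left_module R (P n)"
  using res by (auto simp: free_resolution_def free_left_module_def)

lemma resolution_hom: "e \<in> left_module_hom R (P 0) M" "d n \<in> left_module_hom R (P (Suc n)) (P n)"
  using res by (auto simp: free_resolution_def)

lemma resolution_exact:
  "d 0 ` carrier (P (Suc 0)) = {x \<in> carrier (P 0). e x = \<zero>\<^bsub>M\<^esub>}"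
  "d (Suc n) ` carrier (P (Suc (Suc n))) = {x \<in> carrier (P (Suc n)). d n x = \<zero>\<^bsub>P n\<^esub>}"
  using res by (auto simp: free_resolution_def)

lemma resolution_dd: "x \<in> carrier (P (Suc (Suc n))) \<Longrightarrow> d n (d (Suc n) x) = \<zero>\<^bsub>P n\<^esub>"
  using resolution_exact(2)[of n] by blast

lemma resolution_ed: "x \<in> carrier (P (Suc 0)) \<Longrightarrow> e (d 0 x) = \<zero>\<^bsub>M\<^esub>"
  using resolution_exact(1) by blast

lemma resolution_free: "free_left_module R (P n)"
  using res by (auto simp: free_resolution_def)

text \<open>Of the homotopy 1 - f = d s + s d only what a cocycle can see is recorded: s itself in
  degree n, and the term d s merely as membership in the image of the next differential.\<close>

lemma chain_endomorphism_homotopic_id: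
  assumes f: "\<And>n. f n \<in> left_module_hom R (P n) (P n)"
    and f0: "\<And>x. x \<in> carrier (P 0) \<Longrightarrow> e (f 0 x) = e x"
    and fS: "\<And>n x. x \<in> carrier (P (Suc n)) \<Longrightarrow> d n (f (Suc n) x) = f n (d n x)"
  shows "\<exists>s\<in>left_module_hom R (P n) (P (Suc n)). \<forall>x\<in>carrier (P (Suc n)).
     x \<ominus>\<^bsub>P (Suc n)\<^esub> f (Suc n) x \<ominus>\<^bsub>P (Suc n)\<^esub> s (d n x) \<in> d (Suc n) ` carrier (P (Suc (Suc n)))"
proof -
  interpret P: left_module R "P m" for m by (rule resolution_module)
  interpret M: left_module R M by (rule M)
  note fD = left_module_homD[OF f] and dD = left_module_homD[OF resolution_hom(2)]
    and eD = left_module_homD[OF resolution_hom(1)]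
  note dm = left_module_hom_minus[OF resolution_module resolution_module resolution_hom(2)]
  \<comment> \<open>This is the homotopy identity composed with d, where the summand s d drops out
    because d d = 0. In this form the start of the induction looks like every other step.\<close>
  have key: "\<exists>s\<in>left_module_hom R (P n) (P (Suc n)). \<forall>x\<in>carrier (P (Suc n)).
      d n (s (d n x)) = d n x \<ominus>\<^bsub>P n\<^esub> f n (d n x)" for n
  proof (induction n)
    case 0
    let ?h = "restrict (\<lambda>x. x \<ominus>\<^bsub>P 0\<^esub> f 0 x) (carrier (P 0))"
    have "?h \<in> left_module_hom R (P 0) (P 0)"
    proof (rule left_module_homI[OF _ _ _ resolution_module])
      fix x y assume h: "x \<in> carrier (P 0)" "y \<in> carrier (P 0)"
      thus "x \<oplus>\<^bsub>P 0\<^esub> y \<ominus>\<^bsub>P 0\<^esub> f 0 (x \<oplus>\<^bsub>P 0\<^esub> y) = (x \<ominus>\<^bsub>P 0\<^esub> f 0 x) \<oplus>\<^bsub>P 0\<^esub> (y \<ominus>\<^bsub>P 0\<^esub> f 0 y)"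
        using fD(1)[of x 0] fD(1)[of y 0] by (simp add: fD(2) a_minus_def P.M.minus_add P.M.a_ac)
    next
      fix a x assume h: "a \<in> carrier R" "x \<in> carrier (P 0)"
      have "a \<odot>\<^bsub>P 0\<^esub> (\<ominus>\<^bsub>P 0\<^esub> f 0 x) = \<ominus>\<^bsub>P 0\<^esub> (a \<odot>\<^bsub>P 0\<^esub> f 0 x)"
        using h fD(1)[of x 0]
        by (metis P.M.a_inv_closed P.M.minus_equality P.M.l_neg P.smult_closed P.smult_null_r P.smult_r_distr)
      thus "a \<odot>\<^bsub>P 0\<^esub> x \<ominus>\<^bsub>P 0\<^esub> f 0 (a \<odot>\<^bsub>P 0\<^esub> x) = a \<odot>\<^bsub>P 0\<^esub> (x \<ominus>\<^bsub>P 0\<^esub> f 0 x)"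
        using h fD(1)[of x 0] by (simp add: fD(3) a_minus_def P.smult_r_distr)
    qed (simp add: fD P.M.minus_closed)
    moreover have "?h x \<in> d 0 ` carrier (P (Suc 0))" if "x \<in> carrier (P 0)" for x
      unfolding resolution_exact(1) using that fD(1)[of x 0] eD(1)[of x]
      by (simp add: left_module_hom_minus[OF resolution_module M resolution_hom(1)] f0 P.M.minus_closed)
         (simp add: M.M.r_neg a_minus_def)
    ultimately obtain s where "s\<in>left_module_hom R (P 0) (P (Suc 0))" "\<forall>x\<in>carrier (P 0). d 0 (s x) = ?h x"
      using free_lift[OF resolution_free resolution_module resolution_module _ resolution_hom(2), of ?h 0 0] by auto
    thus ?case using dD(1) by (intro bexI[of _ s]) auto
  next
    case (Suc n)
    then obtain s where s: "s\<in>left_module_hom R (P n) (P (Suc n))"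
      "\<And>x. x \<in> carrier (P (Suc n)) \<Longrightarrow> d n (s (d n x)) = d n x \<ominus>\<^bsub>P n\<^esub> f n (d n x)" by blast
    note sD = left_module_homD[OF s(1)]
    let ?h = "restrict (\<lambda>x. x \<ominus>\<^bsub>P (Suc n)\<^esub> (f (Suc n) x \<oplus>\<^bsub>P (Suc n)\<^esub> s (d n x))) (carrier (P (Suc n)))"
    have "?h \<in> left_module_hom R (P (Suc n)) (P (Suc n))"
    proof (rule left_module_homI[OF _ _ _ resolution_module])
      fix x y assume h: "x \<in> carrier (P (Suc n))" "y \<in> carrier (P (Suc n))"
      thus "x \<oplus>\<^bsub>P (Suc n)\<^esub> y \<ominus>\<^bsub>P (Suc n)\<^esub> (f (Suc n) (x \<oplus>\<^bsub>P (Suc n)\<^esub> y) \<oplus>\<^bsub>P (Suc n)\<^esub> s (d n (x \<oplus>\<^bsub>P (Suc n)\<^esub> y))) =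
         (x \<ominus>\<^bsub>P (Suc n)\<^esub> (f (Suc n) x \<oplus>\<^bsub>P (Suc n)\<^esub> s (d n x))) \<oplus>\<^bsub>P (Suc n)\<^esub> (y \<ominus>\<^bsub>P (Suc n)\<^esub> (f (Suc n) y \<oplus>\<^bsub>P (Suc n)\<^esub> s (d n y)))"
        by (simp add: fD dD sD a_minus_def P.M.minus_add P.M.a_ac)
    next
      fix a x assume h: "a \<in> carrier R" "x \<in> carrier (P (Suc n))"
      have ng: "a \<odot>\<^bsub>P (Suc n)\<^esub> (\<ominus>\<^bsub>P (Suc n)\<^esub> z) = \<ominus>\<^bsub>P (Suc n)\<^esub> (a \<odot>\<^bsub>P (Suc n)\<^esub> z)" if "z \<in> carrier (P (Suc n))" for z
        using h that
        by (metis P.M.a_inv_closed P.M.minus_equality P.M.l_neg P.smult_closed P.smult_null_r P.smult_r_distr)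
      show "a \<odot>\<^bsub>P (Suc n)\<^esub> x \<ominus>\<^bsub>P (Suc n)\<^esub> (f (Suc n) (a \<odot>\<^bsub>P (Suc n)\<^esub> x) \<oplus>\<^bsub>P (Suc n)\<^esub> s (d n (a \<odot>\<^bsub>P (Suc n)\<^esub> x))) =
         a \<odot>\<^bsub>P (Suc n)\<^esub> (x \<ominus>\<^bsub>P (Suc n)\<^esub> (f (Suc n) x \<oplus>\<^bsub>P (Suc n)\<^esub> s (d n x)))"
        using h by (simp add: fD dD sD a_minus_def P.smult_r_distr ng)
    qed (simp add: fD dD sD P.M.minus_closed)
    moreover have "?h x \<in> d (Suc n) ` carrier (P (Suc (Suc n)))" if x: "x \<in> carrier (P (Suc n))" for x
    proof -
      \<comment> \<open>By the induction hypothesis d n kills \<open>?h x\<close>, so exactness lets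
        \<open>?h\<close> be lifted through \<open>d (Suc n)\<close>.\<close>
      have c: "d n x \<in> carrier (P n)" "f n (d n x) \<in> carrier (P n)" using x by (simp_all add: dD fD)
      have "d n (?h x) = d n x \<ominus>\<^bsub>P n\<^esub> (f n (d n x) \<oplus>\<^bsub>P n\<^esub> (d n x \<ominus>\<^bsub>P n\<^esub> f n (d n x)))"
        using x by (simp add: dm fD dD sD s(2) fS)
      also have "\<dots> = d n x \<ominus>\<^bsub>P n\<^esub> d n x"
        using c by (metis P.M.a_comm P.M.a_assoc P.M.minus_closed P.M.a_inv_closed P.M.l_neg P.M.r_zero a_minus_def)
      also have "\<dots> = \<zero>\<^bsub>P n\<^esub>" using c by (simp add: a_minus_def P.M.r_neg)
      finally show ?thesis unfolding resolution_exact(2) using x by (simp add: fD dD sD P.M.minus_closed)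
    qed
    ultimately obtain s' where s': "s'\<in>left_module_hom R (P (Suc n)) (P (Suc (Suc n)))" "\<forall>x\<in>carrier (P (Suc n)). d (Suc n) (s' x) = ?h x"
      using free_lift[OF resolution_free resolution_module resolution_module _ resolution_hom(2), of ?h "Suc n" "Suc n"] by auto
    have "d (Suc n) (s' (d (Suc n) x)) = d (Suc n) x \<ominus>\<^bsub>P (Suc n)\<^esub> f (Suc n) (d (Suc n) x)"
      if x: "x \<in> carrier (P (Suc (Suc n)))" for x
      using x s' dD(1)[of x "Suc n"] left_module_hom_zero[OF resolution_module resolution_module s(1)]
      by (simp add: resolution_dd fD)
    thus ?case using s' by blast
  qed
  obtain s where s: "s\<in>left_module_hom R (P n) (P (Suc n))"
      "\<And>x. x \<in> carrier (P (Suc n)) \<Longrightarrow> d n (s (d n x)) = d n x \<ominus>\<^bsub>P n\<^esub> f n (d n x)" using key by blast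
  note sD = left_module_homD[OF s(1)]
  have "x \<ominus>\<^bsub>P (Suc n)\<^esub> f (Suc n) x \<ominus>\<^bsub>P (Suc n)\<^esub> s (d n x) \<in> d (Suc n) ` carrier (P (Suc (Suc n)))"
    if x: "x \<in> carrier (P (Suc n))" for x
  proof -
    have c: "d n x \<in> carrier (P n)" "f n (d n x) \<in> carrier (P n)" using x by (simp_all add: dD fD)
    have "d n (x \<ominus>\<^bsub>P (Suc n)\<^esub> f (Suc n) x \<ominus>\<^bsub>P (Suc n)\<^esub> s (d n x)) =
        (d n x \<ominus>\<^bsub>P n\<^esub> f n (d n x)) \<ominus>\<^bsub>P n\<^esub> (d n x \<ominus>\<^bsub>P n\<^esub> f n (d n x))"
      using x by (simp add: dm fD dD sD s(2) fS P.M.minus_closed)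
    also have "\<dots> = \<zero>\<^bsub>P n\<^esub>"
      using c by (metis P.M.minus_closed P.M.r_neg a_minus_def)
    finally have "d n (x \<ominus>\<^bsub>P (Suc n)\<^esub> f (Suc n) x \<ominus>\<^bsub>P (Suc n)\<^esub> s (d n x)) = \<zero>\<^bsub>P n\<^esub>" .
    thus ?thesis unfolding resolution_exact(2) using x by (simp add: fD dD sD P.M.minus_closed)
  qed
  hence "\<forall>x\<in>carrier (P (Suc n)). x \<ominus>\<^bsub>P (Suc n)\<^esub> f (Suc n) x \<ominus>\<^bsub>P (Suc n)\<^esub> s (d n x) \<in> d (Suc n) ` carrier (P (Suc (Suc n)))"
    by (rule ballI)
  thus ?thesis using s(1) by (intro bexI[of _ s])
qed

end

text \<open>The components are built by dependent choice. The invariant carries along that f n after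
  d n lands in the image of d' n, which is what \<open>free_lift\<close> requires for the next
  component.\<close>

lemma chain_map_exists:
  fixes P :: "nat \<Rightarrow> ('r, 'p) module" and Q :: "nat \<Rightarrow> ('r, 'q) module"
  assumes M: "left_module R M" and P: "free_resolution R M P d e" and Q: "free_resolution R M Q d' e'"
  shows "\<exists>f. (\<forall>n. f n \<in> left_module_hom R (P n) (Q n)) \<and> (\<forall>x\<in>carrier (P 0). e' (f 0 x) = e x) \<and>
    (\<forall>n. \<forall>x\<in>carrier (P (Suc n)). d' n (f (Suc n) x) = f n (d n x))"
proof -
  note Pm = resolution_module[OF M P] and Qm = resolution_module[OF M Q]
  note eh = resolution_hom(1)[OF M P] and dh = resolution_hom(2)[OF M P]
  note eh' = resolution_hom(1)[OF M Q] and dh' = resolution_hom(2)[OF M Q]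
  note eD = left_module_homD[OF eh] and dD = left_module_homD[OF dh]
  note eD' = left_module_homD[OF eh'] and dD' = left_module_homD[OF dh']
  have "\<exists>f. \<forall>n. (f n \<in> left_module_hom R (P n) (Q n) \<and> (n = 0 \<longrightarrow> (\<forall>x\<in>carrier (P 0). e' (f n x) = e x)) \<and>
      (\<forall>x\<in>carrier (P (Suc n)). f n (d n x) \<in> d' n ` carrier (Q (Suc n)))) \<and>
      (\<forall>x\<in>carrier (P (Suc n)). d' n (f (Suc n) x) = f n (d n x))"
  proof (rule dependent_nat_choice)
    have "e ` carrier (P 0) = carrier M" "e' ` carrier (Q 0) = carrier M"
      using P Q by (auto simp: free_resolution_def)
    then obtain f where f: "f \<in> left_module_hom R (P 0) (Q 0)" "\<forall>x\<in>carrier (P 0). e' (f x) = e x"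
      using free_lift[OF resolution_free[OF M P] Qm M eh eh'] by auto
    note fD = left_module_homD[OF f(1)]
    have "f (d 0 x) \<in> d' 0 ` carrier (Q (Suc 0))" if "x \<in> carrier (P (Suc 0))" for x
      unfolding resolution_exact(1)[OF M Q] using that f(2) by (simp add: fD dD resolution_ed[OF M P])
    thus "\<exists>f. f \<in> left_module_hom R (P 0) (Q 0) \<and> ((0::nat) = 0 \<longrightarrow> (\<forall>x\<in>carrier (P 0). e' (f x) = e x)) \<and>
      (\<forall>x\<in>carrier (P (Suc 0)). f (d 0 x) \<in> d' 0 ` carrier (Q (Suc 0)))" using f by auto
  next
    fix f n
    assume h: "f \<in> left_module_hom R (P n) (Q n) \<and> (n = 0 \<longrightarrow> (\<forall>x\<in>carrier (P 0). e' (f x) = e x)) \<and>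
      (\<forall>x\<in>carrier (P (Suc n)). f (d n x) \<in> d' n ` carrier (Q (Suc n)))"
    have c: "compose (carrier (P (Suc n))) f (d n) \<in> left_module_hom R (P (Suc n)) (Q n)"
      using h by (intro left_module_hom_compose[OF Pm dh]) blast
    have "\<And>x. x \<in> carrier (P (Suc n)) \<Longrightarrow> compose (carrier (P (Suc n))) f (d n) x \<in> d' n ` carrier (Q (Suc n))"
      using h by (auto simp: compose_def)
    then obtain g where g: "g \<in> left_module_hom R (P (Suc n)) (Q (Suc n))"
        "\<forall>x\<in>carrier (P (Suc n)). d' n (g x) = compose (carrier (P (Suc n))) f (d n) x"
      using free_lift[OF resolution_free[OF M P] Qm Qm c dh'] by blast
    note gD = left_module_homD[OF g(1)]
    have g2: "\<forall>x\<in>carrier (P (Suc n)). d' n (g x) = f (d n x)"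
      using g(2) by (simp add: compose_def)
    have "g (d (Suc n) x) \<in> d' (Suc n) ` carrier (Q (Suc (Suc n)))" if x: "x \<in> carrier (P (Suc (Suc n)))" for x
      unfolding resolution_exact(2)[OF M Q] using x g2 h
      by (simp add: gD dD resolution_dd[OF M P] left_module_hom_zero[OF Pm Qm])
    thus "\<exists>g. (g \<in> left_module_hom R (P (Suc n)) (Q (Suc n)) \<and> (Suc n = 0 \<longrightarrow> (\<forall>x\<in>carrier (P 0). e' (g x) = e x)) \<and>
      (\<forall>x\<in>carrier (P (Suc (Suc n))). g (d (Suc n) x) \<in> d' (Suc n) ` carrier (Q (Suc (Suc n))))) \<and>
      (\<forall>x\<in>carrier (P (Suc n)). d' n (g x) = f (d n x))"
      using g g2 by auto
  qed
  then obtain f where "\<forall>n. (f n \<in> left_module_hom R (P n) (Q n) \<and> (n = 0 \<longrightarrow> (\<forall>x\<in>carrier (P 0). e' (f n x) = e x)) \<and>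
      (\<forall>x\<in>carrier (P (Suc n)). f n (d n x) \<in> d' n ` carrier (Q (Suc n)))) \<and>
      (\<forall>x\<in>carrier (P (Suc n)). d' n (f (Suc n) x) = f n (d n x))" ..
  thus ?thesis by (intro exI[of _ f]) simp
qed

section \<open>Triviality of cohomology groups and of Ext\<close>

lemma cocyclesI:
  assumes "f \<in> left_module_hom R (P n) N" "\<And>x. x \<in> carrier (P (Suc n)) \<Longrightarrow> f (d n x) = \<zero>\<^bsub>N\<^esub>"
  shows "f \<in> cocycles R P d N n"
  using assms by (auto simp: cocycles_def cochain_group_def compose_def fun_eq_iff)

lemma cocyclesD:
  assumes "f \<in> cocycles R P d N n"
  shows "f \<in> left_module_hom R (P n) N" "x \<in> carrier (P (Suc n)) \<Longrightarrow> f (d n x) = \<zero>\<^bsub>N\<^esub>"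
  using assms unfolding cocycles_def cochain_group_def compose_def
  by (auto simp: fun_eq_iff split: if_splits)

lemma coboundariesI:
  assumes "f \<in> left_module_hom R (P (Suc n)) N" "g \<in> left_module_hom R (P n) N"
    and "\<And>x. x \<in> carrier (P (Suc n)) \<Longrightarrow> f x = g (d n x)"
  shows "f \<in> coboundaries R P d N (Suc n)"
proof -
  have "f = compose (carrier (P (Suc n))) g (d n)"
    using assms(3) left_module_homD(4)[OF assms(1)] by (auto simp: compose_def fun_eq_iff)
  thus ?thesis using assms(2) by auto
qed

lemma coboundariesD:
  assumes "f \<in> coboundaries R P d N (Suc n)"
  shows "\<exists>g\<in>left_module_hom R (P n) N. \<forall>x\<in>carrier (P (Suc n)). f x = g (d n x)"
  using assms by (auto simp: compose_def)

text \<open>Take chain maps f from P to Q and g from Q to P over the identity of M. A cocycle z of P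
  pulls back along g to a cocycle of Q, which is some h d'. As z kills boundaries, the homotopy for
  g f gives z = z g f + z s d = (h f + z s) d.\<close>

lemma cohomology_vanishing_transfer:
  fixes R :: "('r, 'z) ring_scheme" and M :: "('r, 'm) module" and N :: "('r, 'n) module"
    and P :: "nat \<Rightarrow> ('r, 'p) module" and Q :: "nat \<Rightarrow> ('r, 'q) module"
  assumes M: "left_module R M" and N: "left_module R N"
    and P: "free_resolution R M P d e" and Q: "free_resolution R M Q d' e'"
    and van: "cocycles R Q d' N (Suc n) \<subseteq> coboundaries R Q d' N (Suc n)"
  shows "cocycles R P d N (Suc n) \<subseteq> coboundaries R P d N (Suc n)"
proof
  fix z assume z: "z \<in> cocycles R P d N (Suc n)"
  interpret N: left_module R N by (rule N)
  note Pm = resolution_module[OF M P] and Qm = resolution_module[OF M Q]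
  interpret P: left_module R "P m" for m by (rule Pm)
  note dh = resolution_hom(2)[OF M P] and dh' = resolution_hom(2)[OF M Q]
  note dD = left_module_homD[OF dh] and dD' = left_module_homD[OF dh']
  obtain f where f: "\<And>n. f n \<in> left_module_hom R (P n) (Q n)" "\<And>x. x\<in>carrier (P 0) \<Longrightarrow> e' (f 0 x) = e x"
      "\<And>n x. x\<in>carrier (P (Suc n)) \<Longrightarrow> d' n (f (Suc n) x) = f n (d n x)"
    using chain_map_exists[OF M P Q] by blast
  obtain g where g: "\<And>n. g n \<in> left_module_hom R (Q n) (P n)" "\<And>x. x\<in>carrier (Q 0) \<Longrightarrow> e (g 0 x) = e' x"
      "\<And>n x. x\<in>carrier (Q (Suc n)) \<Longrightarrow> d n (g (Suc n) x) = g n (d' n x)"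
    using chain_map_exists[OF M Q P] by blast
  note fD = left_module_homD[OF f(1)] and gD = left_module_homD[OF g(1)]
  note zD = left_module_homD[OF cocyclesD(1)[OF z]]
  define \<phi> where "\<phi> n = compose (carrier (P n)) (g n) (f n)" for n
  have \<phi>: "\<phi> n \<in> left_module_hom R (P n) (P n)" for n
    unfolding \<phi>_def by (rule left_module_hom_compose[OF Pm f(1) g(1)])
  have \<phi>a: "\<phi> n x = g n (f n x)" if "x \<in> carrier (P n)" for n x using that by (simp add: \<phi>_def compose_def)
  obtain s where s: "s\<in>left_module_hom R (P n) (P (Suc n))"
     "\<And>x. x\<in>carrier (P (Suc n)) \<Longrightarrow> x \<ominus>\<^bsub>P (Suc n)\<^esub> \<phi> (Suc n) x \<ominus>\<^bsub>P (Suc n)\<^esub> s (d n x) \<in> d (Suc n) ` carrier (P (Suc (Suc n)))"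
    using chain_endomorphism_homotopic_id[OF M P \<phi>, of n] by (auto simp: \<phi>a f g fD dD)
  note sD = left_module_homD[OF s(1)]
  have "compose (carrier (Q (Suc n))) z (g (Suc n)) \<in> cocycles R Q d' N (Suc n)"
  proof (rule cocyclesI)
    show "compose (carrier (Q (Suc n))) z (g (Suc n)) \<in> left_module_hom R (Q (Suc n)) N"
      by (rule left_module_hom_compose[OF Qm g(1) cocyclesD(1)[OF z]])
  qed (simp add: compose_def dD' g(3)[symmetric] cocyclesD(2)[OF z] gD)
  with van have "compose (carrier (Q (Suc n))) z (g (Suc n)) \<in> coboundaries R Q d' N (Suc n)" by blast
  from coboundariesD[OF this] obtain h where h: "h \<in> left_module_hom R (Q n) N"
    "\<And>x. x \<in> carrier (Q (Suc n)) \<Longrightarrow> z (g (Suc n) x) = h (d' n x)" by (auto simp: compose_def)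
  note hD = left_module_homD[OF h(1)]
  let ?k = "restrict (\<lambda>x. h (f n x) \<oplus>\<^bsub>N\<^esub> z (s x)) (carrier (P n))"
  show "z \<in> coboundaries R P d N (Suc n)"
  proof (rule coboundariesI)
    show "z \<in> left_module_hom R (P (Suc n)) N" by (rule cocyclesD(1)[OF z])
    show "?k \<in> left_module_hom R (P n) N"
      by (rule left_module_homI[OF _ _ _ Pm]) (simp_all add: hD fD zD sD N.M.a_ac N.smult_r_distr)
    fix x assume x: "x \<in> carrier (P (Suc n))"
    note zm = left_module_hom_minus[OF Pm N cocyclesD(1)[OF z]]
    have "z (x \<ominus>\<^bsub>P (Suc n)\<^esub> \<phi> (Suc n) x \<ominus>\<^bsub>P (Suc n)\<^esub> s (d n x)) = \<zero>\<^bsub>N\<^esub>"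
      using s(2)[OF x] cocyclesD(2)[OF z] by auto
    hence 0: "z x \<ominus>\<^bsub>N\<^esub> h (f n (d n x)) \<ominus>\<^bsub>N\<^esub> z (s (d n x)) = \<zero>\<^bsub>N\<^esub>"
      using x by (simp add: zm \<phi>a fD gD sD dD P.M.minus_closed h(2) f(3))
    have c: "z x \<in> carrier N" "h (f n (d n x)) \<in> carrier N" "z (s (d n x)) \<in> carrier N"
      using x by (simp_all add: hD fD zD sD dD)
    have "z x \<ominus>\<^bsub>N\<^esub> (h (f n (d n x)) \<oplus>\<^bsub>N\<^esub> z (s (d n x))) = \<zero>\<^bsub>N\<^esub>"
      using 0 c by (simp add: a_minus_def N.M.minus_add N.M.a_assoc)
    moreover have "u \<ominus>\<^bsub>N\<^esub> v \<oplus>\<^bsub>N\<^esub> v = u" if "u \<in> carrier N" "v \<in> carrier N" for u v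
      using that by (simp add: a_minus_def N.M.a_assoc N.M.l_neg)
    ultimately have "z x = h (f n (d n x)) \<oplus>\<^bsub>N\<^esub> z (s (d n x))"
      using c by (metis N.M.a_closed N.M.l_zero)
    thus "z x = ?k (d n x)" using x by (simp add: dD)
  qed
qed

text \<open>The zero cocycle is a coboundary, so the coset of a cocycle a contains a; if all cosets
  coincide, a is a coboundary. Conversely, coboundaries are stable under adding and subtracting one
  of their members.\<close>

lemma Hom_cohomology_trivial_iff:
  fixes R :: "('r, 'z) ring_scheme" and N :: "('r, 'n) module" and P :: "nat \<Rightarrow> ('r, 'p) module"
  assumes P: "\<And>n. left_module R (P n)" and N: "left_module R N"
    and d: "\<And>n. d n \<in> left_module_hom R (P (Suc n)) (P n)"
    and dd: "\<And>n x. x \<in> carrier (P (Suc (Suc n))) \<Longrightarrow> d n (d (Suc n) x) = \<zero>\<^bsub>P n\<^esub>"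
  shows "carrier (Hom_cohomology R P d N (Suc n)) = {\<one>\<^bsub>Hom_cohomology R P d N (Suc n)\<^esub>} \<longleftrightarrow>
    cocycles R P d N (Suc n) \<subseteq> coboundaries R P d N (Suc n)"
proof -
  interpret N: left_module R N by (rule N)
  interpret P: left_module R "P m" for m by (rule P)
  let ?G = "cochain_group R (P (Suc n)) N" and ?Z = "cocycles R P d N (Suc n)" and ?B = "coboundaries R P d N (Suc n)"
  note dD = left_module_homD[OF d]
  have car: "carrier (Hom_cohomology R P d N (Suc n)) = (\<lambda>a. ?B #>\<^bsub>?G\<lparr>carrier := ?Z\<rparr>\<^esub> a) ` ?Z"
    by (auto simp: Hom_cohomology_def FactGroup_def RCOSETS_def)
  have one: "\<one>\<^bsub>Hom_cohomology R P d N (Suc n)\<^esub> = ?B" by (simp add: Hom_cohomology_def FactGroup_def)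
  have cos: "?B #>\<^bsub>?G\<lparr>carrier := ?Z\<rparr>\<^esub> a = (\<lambda>b. \<lambda>x\<in>carrier (P (Suc n)). b x \<oplus>\<^bsub>N\<^esub> a x) ` ?B" for a
    by (auto simp: r_coset_def cochain_group_def)
  have zh: "restrict (\<lambda>x. \<zero>\<^bsub>N\<^esub>) (carrier (P m)) \<in> left_module_hom R (P m) N" for m
    by (rule left_module_homI[OF _ _ _ P]) (simp_all add: N.smult_null_r)
  have z0: "restrict (\<lambda>x. \<zero>\<^bsub>N\<^esub>) (carrier (P (Suc n))) \<in> ?Z"
    by (rule cocyclesI) (simp_all add: zh dD)
  have b0: "restrict (\<lambda>x. \<zero>\<^bsub>N\<^esub>) (carrier (P (Suc n))) \<in> ?B"
    by (rule coboundariesI[where g = "restrict (\<lambda>x. \<zero>\<^bsub>N\<^esub>) (carrier (P n))"]) (simp_all add: dD zh)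
  show ?thesis
  proof (rule iffI)
    assume triv: "carrier (Hom_cohomology R P d N (Suc n)) = {\<one>\<^bsub>Hom_cohomology R P d N (Suc n)\<^esub>}"
    show "?Z \<subseteq> ?B"
    proof (rule subsetI)
      fix a assume a: "a \<in> ?Z"
      note aD = left_module_homD[OF cocyclesD(1)[OF a]]
      have "a = (\<lambda>x\<in>carrier (P (Suc n)). restrict (\<lambda>x. \<zero>\<^bsub>N\<^esub>) (carrier (P (Suc n))) x \<oplus>\<^bsub>N\<^esub> a x)"
        by (auto simp: fun_eq_iff aD)
      hence "a \<in> ?B #>\<^bsub>?G\<lparr>carrier := ?Z\<rparr>\<^esub> a" unfolding cos using b0 by blast
      also have "\<dots> = ?B" using triv a unfolding car one by auto
      finally show "a \<in> ?B" .
    qed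
  next
    assume sub: "?Z \<subseteq> ?B"
    have "?B #>\<^bsub>?G\<lparr>carrier := ?Z\<rparr>\<^esub> a = ?B" if a: "a \<in> ?Z" for a
    proof -
      from a sub have aB: "a \<in> ?B" by blast
      note aD = left_module_homD[OF cocyclesD(1)[OF a]]
      obtain g where g: "g \<in> left_module_hom R (P n) N" "\<And>x. x \<in> carrier (P (Suc n)) \<Longrightarrow> a x = g (d n x)"
        using coboundariesD[OF aB] by blast
      note gD = left_module_homD[OF g(1)]
      have sm: "r \<odot>\<^bsub>N\<^esub> (\<ominus>\<^bsub>N\<^esub> z) = \<ominus>\<^bsub>N\<^esub> (r \<odot>\<^bsub>N\<^esub> z)" if "r \<in> carrier R" "z \<in> carrier N" for r z
        using that by (metis N.M.a_inv_closed N.M.minus_equality N.M.l_neg N.smult_closed N.smult_null_r N.smult_r_distr)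
      have A: "(\<lambda>x\<in>carrier (P (Suc n)). b x \<oplus>\<^bsub>N\<^esub> a x) \<in> ?B"
        and S: "(\<lambda>x\<in>carrier (P (Suc n)). b x \<oplus>\<^bsub>N\<^esub> \<ominus>\<^bsub>N\<^esub> a x) \<in> ?B" 
        and bh: "b \<in> left_module_hom R (P (Suc n)) N" if b: "b \<in> ?B" for b
      proof -
        obtain h where h: "h \<in> left_module_hom R (P n) N" "\<And>x. x \<in> carrier (P (Suc n)) \<Longrightarrow> b x = h (d n x)"
          using coboundariesD[OF b] by blast
        note hD = left_module_homD[OF h(1)]
        show bh: "b \<in> left_module_hom R (P (Suc n)) N"
          using b by (auto intro: left_module_hom_compose[OF P d])
        have p: "(\<lambda>x\<in>carrier (P m). u x \<oplus>\<^bsub>N\<^esub> v x) \<in> left_module_hom R (P m) N"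
          "(\<lambda>x\<in>carrier (P m). u x \<oplus>\<^bsub>N\<^esub> \<ominus>\<^bsub>N\<^esub> v x) \<in> left_module_hom R (P m) N" 
          if "u \<in> left_module_hom R (P m) N" "v \<in> left_module_hom R (P m) N" for u v m
        proof -
          note uD = left_module_homD[OF that(1)] and vD = left_module_homD[OF that(2)]
          show "(\<lambda>x\<in>carrier (P m). u x \<oplus>\<^bsub>N\<^esub> v x) \<in> left_module_hom R (P m) N"
            by (rule left_module_homI[OF _ _ _ P]) (simp_all add: uD vD N.M.a_ac N.smult_r_distr)
          show "(\<lambda>x\<in>carrier (P m). u x \<oplus>\<^bsub>N\<^esub> \<ominus>\<^bsub>N\<^esub> v x) \<in> left_module_hom R (P m) N"
            by (rule left_module_homI[OF _ _ _ P]) (simp_all add: uD vD N.M.a_ac N.smult_r_distr N.M.minus_add sm)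
        qed
        show "(\<lambda>x\<in>carrier (P (Suc n)). b x \<oplus>\<^bsub>N\<^esub> a x) \<in> ?B"
          by (rule coboundariesI, rule p(1)[OF bh cocyclesD(1)[OF a]], rule p(1)[OF h(1) g(1)])
             (simp add: g(2) h(2) dD)
        show "(\<lambda>x\<in>carrier (P (Suc n)). b x \<oplus>\<^bsub>N\<^esub> \<ominus>\<^bsub>N\<^esub> a x) \<in> ?B"
          by (rule coboundariesI, rule p(2)[OF bh cocyclesD(1)[OF a]], rule p(2)[OF h(1) g(1)])
             (simp add: g(2) h(2) dD)
      qed
      have "b \<in> (\<lambda>b. \<lambda>x\<in>carrier (P (Suc n)). b x \<oplus>\<^bsub>N\<^esub> a x) ` ?B" if b: "b \<in> ?B" for b
      proof (rule image_eqI[OF _ S[OF b]])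
        note bD = left_module_homD[OF bh[OF b]]
        show "b = (\<lambda>x\<in>carrier (P (Suc n)). (\<lambda>x\<in>carrier (P (Suc n)). b x \<oplus>\<^bsub>N\<^esub> \<ominus>\<^bsub>N\<^esub> a x) x \<oplus>\<^bsub>N\<^esub> a x)"
          by (auto simp: fun_eq_iff bD aD N.M.a_assoc N.M.l_neg)
      qed
      thus ?thesis unfolding cos using A by blast
    qed
    thus "carrier (Hom_cohomology R P d N (Suc n)) = {\<one>\<^bsub>Hom_cohomology R P d N (Suc n)\<^esub>}"
      unfolding car one using z0 by blast
  qed
qed

text \<open>Any free resolution decides vanishing, even one on a different carrier type: the one
  selected inside \<open>Ext\<close> exists by \<open>free_resolution_exists\<close>, and vanishing
  passes in both directions.\<close>

lemma Ext_trivial_iff: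
  fixes R :: "('r, 'z) ring_scheme" and M :: "('r, 'm) module"
  assumes M: "left_module R M" and N: "left_module R N" and Q: "free_resolution R M Q d' e'"
  shows "carrier (Ext R M N (Suc n)) = {\<one>\<^bsub>Ext R M N (Suc n)\<^esub>} \<longleftrightarrow>
    cocycles R Q d' N (Suc n) \<subseteq> coboundaries R Q d' N (Suc n)"
proof -
  obtain P d e where S: "(SOME (P :: nat \<Rightarrow> ('r, ('r, 'm) resolution_carrier) module, d, e). free_resolution R M P d e) = (P, d, e)"
    by (metis prod_cases3)
  have "case (SOME (P :: nat \<Rightarrow> ('r, ('r, 'm) resolution_carrier) module, d, e). free_resolution R M P d e)
      of (P, d, e) \<Rightarrow> free_resolution R M P d e"
    by (rule someI_ex) (use free_resolution_exists[OF M] in auto)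
  hence P: "free_resolution R M P d e" by (simp add: S)
  have E: "Ext R M N (Suc n) = Hom_cohomology R P d N (Suc n)" by (simp add: Ext_def S)
  have iff: "carrier (Ext R M N (Suc n)) = {\<one>\<^bsub>Ext R M N (Suc n)\<^esub>} \<longleftrightarrow> cocycles R P d N (Suc n) \<subseteq> coboundaries R P d N (Suc n)"
    unfolding E
  proof (rule Hom_cohomology_trivial_iff)
    show "left_module R (P n)" for n by (rule resolution_module[OF M P])
    show "d n \<in> left_module_hom R (P (Suc n)) (P n)" for n by (rule resolution_hom(2)[OF M P])
    show "d n (d (Suc n) x) = \<zero>\<^bsub>P n\<^esub>" if "x \<in> carrier (P (Suc (Suc n)))" for n x
      using that by (rule resolution_dd[OF M P])
  qed (rule N)
  show ?thesis unfolding iff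
    by (rule iffI) (erule cohomology_vanishing_transfer[OF M N Q P], erule cohomology_vanishing_transfer[OF M N P Q])
qed

section \<open>Representations of quotients of monoid algebras\<close>

context
  fixes A :: "('k::field, 'a) module" and I
  assumes A: "k_algebra A" and I: "ideal I A"
begin

interpretation A: k_algebra A by (rule A)
interpretation I: ideal I A by (rule I)

lemma quot_alg_carrier: "x \<in> carrier A \<Longrightarrow> I +>\<^bsub>A\<^esub> x \<in> carrier (quot_alg A I)"
  by (auto simp: quot_alg_def FactRing_def A_RCOSETS_def')

lemma quot_alg_carrierE:
  assumes "U \<in> carrier (quot_alg A I)"
  obtains x where "x \<in> carrier A" "U = I +>\<^bsub>A\<^esub> x"
  using assms by (auto simp: quot_alg_def FactRing_def A_RCOSETS_def')

lemma quot_alg_add: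
  "x \<in> carrier A \<Longrightarrow> y \<in> carrier A \<Longrightarrow>
    (I +>\<^bsub>A\<^esub> x) \<oplus>\<^bsub>quot_alg A I\<^esub> (I +>\<^bsub>A\<^esub> y) = I +>\<^bsub>A\<^esub> (x \<oplus>\<^bsub>A\<^esub> y)"
  by (simp add: quot_alg_def FactRing_def I.a_rcos_sum)

lemma quot_alg_mult:
  "x \<in> carrier A \<Longrightarrow> y \<in> carrier A \<Longrightarrow>
    (I +>\<^bsub>A\<^esub> x) \<otimes>\<^bsub>quot_alg A I\<^esub> (I +>\<^bsub>A\<^esub> y) = I +>\<^bsub>A\<^esub> (x \<otimes>\<^bsub>A\<^esub> y)"
  by (simp add: quot_alg_def FactRing_def I.rcoset_mult_add)

lemma quot_alg_one: "\<one>\<^bsub>quot_alg A I\<^esub> = I +>\<^bsub>A\<^esub> \<one>\<^bsub>A\<^esub>"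
  by (simp add: quot_alg_def FactRing_def)

lemma quot_alg_zero: "\<zero>\<^bsub>quot_alg A I\<^esub> = I +>\<^bsub>A\<^esub> \<zero>\<^bsub>A\<^esub>"
  using A.a_coset_add_zero[OF I.a_subset] by (simp add: quot_alg_def FactRing_def)

lemma quot_alg_eqI:
  assumes "x \<in> carrier A" "y \<in> carrier A" "x \<ominus>\<^bsub>A\<^esub> y \<in> I"
  shows "I +>\<^bsub>A\<^esub> x = I +>\<^bsub>A\<^esub> y"
  using assms A.quotient_eq_iff_same_a_r_cos[OF I] by blast

text \<open>The scalar multiple is defined as a union of cosets. That union is known to be a single
  coset and it contains c x, so it is the coset of c x.\<close>

lemma quot_alg_smult:
  assumes x: "x \<in> carrier A"
  shows "c \<odot>\<^bsub>quot_alg A I\<^esub> (I +>\<^bsub>A\<^esub> x) = I +>\<^bsub>A\<^esub> (c \<odot>\<^bsub>A\<^esub> x)"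
proof -
  interpret Q: k_algebra "quot_alg A I" by (rule k_algebra_quot_alg[OF A I])
  have "c \<odot>\<^bsub>quot_alg A I\<^esub> (I +>\<^bsub>A\<^esub> x) \<in> carrier (quot_alg A I)"
    using x by (intro Q.smult_closed quot_alg_carrier)
  then obtain z where z: "z \<in> carrier A" "c \<odot>\<^bsub>quot_alg A I\<^esub> (I +>\<^bsub>A\<^esub> x) = I +>\<^bsub>A\<^esub> z"
    by (rule quot_alg_carrierE)
  have "c \<odot>\<^bsub>A\<^esub> x \<in> I +>\<^bsub>A\<^esub> (c \<odot>\<^bsub>A\<^esub> x)" using x by (intro I.a_rcos_self A.smult_closed)
  also have "I +>\<^bsub>A\<^esub> (c \<odot>\<^bsub>A\<^esub> x) \<subseteq> c \<odot>\<^bsub>quot_alg A I\<^esub> (I +>\<^bsub>A\<^esub> x)"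
    using I.a_rcos_self[OF x] by (auto simp: quot_alg_def)
  finally have "c \<odot>\<^bsub>A\<^esub> x \<in> I +>\<^bsub>A\<^esub> z" by (simp add: z)
  thus ?thesis using z I.a_repr_independence' by simp
qed

end

definition mact :: "('m \<Rightarrow> ('i \<Rightarrow> 'k) \<Rightarrow> 'i \<Rightarrow> 'k) \<Rightarrow> ('m \<Rightarrow> 'k::field) \<Rightarrow> ('i \<Rightarrow> 'k) \<Rightarrow> 'i \<Rightarrow> 'k"
  where "mact \<rho> f v = (\<lambda>i. \<Sum>g | f g \<noteq> 0. f g * \<rho> g v i)"

text \<open>On a coset of the kernel of \<^const>\<open>mact\<close>, the choice of the representative is irrelevant.\<close>

definition qact :: "('m \<Rightarrow> ('i \<Rightarrow> 'k) \<Rightarrow> 'i \<Rightarrow> 'k) \<Rightarrow> ('m \<Rightarrow> 'k::field) set \<Rightarrow> ('i \<Rightarrow> 'k) \<Rightarrow> 'i \<Rightarrow> 'k"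
  where "qact \<rho> U = mact \<rho> (SOME f. f \<in> U)"

lemma mact_eq:
  assumes "finite S" "supp f \<subseteq> S"
  shows "mact \<rho> f v i = (\<Sum>g\<in>S. f g * \<rho> g v i)"
  unfolding mact_def by (rule sum.mono_neutral_left) (use assms in auto)

text \<open>Instantiated twice: by words acting on the four coordinates of
  \<open>\<Lambda> q\<close>, and by pairs of elements of \<open>\<Lambda> q\<close> acting on both
  sides of the resolution.\<close>

locale monoid_rep = Group.monoid G for G :: "'m monoid" +
  fixes \<rho> :: "'m \<Rightarrow> ('i \<Rightarrow> 'k::field) \<Rightarrow> 'i \<Rightarrow> 'k"
  assumes \<rho>_add: "g \<in> carrier G \<Longrightarrow> \<rho> g (\<lambda>i. u i + v i) = (\<lambda>i. \<rho> g u i + \<rho> g v i)"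
    and \<rho>_smult: "g \<in> carrier G \<Longrightarrow> \<rho> g (\<lambda>i. c * v i) = (\<lambda>i. c * \<rho> g v i)"
    and \<rho>_mult: "g \<in> carrier G \<Longrightarrow> h \<in> carrier G \<Longrightarrow> \<rho> (g \<otimes>\<^bsub>G\<^esub> h) v = \<rho> g (\<rho> h v)"
    and \<rho>_one: "\<rho> \<one>\<^bsub>G\<^esub> v = v"
begin

abbreviation "F \<equiv> monoid_alg G :: ('k, 'm \<Rightarrow> 'k) module"

sublocale F: k_algebra F by (rule k_algebra_monoid_alg) (rule monoid_axioms)

lemma F_simps: "f \<oplus>\<^bsub>F\<^esub> g = (\<lambda>x. f x + g x)" "c \<odot>\<^bsub>F\<^esub> f = (\<lambda>x. c * f x)" "\<zero>\<^bsub>F\<^esub> = (\<lambda>x. 0)"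
  "\<one>\<^bsub>F\<^esub> = basis_elem \<one>\<^bsub>G\<^esub>"
  by (auto simp: monoid_alg_def basis_elem_def)

lemma F_fin: "f \<in> carrier F \<Longrightarrow> finite (supp f)" by (simp add: monoid_alg_carrier)

lemma basis_F: "g \<in> carrier G \<Longrightarrow> basis_elem g \<in> carrier F" by (rule basis_elem_carrier)

lemma mact_add:
  assumes "f \<in> carrier F" "g \<in> carrier F"
  shows "mact \<rho> (f \<oplus>\<^bsub>F\<^esub> g) v = (\<lambda>i. mact \<rho> f v i + mact \<rho> g v i)"
proof
  fix i
  let ?S = "supp f \<union> supp g"
  have S: "finite ?S" using assms F_fin by blast
  have s: "supp (\<lambda>x. f x + g x) \<subseteq> ?S" by auto
  show "mact \<rho> (f \<oplus>\<^bsub>F\<^esub> g) v i = mact \<rho> f v i + mact \<rho> g v i"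
    unfolding F_simps mact_eq[OF S s] mact_eq[OF S Un_upper1] mact_eq[OF S Un_upper2]
    by (simp add: distrib_right sum.distrib)
qed

lemma mact_smult:
  assumes "f \<in> carrier F"
  shows "mact \<rho> (c \<odot>\<^bsub>F\<^esub> f) v = (\<lambda>i. c * mact \<rho> f v i)"
proof
  fix i
  have s: "supp (\<lambda>x. c * f x) \<subseteq> supp f" by auto
  show "mact \<rho> (c \<odot>\<^bsub>F\<^esub> f) v i = c * mact \<rho> f v i"
    unfolding F_simps mact_eq[OF F_fin[OF assms] s] mact_eq[OF F_fin[OF assms] subset_refl]
    by (simp add: sum_distrib_left mult.assoc)
qed

lemma mact_zero: "mact \<rho> \<zero>\<^bsub>F\<^esub> v = (\<lambda>i. 0)" by (simp add: mact_def F_simps)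

lemma mact_basis: "mact \<rho> (basis_elem g) v = \<rho> g v"
proof
  fix i
  have s: "supp (basis_elem g :: _ \<Rightarrow> 'k) \<subseteq> {g}" by (auto simp: basis_elem_def)
  show "mact \<rho> (basis_elem g) v i = \<rho> g v i"
    by (subst mact_eq[OF _ s]) (auto simp: basis_elem_def)
qed

lemma mact_vadd:
  assumes "f \<in> carrier F"
  shows "mact \<rho> f (\<lambda>i. u i + v i) = (\<lambda>i. mact \<rho> f u i + mact \<rho> f v i)"
proof -
  have "g \<in> supp f \<Longrightarrow> \<rho> g (\<lambda>i. u i + v i) = (\<lambda>i. \<rho> g u i + \<rho> g v i)" for g
    using assms by (intro \<rho>_add) (auto simp: monoid_alg_carrier)
  thus ?thesis unfolding mact_def by (auto simp: distrib_left sum.distrib intro!: ext)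
qed

lemma mact_vsmult:
  assumes "f \<in> carrier F"
  shows "mact \<rho> f (\<lambda>i. c * v i) = (\<lambda>i. c * mact \<rho> f v i)"
proof -
  have "g \<in> supp f \<Longrightarrow> \<rho> g (\<lambda>i. c * v i) = (\<lambda>i. c * \<rho> g v i)" for g
    using assms by (intro \<rho>_smult) (auto simp: monoid_alg_carrier)
  thus ?thesis unfolding mact_def by (auto simp: sum_distrib_left mult.left_commute intro!: ext sum.cong)
qed

lemma mact_vzero: "f \<in> carrier F \<Longrightarrow> mact \<rho> f (\<lambda>i. 0) = (\<lambda>i. 0)"
  using mact_vsmult[of f 0 "\<lambda>i. 0"] by simp

lemma mact_one: "mact \<rho> \<one>\<^bsub>F\<^esub> v = v" by (simp add: F_simps mact_basis \<rho>_one)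

lemma mact_mult:
  assumes f: "f \<in> carrier F" and g: "g \<in> carrier F"
  shows "mact \<rho> (f \<otimes>\<^bsub>F\<^esub> g) v = mact \<rho> f (mact \<rho> g v)"
proof -
  have 1: "mact \<rho> (basis_elem a \<otimes>\<^bsub>F\<^esub> g) v = \<rho> a (mact \<rho> g v)" if a: "a \<in> carrier G" for a
    using g
  proof (induction rule: monoid_alg_induct)
    case zero
    have "\<rho> a (\<lambda>i. 0) = (\<lambda>i. 0)" using \<rho>_smult[OF a, of 0 "\<lambda>i. 0"] by simp
    thus ?case using basis_F[OF a] by (simp add: mact_zero)
  next
    case (add b c g)
    note cl = basis_F[OF a] basis_F[OF add(1)] F.smult_closed[OF basis_F[OF add(1)]]
    have "basis_elem a \<otimes>\<^bsub>F\<^esub> (c \<odot>\<^bsub>F\<^esub> basis_elem b \<oplus>\<^bsub>F\<^esub> g) = 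
       c \<odot>\<^bsub>F\<^esub> basis_elem (a \<otimes>\<^bsub>G\<^esub> b) \<oplus>\<^bsub>F\<^esub> basis_elem a \<otimes>\<^bsub>F\<^esub> g"
      using add cl a by (simp add: F.r_distr F.smult_mult_right basis_elem_mult)
    moreover have "basis_elem (a \<otimes>\<^bsub>G\<^esub> b) \<in> carrier F" using a add(1) by (simp add: basis_F)
    ultimately show ?case using add cl a
      by (simp add: mact_add mact_smult F.smult_closed mact_basis \<rho>_mult \<rho>_add \<rho>_smult)
  qed
  show ?thesis using f
  proof (induction rule: monoid_alg_induct)
    case zero thus ?case using g by (simp add: mact_zero)
  next
    case (add b c f)
    note cl = basis_F[OF add(1)] F.smult_closed[OF basis_F[OF add(1)]]
    have "(c \<odot>\<^bsub>F\<^esub> basis_elem b \<oplus>\<^bsub>F\<^esub> f) \<otimes>\<^bsub>F\<^esub> g = c \<odot>\<^bsub>F\<^esub> (basis_elem b \<otimes>\<^bsub>F\<^esub> g) \<oplus>\<^bsub>F\<^esub> f \<otimes>\<^bsub>F\<^esub> g"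
      using add cl g by (simp add: F.l_distr F.smult_mult_left)
    thus ?case using add cl g
      by (simp add: mact_add mact_smult F.smult_closed mact_basis 1)
  qed
qed

definition "rep_kernel = {f \<in> carrier F. \<forall>v. mact \<rho> f v = (\<lambda>i. 0)}"

lemma ideal_rep_kernel: "ideal rep_kernel F"
proof (rule idealI)
  show "ring F" by (rule F.ring_axioms)
  have um: "mact \<rho> (\<ominus>\<^bsub>F\<^esub> f) v = (\<lambda>i. 0)" if f: "f \<in> carrier F" and k: "\<forall>v. mact \<rho> f v = (\<lambda>i. 0)" for f v
    using mact_add[of "\<ominus>\<^bsub>F\<^esub> f" f v] f k by (simp add: F.l_neg mact_zero)
  show "subgroup rep_kernel (add_monoid F)"
    by (rule F.add.subgroupI)
       (auto simp: rep_kernel_def mact_add mact_zero um a_inv_def[symmetric] intro!: exI[of _ "\<zero>\<^bsub>F\<^esub>"])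
qed (auto simp: rep_kernel_def mact_mult mact_vzero)

context
  fixes S assumes S: "S \<subseteq> rep_kernel"
begin

abbreviation "J \<equiv> Idl\<^bsub>F\<^esub> S"
abbreviation "Q \<equiv> quot_alg F J"

lemma ideal_J: "ideal J F" using S by (intro F.genideal_ideal) (auto simp: rep_kernel_def)

lemma J_subset: "J \<subseteq> rep_kernel" using ideal_rep_kernel S by (auto simp: genideal_def)

text \<open>The representative chosen by \<open>qact\<close> differs from f by an element of J, and
  J acts as zero: its generators do, and \<open>rep_kernel\<close> is an ideal.\<close>

lemma qact_coset:
  assumes f: "f \<in> carrier F" shows "qact \<rho> (J +>\<^bsub>F\<^esub> f) v = mact \<rho> f v"
proof -
  interpret J: ideal J F by (rule ideal_J)
  have "(SOME f'. f' \<in> J +>\<^bsub>F\<^esub> f) \<in> J +>\<^bsub>F\<^esub> f" by (rule someI[where P = "\<lambda>f'. f' \<in> J +>\<^bsub>F\<^esub> f"], rule J.a_rcos_self[OF f])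
  then obtain i where i: "i \<in> J" "(SOME f'. f' \<in> J +>\<^bsub>F\<^esub> f) = i \<oplus>\<^bsub>F\<^esub> f" by (auto simp: a_r_coset_def')
  hence "i \<in> rep_kernel" using J_subset by blast
  thus ?thesis using f by (simp add: qact_def i(2) rep_kernel_def mact_add)
qed

lemma qact_add: "U \<in> carrier Q \<Longrightarrow> V \<in> carrier Q \<Longrightarrow> qact \<rho> (U \<oplus>\<^bsub>Q\<^esub> V) v = (\<lambda>i. qact \<rho> U v i + qact \<rho> V v i)"
  by (elim quot_alg_carrierE[OF F.k_algebra_axioms ideal_J])
     (simp add: quot_alg_add[OF F.k_algebra_axioms ideal_J] qact_coset mact_add)

lemma qact_mult: "U \<in> carrier Q \<Longrightarrow> V \<in> carrier Q \<Longrightarrow> qact \<rho> (U \<otimes>\<^bsub>Q\<^esub> V) v = qact \<rho> U (qact \<rho> V v)"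
  by (elim quot_alg_carrierE[OF F.k_algebra_axioms ideal_J])
     (simp add: quot_alg_mult[OF F.k_algebra_axioms ideal_J] qact_coset mact_mult)

lemma qact_smult: "U \<in> carrier Q \<Longrightarrow> qact \<rho> (c \<odot>\<^bsub>Q\<^esub> U) v = (\<lambda>i. c * qact \<rho> U v i)"
  by (elim quot_alg_carrierE[OF F.k_algebra_axioms ideal_J])
     (simp add: quot_alg_smult[OF F.k_algebra_axioms ideal_J] qact_coset mact_smult F.smult_closed)

lemma qact_one: "qact \<rho> \<one>\<^bsub>Q\<^esub> v = v"
  by (simp add: quot_alg_one[OF F.k_algebra_axioms ideal_J] qact_coset mact_one)

lemma qact_zero: "qact \<rho> \<zero>\<^bsub>Q\<^esub> v = (\<lambda>i. 0)"
  by (simp add: quot_alg_zero[OF F.k_algebra_axioms ideal_J] qact_coset mact_zero)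

lemma qact_vadd: "U \<in> carrier Q \<Longrightarrow> qact \<rho> U (\<lambda>i. u i + v i) = (\<lambda>i. qact \<rho> U u i + qact \<rho> U v i)"
  by (elim quot_alg_carrierE[OF F.k_algebra_axioms ideal_J]) (simp add: qact_coset mact_vadd)

end

end

section \<open>A basis of \<open>\<Lambda> q\<close>\<close>

text \<open>
  Coordinates \<open>c (a, b)\<close> refer to the basis \<open>x\<^sup>a y\<^sup>b\<close>, with \<open>a, b\<close> booleans; in \<open>\<Lambda> q\<close> one has
  \<open>yx = t xy\<close> with \<open>t = - q\<^sup>-\<^sup>1\<close>, and \<open>xmul\<close>, \<open>ymul\<close> are the left multiplications by \<open>x\<close>, \<open>y\<close>.
\<close>

definition xmul :: "(bool \<times> bool \<Rightarrow> 'k::field) \<Rightarrow> bool \<times> bool \<Rightarrow> 'k"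
  where "xmul c = (\<lambda>(a, b). if a then c (False, b) else 0)"

definition ymul :: "'k \<Rightarrow> (bool \<times> bool \<Rightarrow> 'k::field) \<Rightarrow> bool \<times> bool \<Rightarrow> 'k"
  where "ymul t c = (\<lambda>(a, b). if b then t ^ of_bool a * c (a, False) else 0)"

text \<open>This is the product of \<open>\<Lambda> q\<close> in coordinates, as
  \<open>coord_mult\<close> confirms; xy acts on the left as x after y.\<close>

definition lmul :: "'k \<Rightarrow> (bool \<times> bool \<Rightarrow> 'k::field) \<Rightarrow> (bool \<times> bool \<Rightarrow> 'k) \<Rightarrow> bool \<times> bool \<Rightarrow> 'k"
  where "lmul t c d = (\<lambda>i. c (False, False) * d i + c (True, False) * xmul d i +
     c (False, True) * ymul t d i + c (True, True) * xmul (ymul t d) i)"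

definition word_op :: "'k::field \<Rightarrow> letter list \<Rightarrow> (bool \<times> bool \<Rightarrow> 'k) \<Rightarrow> bool \<times> bool \<Rightarrow> 'k"
  where "word_op t w = foldr (\<lambda>l. case l of Letter_x \<Rightarrow> xmul | Letter_y \<Rightarrow> ymul t) w"

locale quantum_plane =
  fixes q :: "'k::field"
  assumes q_nz: "q \<noteq> 0"
begin

definition "t = - inverse q"

lemma t_nz: "t \<noteq> 0" using q_nz by (simp add: t_def)

lemma qt: "q * t = -1" using q_nz by (simp add: t_def)

abbreviation "\<delta>\<^sub>1 \<equiv> basis_elem (False, False) :: bool \<times> bool \<Rightarrow> 'k"

lemma word_op_lin:
  "word_op t w (\<lambda>i. u i + v i) = (\<lambda>i. word_op t w u i + word_op t w v i)"
  "word_op t w (\<lambda>i. c * v i) = (\<lambda>i. c * word_op t w v i)"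
  unfolding word_op_def
  by (induction w) (auto simp: xmul_def ymul_def fun_eq_iff algebra_simps split: letter.splits)

sublocale W: monoid_rep word_monoid "word_op t"
proof
qed (auto simp: word_monoid_def word_op_lin, simp_all add: word_op_def)

lemma free_alg_F: "free_alg_xy = W.F" by (simp add: free_alg_xy_def)

abbreviation "bx \<equiv> basis_elem [Letter_x] :: letter list \<Rightarrow> 'k"
abbreviation "by' \<equiv> basis_elem [Letter_y] :: letter list \<Rightarrow> 'k"

definition "relations = {bx \<otimes>\<^bsub>W.F\<^esub> bx, bx \<otimes>\<^bsub>W.F\<^esub> by' \<oplus>\<^bsub>W.F\<^esub> q \<odot>\<^bsub>W.F\<^esub> (by' \<otimes>\<^bsub>W.F\<^esub> bx), by' \<otimes>\<^bsub>W.F\<^esub> by'}"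

lemma word_carrier [simp]: "basis_elem w \<in> carrier W.F"
  by (rule W.basis_F) (simp add: word_monoid_def)

lemma word_mult [simp]: "basis_elem v \<otimes>\<^bsub>W.F\<^esub> basis_elem w = basis_elem (v @ w)"
  by (subst basis_elem_mult) (simp_all add: word_monoid_def)

text \<open>The mixed relation can only produce an xy-coordinate, and it does so with the
  coefficient 1 + q t = 0.\<close>

lemma relations_kernel: "relations \<subseteq> W.rep_kernel"
proof -
  have "word_op t [Letter_x, Letter_y] v i + q * word_op t [Letter_y, Letter_x] v i = 0" for v i
    using qt by (cases i) (auto simp: word_op_def xmul_def ymul_def algebra_simps mult.assoc[symmetric])
  thus ?thesis
    by (auto simp: relations_def W.rep_kernel_def W.mact_basis W.mact_add W.mact_smult W.F.smult_closed W.F.a_closed)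
       (auto simp: word_op_def xmul_def ymul_def)
qed

abbreviation "JW \<equiv> Idl\<^bsub>W.F\<^esub> relations"
abbreviation "L \<equiv> \<Lambda> q"

definition "gx = JW +>\<^bsub>W.F\<^esub> bx"
definition "gy = JW +>\<^bsub>W.F\<^esub> by'"

lemma L_eq: "L = quot_alg W.F JW"
  by (simp add: \<Lambda>_def free_alg_F relations_def Let_def)

sublocale L: k_algebra L by (rule k_algebra_\<Lambda>)

lemmas W_ideal = W.ideal_J[OF relations_kernel]
lemmas L_carrier = quot_alg_carrier[OF W.F.k_algebra_axioms W_ideal, folded L_eq]
lemmas L_carrierE = quot_alg_carrierE[OF W.F.k_algebra_axioms W_ideal, folded L_eq]
lemmas L_add = quot_alg_add[OF W.F.k_algebra_axioms W_ideal, folded L_eq]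
lemmas L_mult = quot_alg_mult[OF W.F.k_algebra_axioms W_ideal, folded L_eq]
lemmas L_smult = quot_alg_smult[OF W.F.k_algebra_axioms W_ideal, folded L_eq]
lemmas L_one = quot_alg_one[OF W.F.k_algebra_axioms W_ideal, folded L_eq]
lemmas L_zero = quot_alg_zero[OF W.F.k_algebra_axioms W_ideal, folded L_eq]
lemmas L_eqI = quot_alg_eqI[OF W.F.k_algebra_axioms W_ideal]
lemmas L_qact = W.qact_add[OF relations_kernel, folded L_eq] W.qact_mult[OF relations_kernel, folded L_eq]
  W.qact_smult[OF relations_kernel, folded L_eq] W.qact_one[OF relations_kernel, folded L_eq]
  W.qact_coset[OF relations_kernel]

lemma gxy_carrier [simp]: "gx \<in> carrier L" "gy \<in> carrier L"
  by (simp_all add: gx_def gy_def L_carrier)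

lemma rel_JW: "f \<in> relations \<Longrightarrow> f \<in> JW"
  using W.F.genideal_self[of relations] relations_kernel by (auto simp: W.rep_kernel_def)

lemma XX: "gx \<otimes>\<^bsub>L\<^esub> gx = \<zero>\<^bsub>L\<^esub>" and YY: "gy \<otimes>\<^bsub>L\<^esub> gy = \<zero>\<^bsub>L\<^esub>"
  unfolding gx_def gy_def L_mult[OF word_carrier word_carrier] L_zero
  by (rule L_eqI, simp_all add: a_minus_def, rule rel_JW, simp add: relations_def)+

lemma XY: "gx \<otimes>\<^bsub>L\<^esub> gy \<oplus>\<^bsub>L\<^esub> q \<odot>\<^bsub>L\<^esub> (gy \<otimes>\<^bsub>L\<^esub> gx) = \<zero>\<^bsub>L\<^esub>"
proof -
  have "gx \<otimes>\<^bsub>L\<^esub> gy \<oplus>\<^bsub>L\<^esub> q \<odot>\<^bsub>L\<^esub> (gy \<otimes>\<^bsub>L\<^esub> gx) = JW +>\<^bsub>W.F\<^esub> (bx \<otimes>\<^bsub>W.F\<^esub> by' \<oplus>\<^bsub>W.F\<^esub> q \<odot>\<^bsub>W.F\<^esub> (by' \<otimes>\<^bsub>W.F\<^esub> bx))"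
    by (simp add: gx_def gy_def L_mult L_smult L_add W.F.smult_closed)
  also have "\<dots> = \<zero>\<^bsub>L\<^esub>" unfolding L_zero
    by (rule L_eqI)
       (simp_all add: a_minus_def W.F.smult_closed W.F.a_closed, rule rel_JW, simp add: relations_def)
  finally show ?thesis .
qed

lemma YX: "gy \<otimes>\<^bsub>L\<^esub> gx = t \<odot>\<^bsub>L\<^esub> (gx \<otimes>\<^bsub>L\<^esub> gy)"
proof -
  have "q \<odot>\<^bsub>L\<^esub> (t \<odot>\<^bsub>L\<^esub> (gx \<otimes>\<^bsub>L\<^esub> gy)) = (-1) \<odot>\<^bsub>L\<^esub> (gx \<otimes>\<^bsub>L\<^esub> gy)"
    by (simp add: L.smult_assoc[symmetric] qt)
  also have "\<dots> \<oplus>\<^bsub>L\<^esub> (gx \<otimes>\<^bsub>L\<^esub> gy) = \<zero>\<^bsub>L\<^esub>"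
    using L.smult_l_distr[of "gx \<otimes>\<^bsub>L\<^esub> gy" "-1" 1] by (simp add: L.smult_one)
  finally have "q \<odot>\<^bsub>L\<^esub> (t \<odot>\<^bsub>L\<^esub> (gx \<otimes>\<^bsub>L\<^esub> gy)) = q \<odot>\<^bsub>L\<^esub> (gy \<otimes>\<^bsub>L\<^esub> gx)"
    using XY by (metis L.a_comm L.m_closed L.minus_equality L.smult_closed gxy_carrier)
  hence "inverse q \<odot>\<^bsub>L\<^esub> (q \<odot>\<^bsub>L\<^esub> (t \<odot>\<^bsub>L\<^esub> (gx \<otimes>\<^bsub>L\<^esub> gy))) = inverse q \<odot>\<^bsub>L\<^esub> (q \<odot>\<^bsub>L\<^esub> (gy \<otimes>\<^bsub>L\<^esub> gx))" by simp
  moreover have "inverse q * (q * t) = t" "inverse q * q = 1" using q_nz by simp_all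
  ultimately show ?thesis by (simp add: L.smult_assoc[symmetric] L.smult_one)
qed

definition "elt c = c (False, False) \<odot>\<^bsub>L\<^esub> \<one>\<^bsub>L\<^esub> \<oplus>\<^bsub>L\<^esub> c (True, False) \<odot>\<^bsub>L\<^esub> gx \<oplus>\<^bsub>L\<^esub>
   (c (False, True) \<odot>\<^bsub>L\<^esub> gy \<oplus>\<^bsub>L\<^esub> c (True, True) \<odot>\<^bsub>L\<^esub> (gx \<otimes>\<^bsub>L\<^esub> gy))"

lemma elt_carrier [simp]: "elt c \<in> carrier L"
  by (simp add: elt_def L.smult_closed)

lemma L_add4:
  assumes "a \<in> carrier L" "b \<in> carrier L" "c \<in> carrier L" "d \<in> carrier L"
    "a' \<in> carrier L" "b' \<in> carrier L" "c' \<in> carrier L" "d' \<in> carrier L"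
  shows "(a \<oplus>\<^bsub>L\<^esub> b \<oplus>\<^bsub>L\<^esub> (c \<oplus>\<^bsub>L\<^esub> d)) \<oplus>\<^bsub>L\<^esub> (a' \<oplus>\<^bsub>L\<^esub> b' \<oplus>\<^bsub>L\<^esub> (c' \<oplus>\<^bsub>L\<^esub> d')) =
    (a \<oplus>\<^bsub>L\<^esub> a') \<oplus>\<^bsub>L\<^esub> (b \<oplus>\<^bsub>L\<^esub> b') \<oplus>\<^bsub>L\<^esub> ((c \<oplus>\<^bsub>L\<^esub> c') \<oplus>\<^bsub>L\<^esub> (d \<oplus>\<^bsub>L\<^esub> d'))"
  using assms by (simp add: L.a_ac)

lemma elt_add: "elt c \<oplus>\<^bsub>L\<^esub> elt d = elt (\<lambda>i. c i + d i)"
  unfolding elt_def by (subst L_add4) (simp_all add: L.smult_closed L.smult_l_distr)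

lemma elt_smult: "s \<odot>\<^bsub>L\<^esub> elt c = elt (\<lambda>i. s * c i)"
  unfolding elt_def by (simp add: L.smult_closed L.smult_r_distr L.smult_assoc)

lemma elt_zero: "elt (\<lambda>i. 0) = \<zero>\<^bsub>L\<^esub>" by (simp add: elt_def)

lemma elt_one: "elt \<delta>\<^sub>1 = \<one>\<^bsub>L\<^esub>" by (simp add: elt_def basis_elem_def L.smult_one)

lemma X_elt: "gx \<otimes>\<^bsub>L\<^esub> elt c = elt (xmul c)"
proof -
  have "gx \<otimes>\<^bsub>L\<^esub> elt c = c (False, False) \<odot>\<^bsub>L\<^esub> gx \<oplus>\<^bsub>L\<^esub> c (True, False) \<odot>\<^bsub>L\<^esub> (gx \<otimes>\<^bsub>L\<^esub> gx) \<oplus>\<^bsub>L\<^esub>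
   (c (False, True) \<odot>\<^bsub>L\<^esub> (gx \<otimes>\<^bsub>L\<^esub> gy) \<oplus>\<^bsub>L\<^esub> c (True, True) \<odot>\<^bsub>L\<^esub> (gx \<otimes>\<^bsub>L\<^esub> gx \<otimes>\<^bsub>L\<^esub> gy))"
    unfolding elt_def by (simp add: L.r_distr L.smult_closed L.smult_mult_right L.m_assoc)
  thus ?thesis by (simp add: XX elt_def xmul_def L.smult_closed)
qed

lemma Y_elt: "gy \<otimes>\<^bsub>L\<^esub> elt c = elt (ymul t c)"
proof -
  have "gy \<otimes>\<^bsub>L\<^esub> (gx \<otimes>\<^bsub>L\<^esub> gy) = t \<odot>\<^bsub>L\<^esub> (gx \<otimes>\<^bsub>L\<^esub> (gy \<otimes>\<^bsub>L\<^esub> gy))"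
    by (simp add: L.m_assoc[symmetric] YX L.smult_mult_left)
  hence YXY: "gy \<otimes>\<^bsub>L\<^esub> (gx \<otimes>\<^bsub>L\<^esub> gy) = \<zero>\<^bsub>L\<^esub>" by (simp add: YY)
  have "gy \<otimes>\<^bsub>L\<^esub> elt c = c (False, False) \<odot>\<^bsub>L\<^esub> gy \<oplus>\<^bsub>L\<^esub> c (True, False) \<odot>\<^bsub>L\<^esub> (gy \<otimes>\<^bsub>L\<^esub> gx) \<oplus>\<^bsub>L\<^esub>
   (c (False, True) \<odot>\<^bsub>L\<^esub> (gy \<otimes>\<^bsub>L\<^esub> gy) \<oplus>\<^bsub>L\<^esub> c (True, True) \<odot>\<^bsub>L\<^esub> (gy \<otimes>\<^bsub>L\<^esub> (gx \<otimes>\<^bsub>L\<^esub> gy)))"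
    unfolding elt_def by (simp add: L.r_distr L.smult_closed L.smult_mult_right)
  thus ?thesis
    by (simp add: YY YXY YX elt_def ymul_def L.smult_closed L.smult_assoc[symmetric] mult.commute)
qed

text \<open>The span of 1, x, y, xy is stable under left multiplication by both letters, so building
  a word letter by letter from the empty one never leaves it.\<close>

lemma word_elt: "JW +>\<^bsub>W.F\<^esub> basis_elem w \<in> range elt"
proof (induction w)
  case Nil
  have "JW +>\<^bsub>W.F\<^esub> basis_elem [] = elt \<delta>\<^sub>1"
    using L_one by (simp add: elt_one W.F_simps(4)) (simp add: word_monoid_def)
  thus ?case by blast
next
  case (Cons l w)
  then obtain c where c: "JW +>\<^bsub>W.F\<^esub> basis_elem w = elt c" by blast
  have "JW +>\<^bsub>W.F\<^esub> basis_elem (l # w) = (JW +>\<^bsub>W.F\<^esub> basis_elem [l]) \<otimes>\<^bsub>L\<^esub> elt c"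
    unfolding c[symmetric] by (simp add: L_mult)
  also have "\<dots> \<in> range elt" by (cases l) (auto simp: X_elt Y_elt gx_def[symmetric] gy_def[symmetric])
  finally show ?case .
qed

lemma L_elt: "U \<in> carrier L \<Longrightarrow> U \<in> range elt"
proof (erule L_carrierE, hypsubst)
  fix f assume "f \<in> carrier W.F"
  thus "JW +>\<^bsub>W.F\<^esub> f \<in> range elt"
  proof (induction rule: monoid_alg_induct)
    case zero
    have "JW +>\<^bsub>W.F\<^esub> \<zero>\<^bsub>W.F\<^esub> = elt (\<lambda>i. 0)" by (simp add: elt_zero L_zero)
    thus ?case by blast
  next
    case (add w s f)
    obtain c where c: "JW +>\<^bsub>W.F\<^esub> basis_elem w = elt c" using word_elt by blast
    obtain d where d: "JW +>\<^bsub>W.F\<^esub> f = elt d" using add by blast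
    have "JW +>\<^bsub>W.F\<^esub> (s \<odot>\<^bsub>W.F\<^esub> basis_elem w \<oplus>\<^bsub>W.F\<^esub> f) = s \<odot>\<^bsub>L\<^esub> elt c \<oplus>\<^bsub>L\<^esub> elt d"
      unfolding c[symmetric] d[symmetric] using add by (simp add: L_smult L_add W.F.smult_closed)
    also have "\<dots> \<in> range elt" by (simp add: elt_smult elt_add)
    finally show ?case .
  qed
qed

definition "coord U = qact (word_op t) U \<delta>\<^sub>1"

lemma qact_X: "qact (word_op t) gx v = xmul v" and qact_Y: "qact (word_op t) gy v = ymul t v"
  by (simp_all add: gx_def gy_def L_qact W.mact_basis) (simp_all add: word_op_def)

lemma qact_elt: "qact (word_op t) (elt c) v = lmul t c v"
  unfolding elt_def lmul_def by (simp add: L_qact L.smult_closed qact_X qact_Y add.assoc)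

text \<open>Linear independence of 1, x, y, xy: acting on the coordinate vector of 1 returns the
  coefficients, which are thus determined by the element.\<close>

lemma coord_elt [simp]: "coord (elt c) = c"
  unfolding coord_def qact_elt lmul_def
  by (auto simp: fun_eq_iff xmul_def ymul_def basis_elem_def)

lemma elt_coord [simp]: "U \<in> carrier L \<Longrightarrow> elt (coord U) = U"
  using L_elt by fastforce

lemma coord_eqI: "U \<in> carrier L \<Longrightarrow> V \<in> carrier L \<Longrightarrow> coord U = coord V \<Longrightarrow> U = V"
  by (metis elt_coord)

lemma coord_add: "U \<in> carrier L \<Longrightarrow> V \<in> carrier L \<Longrightarrow> coord (U \<oplus>\<^bsub>L\<^esub> V) = (\<lambda>i. coord U i + coord V i)"
  by (simp add: coord_def L_qact)

lemma coord_smult: "U \<in> carrier L \<Longrightarrow> coord (s \<odot>\<^bsub>L\<^esub> U) = (\<lambda>i. s * coord U i)"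
  by (simp add: coord_def L_qact)

lemma coord_zero [simp]: "coord \<zero>\<^bsub>L\<^esub> = (\<lambda>i. 0)"
  using coord_elt[of "\<lambda>i. 0"] by (simp add: elt_zero)

lemma coord_one: "coord \<one>\<^bsub>L\<^esub> = \<delta>\<^sub>1"
  using coord_elt[of "\<delta>\<^sub>1"] by (simp add: elt_one)

lemma coord_mult: "U \<in> carrier L \<Longrightarrow> V \<in> carrier L \<Longrightarrow> coord (U \<otimes>\<^bsub>L\<^esub> V) = lmul t (coord U) (coord V)"
  by (metis coord_def L_qact(2) elt_coord qact_elt)

end

section \<open>The enveloping algebra\<close>

text \<open>The pure tensor of a and b. The factor a belongs to the opposite algebra and acts from
  the right, b acts from the left.\<close>

definition tens :: "('k::field, 'a) module \<Rightarrow> 'a \<Rightarrow> 'a \<Rightarrow> ('a \<times> 'a \<Rightarrow> 'k) set"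
  where "tens A a b = (let F = monoid_alg (opposite_alg A \<times>\<times> A) in
    Idl\<^bsub>F\<^esub> (bilinearity_relations (opposite_alg A) A) +>\<^bsub>F\<^esub> basis_elem (a, b))"

context
  fixes A :: "('k::field, 'a) module"
  assumes A: "k_algebra A"
begin

interpretation A: k_algebra A by (rule A)

abbreviation "FE \<equiv> monoid_alg (opposite_alg A \<times>\<times> A) :: ('k, 'a \<times> 'a \<Rightarrow> 'k) module"
abbreviation "JE \<equiv> Idl\<^bsub>FE\<^esub> (bilinearity_relations (opposite_alg A) A)"

interpretation F: k_algebra FE by (intro k_algebra_tensor_pre k_algebra_opposite A)

interpretation E: k_algebra "enveloping_alg A" by (rule k_algebra_enveloping[OF A])

lemma env_eq: "enveloping_alg A = quot_alg FE JE"
  by (simp add: enveloping_alg_def tensor_alg_def Let_def)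

lemma ideal_JE: "ideal JE FE" by (intro ideal_tensor k_algebra_opposite A)

lemma basis_FE: "a \<in> carrier A \<Longrightarrow> b \<in> carrier A \<Longrightarrow> basis_elem (a, b) \<in> carrier FE"
  by (rule basis_elem_carrier) (simp add: carrier_opposite[OF A])

lemma tens_eq: "tens A a b = JE +>\<^bsub>FE\<^esub> basis_elem (a, b)"
  by (simp add: tens_def Let_def)

lemmas env_add = quot_alg_add[OF F.k_algebra_axioms ideal_JE, folded env_eq]
lemmas env_smult = quot_alg_smult[OF F.k_algebra_axioms ideal_JE, folded env_eq]
lemmas env_zero = quot_alg_zero[OF F.k_algebra_axioms ideal_JE, folded env_eq]
lemmas env_eqI = quot_alg_eqI[OF F.k_algebra_axioms ideal_JE]
lemmas env_carrier = quot_alg_carrier[OF F.k_algebra_axioms ideal_JE, folded env_eq]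
lemmas env_carrierE = quot_alg_carrierE[OF F.k_algebra_axioms ideal_JE, folded env_eq]

lemma tens_closed: "a \<in> carrier A \<Longrightarrow> b \<in> carrier A \<Longrightarrow> tens A a b \<in> carrier (enveloping_alg A)"
  by (simp add: tens_eq env_carrier basis_FE)

lemma bilin_JE: "f \<in> bilinearity_relations (opposite_alg A) A \<Longrightarrow> f \<in> JE"
  using F.genideal_self[OF bilinearity_relations_carrier[OF k_algebra_opposite[OF A] A]] by blast

lemma bilin_eqI:
  "f \<in> carrier FE \<Longrightarrow> g \<in> carrier FE \<Longrightarrow> f \<ominus>\<^bsub>FE\<^esub> g \<in> bilinearity_relations (opposite_alg A) A \<Longrightarrow>
    JE +>\<^bsub>FE\<^esub> f = JE +>\<^bsub>FE\<^esub> g"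
  by (rule env_eqI) (auto intro: bilin_JE)

lemma tens_add_left:
  assumes "a \<in> carrier A" "a' \<in> carrier A" "b \<in> carrier A"
  shows "tens A (a \<oplus>\<^bsub>A\<^esub> a') b = tens A a b \<oplus>\<^bsub>enveloping_alg A\<^esub> tens A a' b"
  unfolding tens_eq using assms
  by (subst env_add, simp_all add: basis_FE)
     (rule bilin_eqI, simp_all add: basis_FE, unfold bilinearity_relations_def Let_def, use assms in \<open>auto simp: opposite_alg_def\<close>)

lemma tens_add_right:
  assumes "a \<in> carrier A" "b \<in> carrier A" "b' \<in> carrier A"
  shows "tens A a (b \<oplus>\<^bsub>A\<^esub> b') = tens A a b \<oplus>\<^bsub>enveloping_alg A\<^esub> tens A a b'"
  unfolding tens_eq using assms
  by (subst env_add, simp_all add: basis_FE)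
     (rule bilin_eqI, simp_all add: basis_FE, unfold bilinearity_relations_def Let_def, use assms in \<open>auto simp: opposite_alg_def\<close>)

lemma tens_smult_left:
  assumes "a \<in> carrier A" "b \<in> carrier A"
  shows "tens A (c \<odot>\<^bsub>A\<^esub> a) b = c \<odot>\<^bsub>enveloping_alg A\<^esub> tens A a b"
  unfolding tens_eq using assms
  by (subst env_smult, simp_all add: basis_FE)
     (rule bilin_eqI, simp_all add: basis_FE A.smult_closed F.smult_closed, unfold bilinearity_relations_def Let_def, use assms in \<open>auto simp: opposite_alg_def\<close>)

lemma tens_smult_right:
  assumes "a \<in> carrier A" "b \<in> carrier A"
  shows "tens A a (c \<odot>\<^bsub>A\<^esub> b) = c \<odot>\<^bsub>enveloping_alg A\<^esub> tens A a b"
  unfolding tens_eq using assms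
  by (subst env_smult, simp_all add: basis_FE)
     (rule bilin_eqI, simp_all add: basis_FE A.smult_closed F.smult_closed, unfold bilinearity_relations_def Let_def, use assms in \<open>auto simp: opposite_alg_def\<close>)

text \<open>Pure tensors generate additively, since a coefficient from the field can be absorbed
  into the first factor.\<close>

lemma env_induct [consumes 1, case_names zero add]:
  assumes "\<xi> \<in> carrier (enveloping_alg A)"
    and "P \<zero>\<^bsub>enveloping_alg A\<^esub>"
    and step: "\<And>a b \<xi>. a \<in> carrier A \<Longrightarrow> b \<in> carrier A \<Longrightarrow> \<xi> \<in> carrier (enveloping_alg A) \<Longrightarrow> P \<xi> \<Longrightarrow>
      P (tens A a b \<oplus>\<^bsub>enveloping_alg A\<^esub> \<xi>)"
  shows "P \<xi>"
proof -
  obtain f where f: "f \<in> carrier FE" "\<xi> = JE +>\<^bsub>FE\<^esub> f" using assms(1) by (rule env_carrierE)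
  have "P (JE +>\<^bsub>FE\<^esub> f)" using f(1)
  proof (induction rule: monoid_alg_induct)
    case zero show ?case using assms(2) by (simp add: env_zero)
  next
    case (add p c f)
    obtain a b where p: "p = (a, b)" "a \<in> carrier A" "b \<in> carrier A"
      using add(1) by (cases p) (simp add: carrier_opposite[OF A])
    have "P (tens A (c \<odot>\<^bsub>A\<^esub> a) b \<oplus>\<^bsub>enveloping_alg A\<^esub> (JE +>\<^bsub>FE\<^esub> f))"
      using add p by (intro step) (auto intro: A.smult_closed env_carrier)
    thus ?case using p add
      by (simp add: tens_smult_left) (simp add: tens_eq env_smult env_add basis_FE F.smult_closed)
  qed
  thus ?thesis using f by simp
qed

text \<open>The action is \<open>the_elem\<close> of an image over a whole coset. The ideal of the
  bilinearity relations annihilates every m, so this image is a singleton, given by the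
  representative \<open>basis_elem (a, b)\<close>.\<close>

lemma tens_bimodule:
  assumes "a \<in> carrier A" "b \<in> carrier A" "m \<in> carrier A"
  shows "tens A a b \<odot>\<^bsub>bimodule_of_alg A\<^esub> m = b \<otimes>\<^bsub>A\<^esub> m \<otimes>\<^bsub>A\<^esub> a"
proof -
  interpret J: ideal JE FE by (rule ideal_JE)
  have sub: "JE \<subseteq> env_annihilator A"
    using ideal_env_annihilator[OF A] bilinearity_relations_env_annihilator[OF A] by (auto simp: genideal_def)
  have p: "(a, b) \<in> carrier A \<times> carrier A" using assms by simp
  have "env_act A g m = b \<otimes>\<^bsub>A\<^esub> m \<otimes>\<^bsub>A\<^esub> a" if g: "g \<in> tens A a b" for g
  proof -
    obtain i where i: "i \<in> JE" "g = i \<oplus>\<^bsub>FE\<^esub> basis_elem (a, b)"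
      using g unfolding tens_eq a_r_coset_def' by blast
    hence "i \<in> carrier FE" "env_act A i m = \<zero>\<^bsub>A\<^esub>" using sub assms by (auto simp: env_annihilator_def[OF A])
    thus ?thesis using i assms p
      by (simp add: env_act_add[OF A] basis_FE env_act_basis[OF A p] sandwich_def[OF A] A.m_closed)
  qed
  moreover have "basis_elem (a, b) \<in> tens A a b"
    unfolding tens_eq by (rule J.a_rcos_self[OF basis_FE]) (use assms in auto)
  ultimately have "(\<lambda>f. env_act A f m) ` tens A a b = {b \<otimes>\<^bsub>A\<^esub> m \<otimes>\<^bsub>A\<^esub> a}"
    by (intro subset_antisym subsetI) (auto intro: rev_image_eqI)
  thus ?thesis by (simp add: bimodule_of_alg_def env_act_def[OF A] sandwich_def[OF A])
qed

end

text \<open>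
  The index \<open>(a, i, c, b, j, d)\<close> stands for \<open>x\<^sup>a X\<^sub>i x\<^sup>c \<otimes> y\<^sup>b Y\<^sub>j y\<^sup>d\<close> in the twisted tensor product
  of the periodic bimodule resolutions, with generators \<open>X\<^sub>i\<close> and \<open>Y\<^sub>j\<close>, of \<open>k[x]/(x\<^sup>2)\<close> and
  \<open>k[y]/(y\<^sup>2)\<close>. Here \<open>x\<^sup>a X\<^sub>i x\<^sup>c\<close> has degree \<open>a + i + c\<close>, and moving a \<open>y\<close> to the right past an
  element of degree \<open>n\<close> costs the factor \<open>t\<^sup>n\<close>.
\<close>

type_synonym kidx = "bool \<times> nat \<times> bool \<times> bool \<times> nat \<times> bool"

definition Lx :: "(kidx \<Rightarrow> 'k::field) \<Rightarrow> kidx \<Rightarrow> 'k"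
  where "Lx v = (\<lambda>(a, i, c, b, j, d). if a then v (False, i, c, b, j, d) else 0)"

definition Ly :: "'k \<Rightarrow> (kidx \<Rightarrow> 'k::field) \<Rightarrow> kidx \<Rightarrow> 'k"
  where "Ly t v = (\<lambda>(a, i, c, b, j, d).
    if b then t ^ (of_bool a + i + of_bool c) * v (a, i, c, False, j, d) else 0)"

definition Rx :: "'k \<Rightarrow> (kidx \<Rightarrow> 'k::field) \<Rightarrow> kidx \<Rightarrow> 'k"
  where "Rx t v = (\<lambda>(a, i, c, b, j, d).
    if c then t ^ (of_bool b + j + of_bool d) * v (a, i, False, b, j, d) else 0)"

definition Ry :: "(kidx \<Rightarrow> 'k::field) \<Rightarrow> kidx \<Rightarrow> 'k"
  where "Ry v = (\<lambda>(a, i, c, b, j, d). if d then v (a, i, c, b, j, False) else 0)"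

lemmas op_defs = Lx_def Ly_def Rx_def Ry_def

definition left_act :: "'k \<Rightarrow> (bool \<times> bool \<Rightarrow> 'k) \<Rightarrow> (kidx \<Rightarrow> 'k::field) \<Rightarrow> kidx \<Rightarrow> 'k"
  where "left_act t c v = (\<lambda>m. c (False, False) * v m + c (True, False) * Lx v m +
    c (False, True) * Ly t v m + c (True, True) * Lx (Ly t v) m)"

text \<open>From the right, xy acts by x first and then by y, the reverse of the order in
  \<open>left_act\<close>.\<close>

definition right_act :: "'k \<Rightarrow> (bool \<times> bool \<Rightarrow> 'k) \<Rightarrow> (kidx \<Rightarrow> 'k::field) \<Rightarrow> kidx \<Rightarrow> 'k"
  where "right_act t c v = (\<lambda>m. c (False, False) * v m + c (True, False) * Rx t v m +
    c (False, True) * Ry v m + c (True, True) * Ry (Rx t v) m)"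

lemma left_act_mult: "left_act t (lmul t c d) v = left_act t c (left_act t d v)"
proof (rule ext, clarify)
  fix a i e b j f
  show "left_act t (lmul t c d) v (a, i, e, b, j, f) = left_act t c (left_act t d v) (a, i, e, b, j, f)"
    by (cases a; cases b)
       (simp_all add: left_act_def lmul_def xmul_def ymul_def op_defs algebra_simps)
qed

lemma right_act_mult: "right_act t (lmul t c d) v = right_act t d (right_act t c v)"
proof (rule ext, clarify)
  fix a i e b j f
  show "right_act t (lmul t c d) v (a, i, e, b, j, f) = right_act t d (right_act t c v) (a, i, e, b, j, f)"
    by (cases e; cases f)
       (simp_all add: right_act_def lmul_def xmul_def ymul_def op_defs algebra_simps)
qed

text \<open>The case that matters is y from the left and x from the right: whichever acts second has
  to pass the letter just added, and this costs one extra t in both orders.\<close>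

lemma left_right_act: "left_act t c (right_act t d v) = right_act t d (left_act t c v)"
proof (rule ext, clarify)
  fix a i e b j f
  show "left_act t c (right_act t d v) (a, i, e, b, j, f) = right_act t d (left_act t c v) (a, i, e, b, j, f)"
    by (cases a; cases b; cases e; cases f)
       (simp_all add: left_act_def right_act_def op_defs algebra_simps power_add)
qed

lemma act_add:
  "left_act t c (\<lambda>m. u m + v m) = (\<lambda>m. left_act t c u m + left_act t c v m)"
  "right_act t c (\<lambda>m. u m + v m) = (\<lambda>m. right_act t c u m + right_act t c v m)"
  by (auto simp: fun_eq_iff left_act_def right_act_def op_defs algebra_simps)

lemma act_scale:
  "left_act t c (\<lambda>m. s * v m) = (\<lambda>m. s * left_act t c v m)"
  "right_act t c (\<lambda>m. s * v m) = (\<lambda>m. s * right_act t c v m)"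
  by (auto simp: fun_eq_iff left_act_def right_act_def op_defs algebra_simps)

lemma act_coord_add:
  "left_act t (\<lambda>m. c m + d m) v = (\<lambda>m. left_act t c v m + left_act t d v m)"
  "right_act t (\<lambda>m. c m + d m) v = (\<lambda>m. right_act t c v m + right_act t d v m)"
  by (auto simp: fun_eq_iff left_act_def right_act_def algebra_simps)

lemma act_coord_scale:
  "left_act t (\<lambda>m. s * c m) v = (\<lambda>m. s * left_act t c v m)"
  "right_act t (\<lambda>m. s * c m) v = (\<lambda>m. s * right_act t c v m)"
  by (auto simp: fun_eq_iff left_act_def right_act_def algebra_simps)

section \<open>The action of the enveloping algebra on the coordinates\<close>

context quantum_plane
begin

definition "bi_act p v = left_act t (coord (snd p)) (right_act t (coord (fst p)) v)"

sublocale B: monoid_rep "opposite_alg L \<times>\<times> L" bi_act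
proof (intro_locales)
  interpret op: k_algebra "opposite_alg L" by (rule k_algebra_opposite) (rule L.k_algebra_axioms)
  show "Group.monoid (opposite_alg L \<times>\<times> L)"
    by (intro DirProd_monoid op.monoid_axioms L.monoid_axioms)
  show "monoid_rep_axioms (opposite_alg L \<times>\<times> L) bi_act"
  proof
    fix g h v assume "g \<in> carrier (opposite_alg L \<times>\<times> L)" "h \<in> carrier (opposite_alg L \<times>\<times> L)"
    hence "fst g \<in> carrier L" "snd g \<in> carrier L" "fst h \<in> carrier L" "snd h \<in> carrier L"
      and "g \<otimes>\<^bsub>opposite_alg L \<times>\<times> L\<^esub> h = (fst h \<otimes>\<^bsub>L\<^esub> fst g, snd g \<otimes>\<^bsub>L\<^esub> snd h)"
      by (auto simp: DirProd_def opposite_alg_def)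
    thus "bi_act (g \<otimes>\<^bsub>opposite_alg L \<times>\<times> L\<^esub> h) v = bi_act g (bi_act h v)"
      by (simp add: bi_act_def coord_mult left_act_mult right_act_mult left_right_act)
  next
    have one: "\<one>\<^bsub>opposite_alg L\<^esub> = \<one>\<^bsub>L\<^esub>" by (simp add: opposite_alg_def)
    show "bi_act \<one>\<^bsub>opposite_alg L \<times>\<times> L\<^esub> v = v" for v
      by (auto simp: one bi_act_def coord_one left_act_def right_act_def basis_elem_def)
  qed (simp_all add: bi_act_def act_add act_scale)
qed

abbreviation "bilin \<equiv> bilinearity_relations (opposite_alg L) L"
abbreviation "E \<equiv> enveloping_alg L"

sublocale E: k_algebra E by (rule k_algebra_enveloping[OF L.k_algebra_axioms])

lemmas L_alg = L.k_algebra_axioms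

text \<open>Lets the action of pairs descend to the enveloping algebra. It holds because both
  one-sided actions are linear in the acting element as well as in the vector.\<close>

lemma bilin_kernel: "bilin \<subseteq> B.rep_kernel"
proof -
  have op: "carrier (opposite_alg L) = carrier L" "ring.add (opposite_alg L) = ring.add L" "module.smult (opposite_alg L) = module.smult L"
    by (simp_all add: opposite_alg_def)
  have b: "\<And>a b. a \<in> carrier L \<Longrightarrow> b \<in> carrier L \<Longrightarrow> basis_elem (a, b) \<in> carrier B.F"
    by (rule basis_FE[OF L_alg])
  have sub: "bilin \<subseteq> carrier B.F" by (intro bilinearity_relations_carrier k_algebra_opposite L_alg)
  have neg: "mact bi_act (f \<ominus>\<^bsub>B.F\<^esub> g) v = (\<lambda>i. mact bi_act f v i - mact bi_act g v i)"
    if "f \<in> carrier B.F" "g \<in> carrier B.F" for f g v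
  proof -
    have "mact bi_act (f \<ominus>\<^bsub>B.F\<^esub> g \<oplus>\<^bsub>B.F\<^esub> g) v = (\<lambda>i. mact bi_act (f \<ominus>\<^bsub>B.F\<^esub> g) v i + mact bi_act g v i)"
      using that by (intro B.mact_add) (auto simp: a_minus_def)
    moreover have "f \<ominus>\<^bsub>B.F\<^esub> g \<oplus>\<^bsub>B.F\<^esub> g = f" using that by (simp add: a_minus_def B.F.a_assoc B.F.l_neg)
    ultimately show ?thesis by (simp add: fun_eq_iff)
  qed
  have "mact bi_act f v = (\<lambda>i. 0)" if "f \<in> bilin" for f v
    using that unfolding bilinearity_relations_def Let_def op
    by (auto simp: neg b B.mact_add B.mact_smult B.mact_basis B.F.smult_closed B.F.a_closed L.smult_closed
        bi_act_def coord_add coord_smult act_coord_add act_coord_scale act_add act_scale)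
  thus ?thesis using sub by (auto simp: B.rep_kernel_def)
qed

lemma E_eq: "E = B.Q bilin" by (rule env_eq[OF L_alg])

lemmas E_qact = B.qact_add[OF bilin_kernel, folded E_eq] B.qact_mult[OF bilin_kernel, folded E_eq]
  B.qact_one[OF bilin_kernel, folded E_eq] B.qact_zero[OF bilin_kernel, folded E_eq]
  B.qact_vadd[OF bilin_kernel, folded E_eq] 

abbreviation "act \<equiv> qact bi_act"

lemma act_tens:
  "a \<in> carrier L \<Longrightarrow> b \<in> carrier L \<Longrightarrow> act (tens L a b) v = left_act t (coord b) (right_act t (coord a) v)"
  by (simp add: tens_eq[OF L_alg] B.qact_coset[OF bilin_kernel] basis_FE[OF L_alg] B.mact_basis bi_act_def)

end

section \<open>The resolution\<close>

text \<open>
  The total differential \<open>d \<otimes> 1 + (-1)\<^sup>i 1 \<otimes> d\<close>, where \<open>d X\<^sub>i\<^sub>+\<^sub>1 = x X\<^sub>i + (-1)\<^sup>i\<^sup>+\<^sup>1 X\<^sub>i x\<close> and likewise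
  for \<open>Y\<^sub>j\<close>, written as an operation on coordinates.
\<close>

definition kdiff :: "(kidx \<Rightarrow> 'k::field) \<Rightarrow> kidx \<Rightarrow> 'k"
  where "kdiff v = (\<lambda>(a, i, c, b, j, d).
    (if a then v (False, Suc i, c, b, j, d) else 0) -
    (if c then (-1) ^ i * v (a, Suc i, False, b, j, d) else 0) +
    (if b then (-1) ^ i * v (a, i, c, False, Suc j, d) else 0) -
    (if d then (-1) ^ (i + j) * v (a, i, c, b, Suc j, False) else 0))"

text \<open>
  With \<open>s\<close> the contracting homotopy \<open>x X\<^sub>i x\<^sup>c \<mapsto> X\<^sub>i\<^sub>+\<^sub>1 x\<^sup>c\<close>, \<open>X\<^sub>i x\<^sup>c \<mapsto> 0\<close> of one factor, this is
  \<open>s \<otimes> 1 + \<pi> \<otimes> s\<close> for the projection \<open>\<pi>\<close> with \<open>x\<^sup>a X\<^sub>0 x\<^sup>c \<mapsto> X\<^sub>0 x\<^sup>a\<^sup>+\<^sup>c\<close>.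
\<close>

definition khomotopy :: "(kidx \<Rightarrow> 'k::field) \<Rightarrow> kidx \<Rightarrow> 'k"
  where "khomotopy v = (\<lambda>(a, i, c, b, j, d). if a then 0 else
    (case i of Suc i' \<Rightarrow> v (True, i', c, b, j, d)
     | 0 \<Rightarrow> if b then 0 else
       (case j of 0 \<Rightarrow> 0
        | Suc j' \<Rightarrow> if c then v (False, 0, True, True, j', d) + v (True, 0, False, True, j', d)
            else v (False, 0, False, True, j', d))))"

definition fold_mul :: "(bool \<Rightarrow> bool \<Rightarrow> 'k::field) \<Rightarrow> bool \<Rightarrow> 'k"
  where "fold_mul f a = (if a then f True False + f False True else f False False)"

definition kaug :: "(kidx \<Rightarrow> 'k::field) \<Rightarrow> bool \<times> bool \<Rightarrow> 'k"
  where "kaug v = (\<lambda>(a, b). fold_mul (\<lambda>a c. fold_mul (\<lambda>b d. v (a, 0, c, b, 0, d)) b) a)"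

definition kunit :: "(bool \<times> bool \<Rightarrow> 'k::field) \<Rightarrow> kidx \<Rightarrow> 'k"
  where "kunit l = (\<lambda>(a, i, c, b, j, d). if \<not> a \<and> i = 0 \<and> \<not> b \<and> j = 0 then l (c, d) else 0)"

lemma kdiff_kdiff: "kdiff (kdiff v) = (\<lambda>m. 0)"
proof (rule ext, clarify)
  fix a i c b j d
  show "kdiff (kdiff v) (a, i, c, b, j, d) = 0"
    by (cases a; cases b; cases c; cases d) (simp_all add: kdiff_def algebra_simps power_add)
qed

lemma kaug_kdiff: "kaug (kdiff v) = (\<lambda>m. 0)"
  by (auto simp: kaug_def kdiff_def fold_mul_def fun_eq_iff)

lemma kaug_kunit: "kaug (kunit l) = l"
  by (auto simp: kaug_def kunit_def fold_mul_def fun_eq_iff)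

text \<open>Exactness in all degrees comes from this single identity over the field. Here
  \<open>kunit\<close> is a section of the augmentation, with values in the span of the elements X_0
  x^c \<otimes> Y_0 y^d.\<close>

lemma khomotopy:
  "kdiff (khomotopy v) m + khomotopy (kdiff v) m + kunit (kaug v) m = v m"
proof -
  obtain a i c b j d where m: "m = (a, i, c, b, j, d)" by (cases m)
  show ?thesis unfolding m
    by (cases i; cases j; cases a; cases b; cases c; cases d)
       (simp_all add: kdiff_def khomotopy_def kunit_def kaug_def fold_mul_def algebra_simps)
qed

lemma kdiff_lin:
  "kdiff (\<lambda>m. u m + v m) = (\<lambda>m. kdiff u m + kdiff v m)"
  "kdiff (\<lambda>m. s * v m) = (\<lambda>m. s * kdiff v m)"
  by (auto simp: fun_eq_iff kdiff_def algebra_simps)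

lemma kaug_lin:
  "kaug (\<lambda>m. u m + v m) = (\<lambda>m. kaug u m + kaug v m)"
  "kaug (\<lambda>m. s * v m) = (\<lambda>m. s * kaug v m)"
  by (auto simp: fun_eq_iff kaug_def fold_mul_def algebra_simps)

text \<open>Although \<open>kdiff\<close> does not involve t, it is compatible with the twisted
  operations: each of its terms preserves the degrees a + i + c and b + j + d that govern the powers
  of t.\<close>

lemma kdiff_ops:
  "kdiff (Lx v) = Lx (kdiff v)" "kdiff (Ly t v) = Ly t (kdiff v)"
  "kdiff (Rx t v) = Rx t (kdiff v)" "kdiff (Ry v) = Ry (kdiff v)"
  by (auto simp: fun_eq_iff kdiff_def op_defs algebra_simps)

lemma kdiff_act: "kdiff (left_act t c v) = left_act t c (kdiff v)" "kdiff (right_act t c v) = right_act t c (kdiff v)"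
  unfolding left_act_def right_act_def by (simp_all add: kdiff_lin kdiff_ops)

lemma kaug_act:
  "kaug (left_act t c v) = lmul t c (kaug v)" "kaug (right_act t c v) = lmul t (kaug v) c"
  by (auto simp: fun_eq_iff kaug_def fold_mul_def left_act_def right_act_def lmul_def xmul_def ymul_def op_defs algebra_simps)

section \<open>Homogeneous components and their generators\<close>

definition homog :: "nat \<Rightarrow> (kidx \<Rightarrow> 'k::field) set"
  where "homog n = {v. \<forall>a i c b j d. i + j \<noteq> n \<longrightarrow> v (a, i, c, b, j, d) = 0}"

lemma homog_lin: "u \<in> homog n \<Longrightarrow> v \<in> homog n \<Longrightarrow> (\<lambda>m. u m + v m) \<in> homog n"
  "v \<in> homog n \<Longrightarrow> (\<lambda>m. s * v m) \<in> homog n" "(\<lambda>m. 0) \<in> homog n"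
  by (auto simp: homog_def)

lemma homog_act: "v \<in> homog n \<Longrightarrow> left_act t c v \<in> homog n" "v \<in> homog n \<Longrightarrow> right_act t c v \<in> homog n"
  by (auto simp: homog_def left_act_def right_act_def op_defs)

lemma homog_kdiff: "v \<in> homog (Suc n) \<Longrightarrow> kdiff v \<in> homog n" "v \<in> homog 0 \<Longrightarrow> kdiff v = (\<lambda>m. 0)"
  by (auto simp: homog_def kdiff_def fun_eq_iff)

lemma homog_khomotopy: "v \<in> homog n \<Longrightarrow> khomotopy v \<in> homog (Suc n)"
  by (auto simp: homog_def khomotopy_def split: nat.splits)

lemma homog_kunit: "kunit l \<in> homog 0"
  by (auto simp: homog_def kunit_def)

lemma khomotopy_zero: "khomotopy (\<lambda>m. 0) = (\<lambda>m. 0)"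
  by (auto simp: khomotopy_def fun_eq_iff split: nat.splits)

lemma kunit_zero: "kunit (\<lambda>m. 0) = (\<lambda>m. 0)"
  by (auto simp: kunit_def fun_eq_iff)

definition gen :: "nat \<Rightarrow> nat \<Rightarrow> kidx \<Rightarrow> 'k::field"
  where "gen i j = basis_elem (False, i, False, False, j, False)"

lemma gen_eq_iff: "gen i j = (gen i' j' :: _ \<Rightarrow> 'k::field) \<longleftrightarrow> i = i' \<and> j = j'"
proof
  assume "gen i j = (gen i' j' :: _ \<Rightarrow> 'k)"
  from fun_cong[OF this, of "(False, i, False, False, j, False)"] show "i = i' \<and> j = j'"
    by (auto simp: gen_def basis_elem_def split: if_splits)
qed auto

lemma gen_homog: "i + j = n \<Longrightarrow> gen i j \<in> homog n"
  by (auto simp: homog_def gen_def basis_elem_def)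

section \<open>The components as free modules over the enveloping algebra\<close>

context quantum_plane
begin

lemmas E_induct [consumes 1, case_names zero add] = env_induct[OF L_alg]

definition kmod :: "nat \<Rightarrow> (((letter list \<Rightarrow> 'k) set \<times> (letter list \<Rightarrow> 'k) set \<Rightarrow> 'k) set, kidx \<Rightarrow> 'k) module"
  where "kmod n =
  \<lparr>carrier = homog n, monoid.mult = (\<lambda>u v. u), monoid.one = (\<lambda>m. 0), ring.zero = (\<lambda>m. 0),
   ring.add = (\<lambda>u v m. u m + v m), module.smult = act\<rparr>"

lemma kmod_simps [simp]: "carrier (kmod n) = homog n" "\<zero>\<^bsub>kmod n\<^esub> = (\<lambda>m. 0)"
  "u \<oplus>\<^bsub>kmod n\<^esub> v = (\<lambda>m. u m + v m)" "\<xi> \<odot>\<^bsub>kmod n\<^esub> v = act \<xi> v"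
  by (simp_all add: kmod_def)

lemma act_homog: "\<xi> \<in> carrier E \<Longrightarrow> v \<in> homog n \<Longrightarrow> act \<xi> v \<in> homog n"
proof (induction rule: E_induct)
  case (add a b \<xi>)
  thus ?case
    by (simp add: E_qact act_tens tens_closed[OF L_alg] homog_lin homog_act)
qed (simp add: E_qact homog_lin)

lemma left_module_kmod: "left_module E (kmod n)"
proof -
  interpret K: abelian_group "kmod n"
  proof (rule abelian_groupI)
    fix u assume "u \<in> carrier (kmod n)"
    thus "\<exists>v\<in>carrier (kmod n). v \<oplus>\<^bsub>kmod n\<^esub> u = \<zero>\<^bsub>kmod n\<^esub>"
      using homog_lin(2)[of u n "-1"] by (intro bexI[of _ "\<lambda>m. -1 * u m"]) simp_all
  qed (simp_all add: homog_lin algebra_simps)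
  show ?thesis
    by unfold_locales (simp_all add: act_homog E_qact)
qed

lemma finsum_kmod:
  assumes "finite S" "h \<in> S \<rightarrow> homog n"
  shows "(\<Oplus>\<^bsub>kmod n\<^esub>s\<in>S. h s) = (\<lambda>m. \<Sum>s\<in>S. h s m)"
proof -
  interpret K: left_module E "kmod n" by (rule left_module_kmod)
  show ?thesis using assms
  proof (induction S rule: finite_induct)
    case empty
    have "(\<Oplus>\<^bsub>kmod n\<^esub>s\<in>{}. h s) = \<zero>\<^bsub>kmod n\<^esub>" by simp
    thus ?case by simp
  next
    case (insert s S)
    have "(\<Oplus>\<^bsub>kmod n\<^esub>s\<in>insert s S. h s) = h s \<oplus>\<^bsub>kmod n\<^esub> (\<Oplus>\<^bsub>kmod n\<^esub>s\<in>S. h s)"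
      using insert by (intro K.M.finsum_insert) (auto simp: Pi_iff)
    thus ?case using insert by (simp add: Pi_iff)
  qed
qed

text \<open>In the normal form \<open>env_elt u\<close>, the number \<open>u m l\<close> is the
  coefficient of the tensor whose left-acting factor is the basis element m and whose right-acting
  factor is the basis element l.\<close>

definition "env_part u a b = tens L (elt (u (a, b))) (elt (basis_elem (a, b)))"

definition "env_elt u = env_part u False False \<oplus>\<^bsub>E\<^esub> env_part u True False \<oplus>\<^bsub>E\<^esub>
  (env_part u False True \<oplus>\<^bsub>E\<^esub> env_part u True True)"

lemma env_part_closed [simp]: "env_part u a b \<in> carrier E"
  by (simp add: env_part_def tens_closed[OF L_alg])

lemma env_elt_closed [simp]: "env_elt u \<in> carrier E"
  by (simp add: env_elt_def)

lemma env_elt_add: "env_elt u \<oplus>\<^bsub>E\<^esub> env_elt v = env_elt (\<lambda>m l. u m l + v m l)"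
proof -
  have "env_part u a b \<oplus>\<^bsub>E\<^esub> env_part v a b = env_part (\<lambda>m l. u m l + v m l) a b" for a b
    by (simp add: env_part_def tens_add_left[OF L_alg, symmetric] elt_add)
  hence eq: "env_part (\<lambda>m l. u m l + v m l) a b = env_part u a b \<oplus>\<^bsub>E\<^esub> env_part v a b" for a b by simp
  show ?thesis unfolding env_elt_def eq by (simp add: E.a_ac)
qed

lemma env_elt_zero: "env_elt (\<lambda>m l. 0) = \<zero>\<^bsub>E\<^esub>"
proof -
  have "env_part (\<lambda>m l. 0) a b = 0 \<odot>\<^bsub>E\<^esub> tens L \<zero>\<^bsub>L\<^esub> (elt (basis_elem (a, b)))" for a b
    by (subst tens_smult_left[OF L_alg, symmetric]) (simp_all add: env_part_def elt_zero)
  thus ?thesis by (simp add: env_elt_def tens_closed[OF L_alg])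
qed

lemma tens_env_elt:
  assumes "a \<in> carrier L" "b \<in> carrier L"
  shows "tens L a b = env_elt (\<lambda>m l. coord b m * coord a l)"
proof -
  let ?e = "\<lambda>m. elt (\<lambda>l. coord b m * basis_elem m l)"
  have "b = ?e (False, False) \<oplus>\<^bsub>L\<^esub> ?e (True, False) \<oplus>\<^bsub>L\<^esub> (?e (False, True) \<oplus>\<^bsub>L\<^esub> ?e (True, True))"
    using assms by (intro coord_eqI) (auto simp: elt_add basis_elem_def)
  hence "tens L a b = tens L a (?e (False, False) \<oplus>\<^bsub>L\<^esub> ?e (True, False) \<oplus>\<^bsub>L\<^esub> (?e (False, True) \<oplus>\<^bsub>L\<^esub> ?e (True, True)))"
    by simp
  also have "\<dots> = tens L a (?e (False, False)) \<oplus>\<^bsub>E\<^esub> tens L a (?e (True, False)) \<oplus>\<^bsub>E\<^esub> 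
     (tens L a (?e (False, True)) \<oplus>\<^bsub>E\<^esub> tens L a (?e (True, True)))"
    using assms by (simp add: tens_add_right[OF L_alg] del: elt_add)
  also have "\<dots> = env_elt (\<lambda>m l. coord b m * coord a l)"
  proof -
    have "tens L a (?e (i, j)) = env_part (\<lambda>m l. coord b m * coord a l) i j" for i j
      using assms by (simp add: env_part_def elt_smult[symmetric] tens_smult_left[OF L_alg] tens_smult_right[OF L_alg])
    thus ?thesis by (simp add: env_elt_def)
  qed
  finally show ?thesis .
qed

lemma env_elt_surj: "\<xi> \<in> carrier E \<Longrightarrow> \<exists>u. \<xi> = env_elt u"
proof (induction rule: E_induct)
  case zero thus ?case by (intro exI[of _ "\<lambda>m l. 0"]) (simp add: env_elt_zero)
next
  case (add a b \<xi>)
  then obtain u where "\<xi> = env_elt u" by blast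
  hence "tens L a b \<oplus>\<^bsub>E\<^esub> \<xi> = env_elt (\<lambda>m l. coord b m * coord a l + u m l)"
    using add by (simp add: tens_env_elt env_elt_add)
  thus ?case by blast
qed

text \<open>Coefficients reappear as coordinates up to powers of t: t^(cj) for x^c passing Y_j, then
  t^(b(i + c)) for y^b passing X_i x^c. As t is nonzero, each generator freely spans its bidegree,
  which the following lemmas extract.\<close>

lemma act_env_elt:
  "act (env_elt u) (gen i j) (a, i', c, b, j', d) =
    (if i' = i \<and> j' = j then t ^ (of_bool b * (i + of_bool c) + of_bool c * j) * u (a, b) (c, d) else 0)"
  by (cases a; cases b; cases c; cases d)
     (simp_all add: env_elt_def env_part_def E_qact tens_closed[OF L_alg] act_tens left_act_def right_act_def op_defs
        gen_def basis_elem_def power_add)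

lemma act_gen_inj:
  assumes "\<xi> \<in> carrier E" "\<eta> \<in> carrier E" "act \<xi> (gen i j) = act \<eta> (gen i j)"
  shows "\<xi> = \<eta>"
proof -
  obtain u v where u: "\<xi> = env_elt u" "\<eta> = env_elt v" using assms env_elt_surj by blast
  have "u (a, b) (c, d) = v (a, b) (c, d)" for a b c d
    using fun_cong[OF assms(3), of "(a, i, c, b, j, d)"] t_nz by (simp add: u act_env_elt)
  hence "u = v" by (auto simp: fun_eq_iff)
  thus ?thesis by (simp add: u)
qed

lemma act_gen_surj:
  "\<exists>\<xi>\<in>carrier E. act \<xi> (gen i j) = (\<lambda>(a, i', c, b, j', d). if i' = i \<and> j' = j then v (a, i', c, b, j', d) else 0)"
  by (rule bexI[of _ "env_elt (\<lambda>(a, b) (c, d). v (a, i, c, b, j, d) / t ^ (of_bool b * (i + of_bool c) + of_bool c * j))"])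
     (auto simp: fun_eq_iff act_env_elt t_nz)

lemma act_gen_outside:
  assumes "\<xi> \<in> carrier E" "i' \<noteq> i \<or> j' \<noteq> j"
  shows "act \<xi> (gen i j) (a, i', c, b, j', d) = 0"
  using env_elt_surj[OF assms(1)] assms(2) by (auto simp: act_env_elt)

definition "gens n = (\<lambda>i. gen i (n - i) :: kidx \<Rightarrow> 'k) ` {..n}"

lemma gens_iff: "w \<in> gens n \<longleftrightarrow> (\<exists>i j. i + j = n \<and> w = gen i j)"
  by (auto simp: gens_def image_iff intro: le_add_diff_inverse) (metis add_diff_cancel_left' atMost_iff le_add1)

text \<open>Distinct generators occupy distinct bidegrees, so a combination can be compared with v
  one bidegree at a time; \<open>act_gen_surj\<close> and \<open>act_gen_inj\<close> then give
  existence and uniqueness of each coefficient.\<close>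

lemma free_on_kmod: "free_on E (kmod n) (gens n)"
proof -
  interpret K: left_module E "kmod n" by (rule left_module_kmod)
  have fin: "finite (gens n)" by (simp add: gens_def)
  have sub: "gens n \<subseteq> homog n" using gen_homog by (auto simp: gens_iff)
  have val: "(\<Oplus>\<^bsub>kmod n\<^esub>w\<in>{w \<in> gens n. f w \<noteq> \<zero>\<^bsub>E\<^esub>}. f w \<odot>\<^bsub>kmod n\<^esub> w) (a, i, c, b, j, d) =
      act (f (gen i j)) (gen i j) (a, i, c, b, j, d)"
    if f: "f \<in> gens n \<rightarrow>\<^sub>E carrier E" and ij: "i + j = n" for f a i c b j d
  proof -
    let ?m = "(a, i, c, b, j, d)" and ?S = "{w \<in> gens n. f w \<noteq> \<zero>\<^bsub>E\<^esub>}"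
    have fc: "w \<in> gens n \<Longrightarrow> f w \<in> carrier E" for w using f by auto
    have "(\<Oplus>\<^bsub>kmod n\<^esub>w\<in>?S. f w \<odot>\<^bsub>kmod n\<^esub> w) ?m = (\<Sum>w\<in>?S. act (f w) w ?m)"
      using fin sub fc by (subst finsum_kmod) (auto intro!: act_homog)
    also have "\<dots> = (\<Sum>w\<in>gens n. act (f w) w ?m)"
      by (rule sum.mono_neutral_left) (use fin in \<open>auto simp: E_qact\<close>)
    also have "\<dots> = (\<Sum>w\<in>{gen i j}. act (f w) w ?m)"
    proof (rule sum.mono_neutral_right)
      show "{gen i j} \<subseteq> gens n" using ij by (auto simp: gens_iff)
      show "\<forall>w\<in>gens n - {gen i j}. act (f w) w ?m = 0"
      proof
        fix w assume w: "w \<in> gens n - {gen i j}"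
        then obtain i' j' where w': "w = gen i' j'" by (auto simp: gens_iff)
        hence "i \<noteq> i' \<or> j \<noteq> j'" using w by auto
        thus "act (f w) w ?m = 0" using w fc unfolding w' by (intro act_gen_outside) auto
      qed
    qed (rule fin)
    finally show ?thesis by simp
  qed
  show ?thesis unfolding free_on_def
  proof (intro conjI ballI)
    show "gens n \<subseteq> carrier (kmod n)" using sub by simp
    fix v assume v: "v \<in> carrier (kmod n)"
    let ?Q = "\<lambda>f. f \<in> gens n \<rightarrow>\<^sub>E carrier E \<and> finite {w \<in> gens n. f w \<noteq> \<zero>\<^bsub>E\<^esub>} \<and>
      v = (\<Oplus>\<^bsub>kmod n\<^esub>w\<in>{w \<in> gens n. f w \<noteq> \<zero>\<^bsub>E\<^esub>}. f w \<odot>\<^bsub>kmod n\<^esub> w)"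
    have Q: "?Q f \<longleftrightarrow> (f \<in> gens n \<rightarrow>\<^sub>E carrier E \<and>
      (\<forall>a i c b j d. i + j = n \<longrightarrow> v (a, i, c, b, j, d) = act (f (gen i j)) (gen i j) (a, i, c, b, j, d)))" for f
    proof (cases "f \<in> gens n \<rightarrow>\<^sub>E carrier E")
      case True
      let ?s = "(\<Oplus>\<^bsub>kmod n\<^esub>w\<in>{w \<in> gens n. f w \<noteq> \<zero>\<^bsub>E\<^esub>}. f w \<odot>\<^bsub>kmod n\<^esub> w)"
      have "?s \<in> carrier (kmod n)"
        by (rule K.M.finsum_closed) (use True sub in \<open>auto intro!: act_homog\<close>)
      hence s: "?s \<in> homog n" by simp
      have "v = ?s \<longleftrightarrow> (\<forall>a i c b j d. i + j = n \<longrightarrow> v (a, i, c, b, j, d) = ?s (a, i, c, b, j, d))"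
      proof
        assume h: "\<forall>a i c b j d. i + j = n \<longrightarrow> v (a, i, c, b, j, d) = ?s (a, i, c, b, j, d)"
        show "v = ?s"
        proof (rule ext, clarify)
          fix a i c b j d
          show "v (a, i, c, b, j, d) = ?s (a, i, c, b, j, d)"
            using h s v by (cases "i + j = n") (simp_all add: homog_def)
        qed
      qed simp
      thus ?thesis using True fin by (simp add: val del: kmod_simps)
    qed auto
    have "\<exists>f. ?Q f"
    proof -
      have "\<forall>w\<in>gens n. \<exists>\<xi>. \<xi> \<in> carrier E \<and> (\<forall>i j a c b d. w = gen i j \<longrightarrow> v (a, i, c, b, j, d) = act \<xi> w (a, i, c, b, j, d))"
      proof
        fix w assume "w \<in> gens n"
        then obtain i j where w: "w = gen i j" by (auto simp: gens_iff)
        obtain \<xi> where "\<xi> \<in> carrier E" "act \<xi> (gen i j) = (\<lambda>(a, i', c, b, j', d). if i' = i \<and> j' = j then v (a, i', c, b, j', d) else 0)"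
          using act_gen_surj by blast
        thus "\<exists>\<xi>. \<xi> \<in> carrier E \<and> (\<forall>i j a c b d. w = gen i j \<longrightarrow> v (a, i, c, b, j, d) = act \<xi> w (a, i, c, b, j, d))"
          by (intro exI[of _ \<xi>]) (auto simp: w gen_eq_iff)
      qed
      then obtain f where f: "\<And>w. w \<in> gens n \<Longrightarrow> f w \<in> carrier E"
        "\<And>w i j a c b d. w \<in> gens n \<Longrightarrow> w = gen i j \<Longrightarrow> v (a, i, c, b, j, d) = act (f w) w (a, i, c, b, j, d)" 
        by metis
      have "?Q (restrict f (gens n))" unfolding Q
        using f by (auto simp: gens_iff)
      thus ?thesis by blast
    qed
    moreover have "f = g" if f: "?Q f" and g: "?Q g" for f g
    proof (rule PiE_ext)
      show fE: "f \<in> gens n \<rightarrow>\<^sub>E carrier E" and gE: "g \<in> gens n \<rightarrow>\<^sub>E carrier E" using f g by auto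
      fix w assume w: "w \<in> gens n"
      then obtain i j where ij: "w = gen i j" "i + j = n" by (auto simp: gens_iff)
      have c: "f w \<in> carrier E" "g w \<in> carrier E" using w fE gE by auto
      have "act (f w) w m = act (g w) w m" for m
      proof -
        obtain a i' c' b j' d where m: "m = (a, i', c', b, j', d)" by (cases m)
        show ?thesis
        proof (cases "i' = i \<and> j' = j")
          case True
          thus ?thesis using f g ij unfolding Q m by metis
        next
          case False
          thus ?thesis using c unfolding m ij by (simp add: act_gen_outside)
        qed
      qed
      thus "f w = g w" using c unfolding ij by (intro act_gen_inj[of _ _ i j]) auto
    qed
    ultimately show "\<exists>!f. ?Q f" by blast
  qed
qed

abbreviation "N \<equiv> bimodule_of_alg L"

lemma N_simps [simp]: "carrier N = carrier L" "\<zero>\<^bsub>N\<^esub> = \<zero>\<^bsub>L\<^esub>" "x \<oplus>\<^bsub>N\<^esub> y = x \<oplus>\<^bsub>L\<^esub> y"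
  by (simp_all add: bimodule_of_alg_def)

lemma left_module_N: "left_module E N" by (rule left_module_bimodule_of_alg[OF L_alg])

lemma kdiff_E_act:
  assumes "\<xi> \<in> carrier E" shows "kdiff (act \<xi> v) = act \<xi> (kdiff v)"
  using assms
proof (induction rule: E_induct)
  case zero show ?case using kdiff_lin(2)[of 0 "\<lambda>m. 0"] by (simp add: E_qact)
next
  case (add a b \<xi>)
  thus ?case by (simp add: E_qact tens_closed[OF L_alg] act_tens kdiff_lin kdiff_act)
qed

lemma kaug_E_act:
  assumes "\<xi> \<in> carrier E" shows "elt (kaug (act \<xi> v)) = \<xi> \<odot>\<^bsub>N\<^esub> elt (kaug v)"
  using assms
proof (induction rule: E_induct)
  interpret N: left_module E N by (rule left_module_N)
  {
    case zero
    have "kaug (\<lambda>m. 0 :: 'k) = (\<lambda>m. 0)" using kaug_lin(2)[of 0 "\<lambda>m. 0"] by simp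
    thus ?case using N.smult_null_l[of "elt (kaug v)"] by (simp add: E_qact elt_zero)
  next
    case (add a b \<xi>)
    have "elt (kaug (act (tens L a b) v)) = tens L a b \<odot>\<^bsub>N\<^esub> elt (kaug v)"
      unfolding tens_bimodule[OF L_alg add(1,2) elt_carrier] using add
      by (intro coord_eqI) (simp_all add: act_tens kaug_act coord_mult left_right_act)
    moreover have "elt (kaug (act (tens L a b \<oplus>\<^bsub>E\<^esub> \<xi>) v)) = elt (kaug (act (tens L a b) v)) \<oplus>\<^bsub>L\<^esub> elt (kaug (act \<xi> v))"
      using add(1-3) by (simp add: E_qact tens_closed[OF L_alg] kaug_lin elt_add)
    ultimately show ?case using add N.smult_l_distr[of "tens L a b" \<xi> "elt (kaug v)"]
      by (simp add: tens_closed[OF L_alg])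
  }
qed

definition "kd n = restrict kdiff (homog (Suc n))"
definition "ke = restrict (\<lambda>v. elt (kaug v)) (homog 0)"

text \<open>For a cycle v the identity \<open>khomotopy\<close> collapses to v =
  \<open>kdiff (khomotopy v)\<close>. In degree 0 the term with \<open>kdiff v\<close> vanishes by
  degree, and the one with \<open>kaug v\<close> because v lies in the kernel of the
  augmentation.\<close>

lemma free_resolution_kmod: "free_resolution E N kmod kd ke"
  unfolding free_resolution_def
proof (intro conjI allI)
  show "free_left_module E (kmod n)" for n
    using left_module_kmod free_on_kmod by (auto simp: free_left_module_iff)
  have "restrict (\<lambda>v. elt (kaug v)) (carrier (kmod 0)) \<in> left_module_hom E (kmod 0) N"
    by (rule left_module_homI[OF _ _ _ left_module_kmod]) (simp_all add: kaug_lin elt_add kaug_E_act)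
  thus "ke \<in> left_module_hom E (kmod 0) N" by (simp add: ke_def)
  show "kd n \<in> left_module_hom E (kmod (Suc n)) (kmod n)" for n
  proof -
    have "restrict kdiff (carrier (kmod (Suc n))) \<in> left_module_hom E (kmod (Suc n)) (kmod n)"
      by (rule left_module_homI[OF _ _ _ left_module_kmod]) (simp_all add: kdiff_lin homog_kdiff kdiff_E_act)
    thus ?thesis by (simp add: kd_def)
  qed
  show "ke ` carrier (kmod 0) = carrier N"
  proof
    show "carrier N \<subseteq> ke ` carrier (kmod 0)"
    proof
      fix U assume "U \<in> carrier N"
      hence "U = ke (kunit (coord U))" by (simp add: ke_def homog_kunit kaug_kunit)
      thus "U \<in> ke ` carrier (kmod 0)" using homog_kunit by auto
    qed
  qed (auto simp: ke_def)
  show "kd 0 ` carrier (kmod 1) = {x \<in> carrier (kmod 0). ke x = \<zero>\<^bsub>N\<^esub>}"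
  proof
    show "kd 0 ` carrier (kmod 1) \<subseteq> {x \<in> carrier (kmod 0). ke x = \<zero>\<^bsub>N\<^esub>}"
      by (auto simp: kd_def ke_def homog_kdiff kaug_kdiff elt_zero)
    show "{x \<in> carrier (kmod 0). ke x = \<zero>\<^bsub>N\<^esub>} \<subseteq> kd 0 ` carrier (kmod 1)"
    proof clarify
      fix v assume v: "v \<in> carrier (kmod 0)" "ke v = \<zero>\<^bsub>N\<^esub>"
      hence "kaug v = (\<lambda>m. 0)" using coord_elt[of "kaug v"] by (simp add: ke_def)
      hence "v = kdiff (khomotopy v)"
        using khomotopy[of v] homog_kdiff(2)[of v] v by (intro ext) (simp add: khomotopy_zero kunit_zero)
      hence "v = kd 0 (khomotopy v)" using homog_khomotopy[of v 0] v by (simp add: kd_def)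
      thus "v \<in> kd 0 ` carrier (kmod 1)" using homog_khomotopy[of v 0] v by simp
    qed
  qed
  show "kd (Suc n) ` carrier (kmod (Suc (Suc n))) = {x \<in> carrier (kmod (Suc n)). kd n x = \<zero>\<^bsub>kmod n\<^esub>}" for n
  proof
    show "kd (Suc n) ` carrier (kmod (Suc (Suc n))) \<subseteq> {x \<in> carrier (kmod (Suc n)). kd n x = \<zero>\<^bsub>kmod n\<^esub>}"
      by (auto simp: kd_def homog_kdiff kdiff_kdiff)
    show "{x \<in> carrier (kmod (Suc n)). kd n x = \<zero>\<^bsub>kmod n\<^esub>} \<subseteq> kd (Suc n) ` carrier (kmod (Suc (Suc n)))"
    proof clarify
      fix v assume v: "v \<in> carrier (kmod (Suc n))" "kd n v = \<zero>\<^bsub>kmod n\<^esub>"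
      hence "kdiff v = (\<lambda>m. 0)" "v \<in> homog (Suc n)" by (simp_all add: kd_def)
      \<comment> \<open>The augmentation reads only bidegree (0, 0), which is absent in positive
        total degree.\<close>
      moreover hence "kaug v = (\<lambda>m. 0)" by (auto simp: kaug_def fold_mul_def homog_def fun_eq_iff)
      ultimately have "v = kdiff (khomotopy v)"
        using khomotopy[of v] by (intro ext) (simp add: khomotopy_zero kunit_zero)
      hence "v = kd (Suc n) (khomotopy v)" using homog_khomotopy[of v "Suc n"] v by (simp add: kd_def)
      thus "v \<in> kd (Suc n) ` carrier (kmod (Suc (Suc n)))" using homog_khomotopy[of v "Suc n"] v by simp
    qed
  qed
qed

end

section \<open>The cohomology of \<open>\<Lambda> q\<close>\<close>

context quantum_plane
begin

abbreviation "\<delta>x \<equiv> basis_elem (True, False) :: bool \<times> bool \<Rightarrow> 'k"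
abbreviation "\<delta>y \<equiv> basis_elem (False, True) :: bool \<times> bool \<Rightarrow> 'k"

definition "two_sided c d v = left_act t c (right_act t d v)"

lemma two_sided_homog: "v \<in> homog n \<Longrightarrow> two_sided c d v \<in> homog n"
  by (simp add: two_sided_def homog_act)

text \<open>The summands of the boundaries of the generators of bidegrees \<open>(i + 1, j)\<close> and \<open>(i, j + 1)\<close>.\<close>

definition "x_part i j = (\<lambda>m. two_sided \<delta>x \<delta>\<^sub>1 (gen i j) m +
   two_sided \<delta>\<^sub>1 (\<lambda>l. (-1) ^ Suc i * inverse t ^ j * \<delta>x l) (gen i j) m)"

definition "y_part i j = (\<lambda>m. two_sided (\<lambda>l. (-1) ^ i * inverse t ^ i * \<delta>y l) \<delta>\<^sub>1 (gen i j) m +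
   two_sided \<delta>\<^sub>1 (\<lambda>l. (-1) ^ Suc (i + j) * \<delta>y l) (gen i j) m)"

lemmas part_defs = x_part_def y_part_def two_sided_def left_act_def right_act_def op_defs gen_def basis_elem_def

text \<open>Multiplying X_i \<otimes> Y_j by x from the right costs t^j, which the factor
  \<open>inverse t ^ j\<close> in \<open>x_part\<close> undoes. In \<open>y_part\<close>,
  \<open>inverse t ^ i\<close> does the same for y from the left.\<close>

lemma x_part_apply: "x_part i j (a, i', c, b, j', d) =
  (if i' = i \<and> j' = j \<and> \<not> b \<and> \<not> d then
     (if a \<and> \<not> c then 1 else 0) + (if c \<and> \<not> a then (-1) ^ Suc i else 0) else 0)"
  using t_nz by (cases a; cases b; cases c; cases d) (simp_all add: part_defs power_inverse)

lemma y_part_apply: "y_part i j (a, i', c, b, j', d) =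
  (if i' = i \<and> j' = j \<and> \<not> a \<and> \<not> c then
     (if b \<and> \<not> d then (-1) ^ i else 0) + (if d \<and> \<not> b then (-1) ^ Suc (i + j) else 0) else 0)"
  using t_nz by (cases a; cases b; cases c; cases d) (simp_all add: part_defs power_inverse)

lemma kdiff_gen:
  "kdiff (gen i j) = (\<lambda>m. (case i of 0 \<Rightarrow> 0 | Suc i' \<Rightarrow> x_part i' j m) + (case j of 0 \<Rightarrow> 0 | Suc j' \<Rightarrow> y_part i j' m))"
proof (rule ext, clarify)
  fix a i' c b j' d
  show "kdiff (gen i j) (a, i', c, b, j', d) = (case i of 0 \<Rightarrow> 0 | Suc i'' \<Rightarrow> x_part i'' j (a, i', c, b, j', d)) +
     (case j of 0 \<Rightarrow> 0 | Suc j'' \<Rightarrow> y_part i j'' (a, i', c, b, j', d))"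
    by (cases i; cases j; cases a; cases b; cases c; cases d)
       (simp_all add: kdiff_def gen_def basis_elem_def x_part_apply y_part_apply)
qed

text \<open>With m = y^b, \<alpha> is the scalar in x m - (-1)^i t^(-j) m x = \<alpha> x y^b, by y^b
  x = t^b x y^b. With m = x^a, \<beta> is the scalar in (-1)^i (t^(-i) y m - (-1)^j m y) = \<beta>
  x^a y, by y x^a = t^a x^a y.\<close>

definition "\<alpha> i j b = 1 - (-1) ^ i * inverse t ^ j * t ^ of_bool b"
definition "\<beta> i j a = (-1) ^ i * (inverse t ^ i * t ^ of_bool a - (-1) ^ j)"

text \<open>The differential of the Hom complex in coordinates, a cochain being represented by the
  coordinates \<open>G i j\<close> of its values on the generators \<open>gen i j\<close>.\<close>

definition cobdry :: "(nat \<Rightarrow> nat \<Rightarrow> bool \<times> bool \<Rightarrow> 'k) \<Rightarrow> nat \<Rightarrow> nat \<Rightarrow> bool \<times> bool \<Rightarrow> 'k"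
  where "cobdry G i j = (\<lambda>(a, b).
    (case i of 0 \<Rightarrow> 0 | Suc i' \<Rightarrow> if a then \<alpha> i' j b * G i' j (False, b) else 0) +
    (case j of 0 \<Rightarrow> 0 | Suc j' \<Rightarrow> if b then \<beta> i j' a * G i j' (a, False) else 0))"

lemma x_part_homog: "i + j = n \<Longrightarrow> x_part i j \<in> homog n" and y_part_homog: "i + j = n \<Longrightarrow> y_part i j \<in> homog n"
  unfolding x_part_def y_part_def by (intro homog_lin two_sided_homog gen_homog; simp)+

context
  fixes h n assumes h: "h \<in> left_module_hom E (kmod n) N"
begin

lemma hom_closed: "v \<in> homog n \<Longrightarrow> h v \<in> carrier L"
  using left_module_homD(1)[OF h] by simp

lemma coord_hom_add: "u \<in> homog n \<Longrightarrow> v \<in> homog n \<Longrightarrow> coord (h (\<lambda>m. u m + v m)) = (\<lambda>l. coord (h u) l + coord (h v) l)"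
  using left_module_homD(2)[OF h, of u v] by (simp add: coord_add hom_closed)

lemma coord_hom_two_sided:
  assumes "v \<in> homog n"
  shows "coord (h (two_sided c d v)) = lmul t (lmul t c (coord (h v))) d"
proof -
  have "h (act (tens L (elt d) (elt c)) v) = tens L (elt d) (elt c) \<odot>\<^bsub>N\<^esub> h v"
    using left_module_homD(3)[OF h, of "tens L (elt d) (elt c)" v] assms by (simp add: tens_closed[OF L_alg])
  also have "\<dots> = elt c \<otimes>\<^bsub>L\<^esub> h v \<otimes>\<^bsub>L\<^esub> elt d"
    by (rule tens_bimodule[OF L_alg]) (simp_all add: hom_closed assms)
  finally show ?thesis
    using assms by (simp add: act_tens two_sided_def coord_mult hom_closed)
qed

lemma coord_hom_kdiff_gen:
  assumes "i + j = Suc n"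
  shows "coord (h (kdiff (gen i j))) = cobdry (\<lambda>i j. coord (h (gen i j))) i j"
proof -
  have x: "coord (h (x_part i' j)) = (\<lambda>(a, b). if a then \<alpha> i' j b * coord (h (gen i' j)) (False, b) else 0)"
    if "i' + j = n" for i'
    unfolding x_part_def using that
    by (subst coord_hom_add)
       (auto simp: two_sided_homog gen_homog coord_hom_two_sided lmul_def xmul_def ymul_def basis_elem_def \<alpha>_def
         fun_eq_iff algebra_simps)
  have y: "coord (h (y_part i j')) = (\<lambda>(a, b). if b then \<beta> i j' a * coord (h (gen i j')) (a, False) else 0)"
    if "i + j' = n" for j'
    unfolding y_part_def using that
    by (subst coord_hom_add)
       (auto simp: two_sided_homog gen_homog coord_hom_two_sided lmul_def xmul_def ymul_def basis_elem_def \<beta>_def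
         fun_eq_iff algebra_simps power_add)
  show ?thesis
  proof (cases i)
    case 0
    then obtain j' where "j = Suc j'" using assms by (cases j) auto
    thus ?thesis using 0 assms y[of j'] by (auto simp: kdiff_gen cobdry_def fun_eq_iff)
  next
    case i: (Suc i')
    show ?thesis
    proof (cases j)
      case 0
      thus ?thesis using i assms x[of i'] by (auto simp: kdiff_gen cobdry_def fun_eq_iff)
    next
      case j: (Suc j')
      have "coord (h (kdiff (gen i j))) = (\<lambda>l. coord (h (x_part i' j)) l + coord (h (y_part i j')) l)"
        unfolding kdiff_gen i j nat.case using assms i j
        by (intro coord_hom_add x_part_homog y_part_homog) auto
      thus ?thesis using i j assms x[of i'] y[of j'] by (auto simp: cobdry_def fun_eq_iff)
    qed
  qed
qed

end

section \<open>Cochains as families of coordinates\<close>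

lemma kmod_hom_exists:
  "\<exists>g\<in>left_module_hom E (kmod n) N. \<forall>i j. i + j = n \<longrightarrow> coord (g (gen i j)) = G i j"
proof -
  have "\<forall>w\<in>gens n. \<exists>U. U \<in> carrier L \<and> (\<forall>i j. w = gen i j \<longrightarrow> coord U = G i j)"
  proof
    fix w assume "w \<in> gens n"
    then obtain i j where "w = gen i j" by (auto simp: gens_iff)
    thus "\<exists>U. U \<in> carrier L \<and> (\<forall>i j. w = gen i j \<longrightarrow> coord U = G i j)"
      by (intro exI[of _ "elt (G i j)"]) (auto simp: gen_eq_iff)
  qed
  then obtain f where f: "\<And>w. w \<in> gens n \<Longrightarrow> f w \<in> carrier L" "\<And>w i j. w \<in> gens n \<Longrightarrow> w = gen i j \<Longrightarrow> coord (f w) = G i j"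
    by metis
  obtain g where "g \<in> left_module_hom E (kmod n) N" "\<And>w. w \<in> gens n \<Longrightarrow> g w = f w"
    using free_on_hom_exists[OF left_module_kmod left_module_N free_on_kmod, of n f] f(1) by auto
  moreover have "gen i j \<in> gens n" if "i + j = n" for i j using that by (auto simp: gens_iff)
  ultimately show ?thesis using f(2) by (intro bexI[of _ g]) auto
qed

lemma kmod_hom_eqI:
  assumes "f \<in> left_module_hom E (kmod n) N" "g \<in> left_module_hom E (kmod n) N"
    and "\<And>i j. i + j = n \<Longrightarrow> coord (f (gen i j)) = coord (g (gen i j))"
  shows "f = g"
proof (rule free_on_hom_unique[OF left_module_kmod left_module_N free_on_kmod assms(1,2)])
  fix w assume "w \<in> gens n"
  then obtain i j where "w = gen i j" "i + j = n" by (auto simp: gens_iff)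
  thus "f w = g w" using assms(3)[of i j] hom_closed[OF assms(1) gen_homog] hom_closed[OF assms(2) gen_homog]
    by (intro coord_eqI) auto
qed

lemma kd_hom: "kd n \<in> left_module_hom E (kmod (Suc n)) (kmod n)"
  using resolution_hom(2)[OF left_module_N free_resolution_kmod] .

lemma compose_kd_hom:
  "g \<in> left_module_hom E (kmod n) N \<Longrightarrow> compose (homog (Suc n)) g (kd n) \<in> left_module_hom E (kmod (Suc n)) N"
  using left_module_hom_compose[OF left_module_kmod kd_hom] by simp

lemma coord_compose_kd:
  assumes "g \<in> left_module_hom E (kmod n) N" "i + j = Suc n"
  shows "coord (compose (homog (Suc n)) g (kd n) (gen i j)) = cobdry (\<lambda>i j. coord (g (gen i j))) i j"
  using coord_hom_kdiff_gen[OF assms] by (simp add: compose_def kd_def gen_homog[OF assms(2)])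

lemma cobdry_cong: "i + j = Suc n \<Longrightarrow> (\<And>i j. i + j = n \<Longrightarrow> G i j = H i j) \<Longrightarrow> cobdry G i j = cobdry H i j"
  by (auto simp: cobdry_def fun_eq_iff split: nat.splits)

text \<open>The converse uses freeness: the composite with \<open>kd\<close> and the zero
  homomorphism \<open>f\<^sub>0\<close> agree on generators, hence everywhere.\<close>

lemma cocycles_kmod_iff:
  assumes g: "g \<in> left_module_hom E (kmod n) N"
  shows "g \<in> cocycles E kmod kd N n \<longleftrightarrow> (\<forall>i j. i + j = Suc n \<longrightarrow> cobdry (\<lambda>i j. coord (g (gen i j))) i j = (\<lambda>l. 0))"
proof
  assume c: "g \<in> cocycles E kmod kd N n"
  show "\<forall>i j. i + j = Suc n \<longrightarrow> cobdry (\<lambda>i j. coord (g (gen i j))) i j = (\<lambda>l. 0)"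
  proof clarify
    fix i j assume ij: "i + j = Suc n"
    hence "g (kd n (gen i j)) = \<zero>\<^bsub>L\<^esub>" using cocyclesD(2)[OF c, of "gen i j"] by (simp add: gen_homog)
    thus "cobdry (\<lambda>i j. coord (g (gen i j))) i j = (\<lambda>l. 0)"
      using coord_compose_kd[OF g ij] by (simp add: compose_def gen_homog[OF ij])
  qed
next
  assume z: "\<forall>i j. i + j = Suc n \<longrightarrow> cobdry (\<lambda>i j. coord (g (gen i j))) i j = (\<lambda>l. 0)"
  obtain f\<^sub>0 where f0: "f\<^sub>0 \<in> left_module_hom E (kmod (Suc n)) N" "\<And>v. v \<in> homog (Suc n) \<Longrightarrow> f\<^sub>0 v = \<zero>\<^bsub>L\<^esub>"
  proof -
    interpret N: left_module E N by (rule left_module_N)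
    have "restrict (\<lambda>v. \<zero>\<^bsub>L\<^esub>) (carrier (kmod (Suc n))) \<in> left_module_hom E (kmod (Suc n)) N"
      using N.smult_null_r by (intro left_module_homI[OF _ _ _ left_module_kmod]) simp_all
    thus ?thesis using that by simp
  qed
  have eq: "compose (homog (Suc n)) g (kd n) = f\<^sub>0"
    by (rule kmod_hom_eqI[OF compose_kd_hom[OF g] f0(1)]) (use z in \<open>simp add: coord_compose_kd[OF g] f0(2) gen_homog\<close>)
  have "g (kd n v) = \<zero>\<^bsub>L\<^esub>" if "v \<in> homog (Suc n)" for v
    using fun_cong[OF eq, of v] that f0(2)[OF that] by (simp add: compose_def)
  thus "g \<in> cocycles E kmod kd N n" by (intro cocyclesI g) simp
qed

text \<open>From here on no modules are involved: vanishing of a Hochschild group becomes exactness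
  of an explicit complex of coordinate families.\<close>

lemma HH_trivial_iff:
  "carrier (HH L (Suc n)) = {\<one>\<^bsub>HH L (Suc n)\<^esub>} \<longleftrightarrow>
    (\<forall>G. (\<forall>i j. i + j = Suc (Suc n) \<longrightarrow> cobdry G i j = (\<lambda>l. 0)) \<longrightarrow>
      (\<exists>H. \<forall>i j. i + j = Suc n \<longrightarrow> cobdry H i j = G i j))"
  unfolding HH_def Ext_trivial_iff[OF left_module_N left_module_N free_resolution_kmod]
proof (intro iffI allI impI subsetI)
  fix G assume sub: "cocycles E kmod kd N (Suc n) \<subseteq> coboundaries E kmod kd N (Suc n)"
    and z: "\<forall>i j. i + j = Suc (Suc n) \<longrightarrow> cobdry G i j = (\<lambda>l. 0)"
  obtain g where g: "g \<in> left_module_hom E (kmod (Suc n)) N" "\<And>i j. i + j = Suc n \<Longrightarrow> coord (g (gen i j)) = G i j"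
    using kmod_hom_exists by metis
  have "g \<in> cocycles E kmod kd N (Suc n)"
    unfolding cocycles_kmod_iff[OF g(1)]
  proof (intro allI impI)
    fix i j assume ij: "i + j = Suc (Suc n)"
    have "cobdry (\<lambda>i j. coord (g (gen i j))) i j = cobdry G i j" using ij g(2) by (rule cobdry_cong)
    thus "cobdry (\<lambda>i j. coord (g (gen i j))) i j = (\<lambda>l. 0)" using z ij by simp
  qed
  then obtain f where f: "f \<in> left_module_hom E (kmod n) N" "\<forall>v\<in>homog (Suc n). g v = f (kd n v)"
    using sub coboundariesD[of g E kmod kd N n] by auto
  have "cobdry (\<lambda>i j. coord (f (gen i j))) i j = G i j" if ij: "i + j = Suc n" for i j
    using coord_compose_kd[OF f(1) ij] g(2)[OF ij] f(2) by (simp add: compose_def gen_homog[OF ij])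
  thus "\<exists>H. \<forall>i j. i + j = Suc n \<longrightarrow> cobdry H i j = G i j" by blast
next
  fix g assume h: "\<forall>G. (\<forall>i j. i + j = Suc (Suc n) \<longrightarrow> cobdry G i j = (\<lambda>l. 0)) \<longrightarrow>
      (\<exists>H. \<forall>i j. i + j = Suc n \<longrightarrow> cobdry H i j = G i j)"
    and c: "g \<in> cocycles E kmod kd N (Suc n)"
  note g = cocyclesD(1)[OF c]
  obtain H where H: "\<And>i j. i + j = Suc n \<Longrightarrow> cobdry H i j = coord (g (gen i j))"
    using h c unfolding cocycles_kmod_iff[OF g] by blast
  obtain f where f: "f \<in> left_module_hom E (kmod n) N" "\<And>i j. i + j = n \<Longrightarrow> coord (f (gen i j)) = H i j"
    using kmod_hom_exists by metis
  have "g = compose (homog (Suc n)) f (kd n)"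
  proof (rule kmod_hom_eqI[OF g compose_kd_hom[OF f(1)]])
    fix i j assume ij: "i + j = Suc n"
    show "coord (g (gen i j)) = coord (compose (homog (Suc n)) f (kd n) (gen i j))"
      unfolding coord_compose_kd[OF f(1) ij] H[OF ij, symmetric] using ij f(2)[symmetric] by (rule cobdry_cong)
  qed
  thus "g \<in> coboundaries E kmod kd N (Suc n)" using f(1) by auto
qed

section \<open>The coefficients of the squares and the range of vanishing\<close>

lemma inverse_t: "inverse t = - q" by (simp add: t_def)

definition "A i j = 1 - (-1) ^ (i + j) * q ^ j"
definition "C i j = q ^ i - (-1) ^ (i + j)"

lemma inverse_t_power: "inverse t ^ Suc n * t = inverse t ^ n"
  using t_nz by simp

text \<open>Passing from j to j + 1 is offset by the extra factor t, so opposite arrows of a square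
  have the same coefficient up to sign. The exceptions, j = 0 for \<alpha> and i = 0 for \<beta>,
  are the two-term complexes.\<close>

lemma \<alpha>_A: "\<alpha> i j False = A i j" "\<alpha> i (Suc j) True = A i j" "\<alpha> i 0 True = 1 - (-1) ^ i * t"
proof -
  show *: "\<alpha> i j False = A i j"
    by (simp add: \<alpha>_def A_def inverse_t power_add power_minus[of q])
  have "\<alpha> i (Suc j) True = 1 - (-1) ^ i * (inverse t ^ Suc j * t)" by (simp add: \<alpha>_def mult.assoc)
  also have "\<dots> = \<alpha> i j False" unfolding inverse_t_power by (simp add: \<alpha>_def)
  finally show "\<alpha> i (Suc j) True = A i j" using * by simp
qed (simp add: \<alpha>_def)

lemma \<beta>_C: "\<beta> i j False = C i j" "\<beta> (Suc i) j True = - C i j" "\<beta> 0 j True = t - (-1) ^ j"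
proof -
  have "\<beta> i j False = ((-1) ^ i * (-1) ^ i) * q ^ i - (-1) ^ (i + j)"
    by (simp add: \<beta>_def inverse_t power_minus[of q] power_add right_diff_distrib mult.assoc)
  thus *: "\<beta> i j False = C i j" by (simp add: C_def flip: power_mult_distrib)
  have "\<beta> (Suc i) j True = - ((-1) ^ i * (inverse t ^ Suc i * t - (-1) ^ j))" by (simp add: \<beta>_def)
  also have "\<dots> = - \<beta> i j False" unfolding inverse_t_power by (simp add: \<beta>_def)
  finally show "\<beta> (Suc i) j True = - C i j" using * by simp
qed (simp add: \<beta>_def)

lemma neg_one_power_cases: "(-1) ^ m = (1 :: 'k) \<or> (-1) ^ m = (-1 :: 'k)"
  by (induction m) auto

context
  fixes M :: nat
  assumes M: "1 \<le> M" and q1: "\<And>k. 0 < k \<Longrightarrow> k \<le> M \<Longrightarrow> q ^ (2 * k) \<noteq> 1"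
begin

lemma q_power: "0 < k \<Longrightarrow> k \<le> M \<Longrightarrow> q ^ k \<noteq> 1 \<and> q ^ k \<noteq> -1"
  using q1[of k] by (auto simp: power_even_eq)

lemma A_nz: "0 < j \<Longrightarrow> j \<le> M \<Longrightarrow> A i j \<noteq> 0"
proof -
  assume "0 < j" "j \<le> M"
  hence "1 - q ^ j \<noteq> 0" "1 + q ^ j \<noteq> 0" using q_power[of j] by (auto simp: add_eq_0_iff)
  moreover have "A i j = 1 - q ^ j \<or> A i j = 1 + q ^ j"
    using neg_one_power_cases[of "i + j"] by (auto simp: A_def)
  ultimately show ?thesis by metis
qed

lemma C_nz: "0 < i \<Longrightarrow> i \<le> M \<Longrightarrow> C i j \<noteq> 0"
proof -
  assume "0 < i" "i \<le> M"
  hence "q ^ i - 1 \<noteq> 0" "q ^ i + 1 \<noteq> 0" using q_power[of i] by (auto simp: eq_neg_iff_add_eq_0)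
  moreover have "C i j = q ^ i - 1 \<or> C i j = q ^ i + 1"
    using neg_one_power_cases[of "i + j"] by (auto simp: C_def)
  ultimately show ?thesis by metis
qed

text \<open>By q t = -1, either value of t would give q = 1 or q = -1.\<close>

lemma t_pm: "t \<noteq> 1" "t \<noteq> -1"
  using q_power[of 1] M qt by auto

lemma \<alpha>_nz: "\<alpha> i 0 True \<noteq> 0" and \<beta>_nz: "\<beta> 0 j True \<noteq> 0"
proof -
  have "\<alpha> i 0 True = 1 - t \<or> \<alpha> i 0 True = 1 + t" "\<beta> 0 j True = t - 1 \<or> \<beta> 0 j True = t + 1"
    using neg_one_power_cases[of i] neg_one_power_cases[of j] unfolding \<alpha>_A \<beta>_C by auto
  moreover have "1 - t \<noteq> 0" "1 + t \<noteq> 0" "t - 1 \<noteq> 0" "t + 1 \<noteq> 0"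
    using t_pm by (auto simp: eq_neg_iff_add_eq_0 add.commute)
  ultimately show "\<alpha> i 0 True \<noteq> 0" "\<beta> 0 j True \<noteq> 0" by metis+
qed

text \<open>The squares that meet degree n + 1 start at (i, j) with i + j equal to n + 1, n or n -
  1. As n >= 2, none of them starts at (0, 0); as n < M, one coefficient is nonzero in each: A if j
  > 0, and C if j = 0.\<close>

lemma cobdry_exact:
  assumes n: "2 \<le> n" "n < M" and z: "\<And>i j. i + j = Suc (Suc n) \<Longrightarrow> cobdry G i j = (\<lambda>l. 0)"
  shows "\<exists>H. \<forall>i j. i + j = Suc n \<longrightarrow> cobdry H i j = G i j"
proof -
  let ?F = False and ?T = True
  \<comment> \<open>For squares starting in degree n + 1 the first map is injective.\<close>
  have 00: "G i j (?F, ?F) = 0" if ij: "i + j = Suc n" for i j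
  proof -
    have 1: "A i j * G i j (?F, ?F) = 0"
      using fun_cong[OF z[of "Suc i" j], of "(?T, ?F)"] ij by (simp add: cobdry_def \<alpha>_A split: nat.splits)
    have 2: "C i j * G i j (?F, ?F) = 0"
      using fun_cong[OF z[of i "Suc j"], of "(?F, ?T)"] ij by (simp add: cobdry_def \<beta>_C split: nat.splits)
    show ?thesis using 1 2 A_nz[of j i] C_nz[of i j] ij n by (cases "0 < j") auto
  qed
  \<comment> \<open>For squares starting in degree n this is the cocycle condition at xy; the minus
    sign in \<open>\<beta>_C\<close> puts the terms on opposite sides.\<close>
  have 11: "A i j * G i (Suc j) (?F, ?T) = C i j * G (Suc i) j (?T, ?F)" if ij: "i + j = n" for i j
    using fun_cong[OF z[of "Suc i" "Suc j"], of "(?T, ?T)"] ij by (simp add: cobdry_def \<alpha>_A \<beta>_C)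
  \<comment> \<open>Here and in \<open>x0\<close>: the sources of the two-term complexes, whose
    differential is injective.\<close>
  have y0: "G 0 (Suc n) (?T, ?F) = 0"
    using fun_cong[OF z[of 0 "Suc (Suc n)"], of "(?T, ?T)"] \<beta>_nz by (simp add: cobdry_def)
  have x0: "G (Suc n) 0 (?F, ?T) = 0"
    using fun_cong[OF z[of "Suc (Suc n)" 0], of "(?T, ?T)"] \<alpha>_nz by (simp add: cobdry_def)
  \<comment> \<open>At 1, divide by whichever of A and C is known to be nonzero. To reach xy, each
    square uses one of its two last arrows and puts 0 on the other: the arrow from y if j' > 0,
    otherwise the arrow from x, whose coefficient is -C. The divisions by \<alpha> and \<beta> serve
    the two-term complexes.\<close>
  define H where "H i j = (\<lambda>l.
    if l = (?F, ?F) then (if 0 < j then G (Suc i) j (?T, ?F) / A i j else G i (Suc j) (?F, ?T) / C i j)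
    else if l = (?F, ?T) then (case j of 0 \<Rightarrow> G (Suc i) 0 (?T, ?T) / \<alpha> i 0 ?T
       | Suc j' \<Rightarrow> if 0 < j' then G (Suc i) j (?T, ?T) / A i j' else 0)
    else if l = (?T, ?F) then (case i of 0 \<Rightarrow> G 0 (Suc j) (?T, ?T) / \<beta> 0 j ?T
       | Suc i' \<Rightarrow> if 0 < j then 0 else - G (Suc i') 1 (?T, ?T) / C i' 0)
    else 0)" for i j
  have A00: "A i j * H i j (?F, ?F) = G (Suc i) j (?T, ?F)" "C i j * H i j (?F, ?F) = G i (Suc j) (?F, ?T)"
    if ij: "i + j = n" for i j
  proof -
    have "0 < j \<Longrightarrow> A i j \<noteq> 0" "j = 0 \<Longrightarrow> C i j \<noteq> 0" using ij n A_nz[of j i] C_nz[of i j] by auto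
    thus "A i j * H i j (?F, ?F) = G (Suc i) j (?T, ?F)" "C i j * H i j (?F, ?F) = G i (Suc j) (?F, ?T)"
      using 11[OF ij] by (auto simp: H_def field_simps)
  qed
  have "cobdry H i j l = G i j l" if ij: "i + j = Suc n" for i j l
  proof -
    obtain a b where l: "l = (a, b)" by (cases l)
    consider "\<not> a" "\<not> b" | "a" "\<not> b" | "\<not> a" "b" | "a" "b" by blast
    thus ?thesis
    proof cases
      case 1 thus ?thesis using 00[OF ij] by (simp add: l cobdry_def split: nat.splits)
    next
      case 2
      show ?thesis
      proof (cases i)
        case 0 thus ?thesis using 2 ij y0 by (simp add: l cobdry_def split: nat.splits)
      next
        case (Suc i') thus ?thesis using 2 ij A00(1)[of i' j] by (simp add: l cobdry_def \<alpha>_A split: nat.splits)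
      qed
    next
      case 3
      show ?thesis
      proof (cases j)
        case 0 thus ?thesis using 3 ij x0 by (simp add: l cobdry_def split: nat.splits)
      next
        case (Suc j') thus ?thesis using 3 ij A00(2)[of i j'] by (simp add: l cobdry_def \<beta>_C split: nat.splits)
      qed
    next
      case 4
      show ?thesis
      proof (cases i)
        case 0 
        then obtain j' where "j = Suc j'" using ij by (cases j) auto
        thus ?thesis using 0 4 \<beta>_nz[of j'] by (simp add: l cobdry_def H_def)
      next
        case i: (Suc i')
        show ?thesis
        proof (cases j)
          case 0 thus ?thesis using i 4 \<alpha>_nz[of i'] by (simp add: l cobdry_def H_def)
        next
          case j: (Suc j')
          show ?thesis
          proof (cases "0 < j'")
            case True
            thus ?thesis using i j 4 ij n A_nz[of j' i'] by (simp add: l cobdry_def H_def \<alpha>_A \<beta>_C)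
          next
            case False
            hence j': "j' = 0" and "n = Suc i'" using i j ij by auto
            hence "C i' 0 \<noteq> 0" using n C_nz[of i' 0] by auto
            thus ?thesis using 4 by (simp add: l cobdry_def H_def \<alpha>_A \<beta>_C i j j')
          qed
        qed
      qed
    qed
  qed
  thus ?thesis by (intro exI[of _ H]) auto
qed

lemma HH_vanishing:
  assumes "3 \<le> n" "n \<le> M" shows "carrier (HH L n) = {\<one>\<^bsub>HH L n\<^esub>}"
proof -
  obtain m where m: "n = Suc m" "2 \<le> m" "m < M" using assms by (cases n) auto
  show ?thesis unfolding m(1) HH_trivial_iff using cobdry_exact[OF m(2,3)] by blast
qed

end

text \<open>The cochain with value 1 on the generator (2r, 0) and 0 on the others of that degree is
  a cocycle, since A and C vanish there. It is no coboundary because the differential never produces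
  a component at 1.\<close>

lemma HH_nonvanishing:
  assumes "0 < r" "q ^ r = 1" shows "carrier (HH L (2 * r)) \<noteq> {\<one>\<^bsub>HH L (2 * r)\<^esub>}"
proof -
  obtain n where n: "2 * r = Suc n" using assms by (cases "2 * r") auto
  define G where "G i j = (if j = 0 then \<delta>\<^sub>1 else (\<lambda>l. 0))" for i j :: nat
  have even: "(-1) ^ Suc n = (1 :: 'k)" "q ^ Suc n = 1"
    unfolding n[symmetric] using assms by (simp, simp add: power_mult mult.commute[of 2])
  have z: "cobdry G i j l = 0" if ij: "i + j = Suc (Suc n)" for i j l
  proof -
    have A: "A (Suc n) 0 = 0" "C (Suc n) 0 = 0" unfolding A_def C_def add_0_right even by simp_all
    obtain a b where l: "l = (a, b)" by (cases l)
    show ?thesis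
      using ij A by (cases i; cases j; cases a; cases b)
        (auto simp: l cobdry_def G_def basis_elem_def \<alpha>_A \<beta>_C split: nat.splits)
  qed
  have "cobdry H (Suc n) 0 \<noteq> G (Suc n) 0" for H
  proof
    assume "cobdry H (Suc n) 0 = G (Suc n) 0"
    from fun_cong[OF this, of "(False, False)"] show False
      by (simp add: cobdry_def G_def basis_elem_def)
  qed
  thus ?thesis unfolding n HH_trivial_iff using z by (metis add_0_right ext)
qed

end

theorem mainTheorem3:
  assumes roots_of_unity: "\<And>(z :: 'k::field alg_closure) m::nat. 0 < m \<Longrightarrow> z ^ m = 1 \<Longrightarrow> z \<in> range to_ac"
  shows "\<forall>N::nat \<ge> 3. \<exists>R::nat. \<forall>r \<ge> R. \<forall>q::'k. primitive_root_of_unity r q \<longrightarrow>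
    (\<forall>n. 3 \<le> n \<and> n \<le> N \<longrightarrow> carrier (HH (\<Lambda> q) n) = {\<one>\<^bsub>HH (\<Lambda> q) n\<^esub>}) \<and>
    (\<exists>n > N. carrier (HH (\<Lambda> q) n) \<noteq> {\<one>\<^bsub>HH (\<Lambda> q) n\<^esub>})"
proof (intro allI impI)
  fix N :: nat assume N: "N \<ge> 3"
  show "\<exists>R::nat. \<forall>r \<ge> R. \<forall>q::'k. primitive_root_of_unity r q \<longrightarrow>
    (\<forall>n. 3 \<le> n \<and> n \<le> N \<longrightarrow> carrier (HH (\<Lambda> q) n) = {\<one>\<^bsub>HH (\<Lambda> q) n\<^esub>}) \<and>
    (\<exists>n > N. carrier (HH (\<Lambda> q) n) \<noteq> {\<one>\<^bsub>HH (\<Lambda> q) n\<^esub>})"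
  proof (intro exI allI impI conjI)
    \<comment> \<open>The bound gives 2k < r whenever k <= N, so that q^(2k) is not 1 for 0 < k <=
      N, as \<open>HH_vanishing\<close> requires.\<close>
    fix r and q :: 'k assume r: "2 * N + 1 \<le> r" and q: "primitive_root_of_unity r q"
    hence q': "0 < r" "q ^ r = 1" "\<And>m. 0 < m \<Longrightarrow> m < r \<Longrightarrow> q ^ m \<noteq> 1"
      by (auto simp: primitive_root_of_unity_def)
    hence "q \<noteq> 0" by (metis power_0_left zero_neq_one less_irrefl)
    then interpret quantum_plane q by unfold_locales
    show "carrier (HH (\<Lambda> q) n) = {\<one>\<^bsub>HH (\<Lambda> q) n\<^esub>}" if "3 \<le> n \<and> n \<le> N" for n
      by (rule HH_vanishing[of N]) (use that N r q'(3) in auto)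
    show "2 * r > N" using r by simp
    show "carrier (HH (\<Lambda> q) (2 * r)) \<noteq> {\<one>\<^bsub>HH (\<Lambda> q) (2 * r)\<^esub>}"
      by (rule HH_nonvanishing[OF q'(1,2)])
  qed
qed

end
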